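(* Let $\Omega$ be a bounded domain in $\mathbb{C}^d$, let $z_1,\dots,z_n\in\Omega$ and $w_1,\dots,w_n\in\mathbb{C}$, and let $\mathcal{A}$ be any unital weak$^*$-closed subalgebra of $H^\infty(\Omega)$. There is a function $\varphi\in\mathcal{A}$ with $\sup_{z\in\Omega}|\varphi(z)|\le 1$ and $\varphi(z_i)=w_i$ for $i=1,\dots,n$ if and only if the matrix $$\left[(1-w_i\overline{w_j})\,k^\nu(z_i,z_j)\right]_{i,j=1}^n$$ is positive semidefinite for every measure of the form $\nu=|f|^2\mu$, where $\mu$ is Lebesgue measure on $\Omega$ and $f\in L^2_a(\Omega)$.
   Context: The Bergman space $L^2_a(\Omega)$ is the space of analytic functions on $\Omega$ which belong to $L^2(\Omega,\mu)$, with the $L^2(\Omega,\mu)$ norm. $H^\infty(\Omega)$ is the algebra of bounded analytic functions on $\Omega$. It is identified isometrically with the algebra of multiplication operators $M_\varphi$, $\varphi\in H^\infty(\Omega)$, on $L^2_a(\Omega)$, and the weak$^*$ topology is the one inherited from $B(L^2_a(\Omega))$. Unital means that $\mathcal{A}$ contains the constant function $1$. For a measure $\nu=|f|^2\mu$, $\mathcal{A}^2(\nu)$ denotes the closure of $\mathcal{A}$ in $L^2(\Omega,\nu)$. If $z\in\Omega$ is such that $\varphi\mapsto\varphi(z)$ ($\varphi\in\mathcal{A}$) extends to a bounded linear functional on $\mathcal{A}^2(\nu)$, let $k^\nu_z\in\mathcal{A}^2(\nu)$ be the vector representing it, so $\varphi(z)=\langle\varphi,k_z^\nu\rangle_{\mathcal{A}^2(\nu)}$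 for $\varphi\in\mathcal{A}$. For two such points put $k^\nu(z,w)=\langle k_w^\nu,k_z^\nu\rangle_{\mathcal{A}^2(\nu)}$. Convention: if the evaluation at $z$ or at $w$ is not bounded in this sense, $k^\nu(z,w)=0$ (equivalently, for each $\nu$ only the indices $i$ for which evaluation at $z_i$ is bounded are used in the matrix). The kernel $k^\nu$ depends on $\mathcal{A}$. *)

theory Defs
  imports "HOL-Analysis.Analysis"
begin

text \<open>The library's \<^const>\<open>analytic_on\<close> is for one complex variable only; in several variables
  analytic means complex differentiable, that is, the Frechet derivative is complex linear.\<close>

definition analytic_in :: "(complex^'d \<Rightarrow> complex) \<Rightarrow> (complex^'d) set \<Rightarrow> bool" where
  "analytic_in f \<Omega> \<longleftrightarrow>
     (\<forall>z\<in>\<Omega>. \<exists>D. (f has_derivative D) (at z) \<and> (\<forall>c v. D (c *s v) = c * D v))"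

definition bounded_domain :: "(complex^'d) set \<Rightarrow> bool" where
  "bounded_domain \<Omega> \<longleftrightarrow> open \<Omega> \<and> connected \<Omega> \<and> \<Omega> \<noteq> {} \<and> bounded \<Omega>"

text \<open>Functions, not classes modulo null sets; the quantities \<open>l2_inner\<close> and \<open>l2_norm\<close> depend only
  on the classes. The inner product is linear in the first argument.\<close>

definition l2_space :: "'a measure \<Rightarrow> ('a \<Rightarrow> complex) set" where
  "l2_space M = {g \<in> borel_measurable M. integrable M (\<lambda>x. (cmod (g x))\<^sup>2)}"

definition l2_inner :: "'a measure \<Rightarrow> ('a \<Rightarrow> complex) \<Rightarrow> ('a \<Rightarrow> complex) \<Rightarrow> complex" where
  "l2_inner M g h = (\<integral>x. g x * cnj (h x) \<partial>M)"

definition l2_norm :: "'a measure \<Rightarrow> ('a \<Rightarrow> complex) \<Rightarrow> real" where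
  "l2_norm M g = sqrt (\<integral>x. (cmod (g x))\<^sup>2 \<partial>M)"

definition l2_closure :: "'a measure \<Rightarrow> ('a \<Rightarrow> complex) set \<Rightarrow> ('a \<Rightarrow> complex) set" where
  "l2_closure M A =
     {g \<in> l2_space M. \<forall>\<epsilon>>0. \<exists>\<phi>\<in>A \<inter> l2_space M. l2_norm M (\<lambda>x. g x - \<phi> x) < \<epsilon>}"

text \<open>A function on \<open>\<Omega>\<close> is represented by its extension by zero to the whole space, so that equality
  of functions on \<open>\<Omega>\<close> is equality in HOL. In particular the constant function 1 on \<open>\<Omega>\<close> is
  \<open>indicator \<Omega>\<close>.\<close>

definition bergman :: "(complex^'d) set \<Rightarrow> (complex^'d \<Rightarrow> complex) set" where
  "bergman \<Omega> = {f \<in> l2_space (lebesgue_on \<Omega>). analytic_in f \<Omega> \<and> (\<forall>z. z \<notin> \<Omega> \<longrightarrow> f z = 0)}"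

definition Hinf :: "(complex^'d) set \<Rightarrow> (complex^'d \<Rightarrow> complex) set" where
  "Hinf \<Omega> = {\<phi>. analytic_in \<phi> \<Omega> \<and> bounded (\<phi> ` \<Omega>) \<and> (\<forall>z. z \<notin> \<Omega> \<longrightarrow> \<phi> z = 0)}"

definition unital_subalgebra ::
    "(complex^'d) set \<Rightarrow> (complex^'d \<Rightarrow> complex) set \<Rightarrow> bool" where
  "unital_subalgebra \<Omega> A \<longleftrightarrow>
     A \<subseteq> Hinf \<Omega> \<and> indicator \<Omega> \<in> A \<and>
     (\<forall>\<phi>\<in>A. \<forall>\<psi>\<in>A. (\<lambda>z. \<phi> z + \<psi> z) \<in> A) \<and>
     (\<forall>c. \<forall>\<phi>\<in>A. (\<lambda>z. c * \<phi> z) \<in> A) \<and>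
     (\<forall>\<phi>\<in>A. \<forall>\<psi>\<in>A. (\<lambda>z. \<phi> z * \<psi> z) \<in> A)"

definition bergman_ops ::
    "(complex^'d) set \<Rightarrow> ((complex^'d \<Rightarrow> complex) \<Rightarrow> (complex^'d \<Rightarrow> complex)) set" where
  "bergman_ops \<Omega> =
     {T \<in> bergman \<Omega> \<rightarrow>\<^sub>E bergman \<Omega>.
        (\<forall>f\<in>bergman \<Omega>. \<forall>g\<in>bergman \<Omega>. T (\<lambda>z. f z + g z) = (\<lambda>z. T f z + T g z)) \<and>
        (\<forall>c. \<forall>f\<in>bergman \<Omega>. T (\<lambda>z. c * f z) = (\<lambda>z. c * T f z)) \<and>
        (\<exists>C. \<forall>f\<in>bergman \<Omega>.
           l2_norm (lebesgue_on \<Omega>) (T f) \<le> C * l2_norm (lebesgue_on \<Omega>) f)}"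

definition square_summable ::
    "(complex^'d) set \<Rightarrow> (nat \<Rightarrow> (complex^'d \<Rightarrow> complex)) \<Rightarrow> bool" where
  "square_summable \<Omega> f \<longleftrightarrow>
     (\<forall>m. f m \<in> bergman \<Omega>) \<and> summable (\<lambda>m. (l2_norm (lebesgue_on \<Omega>) (f m))\<^sup>2)"

text \<open>The weak-star topology of the algebra of bounded operators on a Hilbert space is given by its
  duality with the trace class operators. These are the operators
  \<open>K = (\<Sum>m. \<langle>\<cdot>, g m\<rangle> f m)\<close> with \<open>f\<close> and \<open>g\<close> square summable sequences, and the functional
  \<open>T \<mapsto> tr (T K)\<close> is \<open>T \<mapsto> (\<Sum>m. \<langle>T (f m), g m\<rangle>)\<close>.\<close>

definition trace_functional ::
    "(complex^'d) set \<Rightarrow> (nat \<Rightarrow> (complex^'d \<Rightarrow> complex)) \<Rightarrow> (nat \<Rightarrow> (complex^'d \<Rightarrow> complex)) \<Rightarrow>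
     ((complex^'d \<Rightarrow> complex) \<Rightarrow> (complex^'d \<Rightarrow> complex)) \<Rightarrow> complex" where
  "trace_functional \<Omega> f g T = (\<Sum>m. l2_inner (lebesgue_on \<Omega>) (T (f m)) (g m))"

definition weak_star_ops ::
    "(complex^'d) set \<Rightarrow> ((complex^'d \<Rightarrow> complex) \<Rightarrow> (complex^'d \<Rightarrow> complex)) topology" where
  "weak_star_ops \<Omega> = topology_generated_by
     {{T \<in> bergman_ops \<Omega>. trace_functional \<Omega> f g T \<in> U} | f g U.
        square_summable \<Omega> f \<and> square_summable \<Omega> g \<and> open U}"

definition mult_op ::
    "(complex^'d) set \<Rightarrow> (complex^'d \<Rightarrow> complex) \<Rightarrow> (complex^'d \<Rightarrow> complex) \<Rightarrow> (complex^'d \<Rightarrow> complex)"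
  where "mult_op \<Omega> \<phi> = (\<lambda>f\<in>bergman \<Omega>. (\<lambda>z. \<phi> z * f z))"

definition weak_star_Hinf :: "(complex^'d) set \<Rightarrow> (complex^'d \<Rightarrow> complex) topology" where
  "weak_star_Hinf \<Omega> = pullback_topology (Hinf \<Omega>) (mult_op \<Omega>) (weak_star_ops \<Omega>)"

definition weighted_measure ::
    "(complex^'d) set \<Rightarrow> (complex^'d \<Rightarrow> complex) \<Rightarrow> (complex^'d) measure" where
  "weighted_measure \<Omega> f = density (lebesgue_on \<Omega>) (\<lambda>z. ennreal ((cmod (f z))\<^sup>2))"

text \<open>A functional satisfying the second and third conditions takes equal values on functions that
  agree almost everywhere, so it is a functional on the Hilbert space of classes.\<close>

definition bounded_evaluation ::
    "(complex^'d \<Rightarrow> complex) set \<Rightarrow> (complex^'d) measure \<Rightarrow> complex^'d \<Rightarrow> bool" where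
  "bounded_evaluation A \<nu> z \<longleftrightarrow>
     (\<exists>L. (\<forall>\<phi>\<in>A. L \<phi> = \<phi> z) \<and>
          (\<forall>g\<in>l2_closure \<nu> A. \<forall>h\<in>l2_closure \<nu> A. \<forall>a b :: complex.
             L (\<lambda>x. a * g x + b * h x) = a * L g + b * L h) \<and>
          (\<exists>C. \<forall>g\<in>l2_closure \<nu> A. cmod (L g) \<le> C * l2_norm \<nu> g))"

text \<open>Meaningful only if the evaluation at \<open>z\<close> is bounded; the choice is then unique up to equality
  almost everywhere.\<close>

definition kernel_vector ::
    "(complex^'d \<Rightarrow> complex) set \<Rightarrow> (complex^'d) measure \<Rightarrow> complex^'d \<Rightarrow> (complex^'d \<Rightarrow> complex)"
  where "kernel_vector A \<nu> z = (SOME k. k \<in> l2_closure \<nu> A \<and> (\<forall>\<phi>\<in>A. \<phi> z = l2_inner \<nu> \<phi> k))"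

definition repr_kernel ::
    "(complex^'d \<Rightarrow> complex) set \<Rightarrow> (complex^'d) measure \<Rightarrow> complex^'d \<Rightarrow> complex^'d \<Rightarrow> complex" where
  "repr_kernel A \<nu> z w =
     (if bounded_evaluation A \<nu> z \<and> bounded_evaluation A \<nu> w
      then l2_inner \<nu> (kernel_vector A \<nu> w) (kernel_vector A \<nu> z) else 0)"

definition positive_semidefinite :: "complex^'n^'n \<Rightarrow> bool" where
  "positive_semidefinite M \<longleftrightarrow>
     (\<forall>c::complex^'n. (\<Sum>i\<in>UNIV. \<Sum>j\<in>UNIV. cnj (c $ i) * M $ i $ j * c $ j) \<in> \<real>\<^sub>\<ge>\<^sub>0)"

end

theory Submission
  imports Defs "HOL-Complex_Analysis.Cauchy_Integral_Formula"
begin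

text \<open>If \<open>\<phi>\<close> interpolates with norm at most one, its multiplication operator is a contraction whose
  adjoint maps the kernel vector at \<open>z i\<close> to \<open>cnj (w i)\<close> times itself, and the Pick matrix is the
  defect of that contraction on the kernel vectors.

  For the converse, suppose that some weighted \<open>L\<^sup>2\<close> distance from the unit ball of \<open>L\<^sup>\<infinity>\<close> to the
  interpolants in \<open>A\<close> is positive. Separation gives an integrable \<open>q\<close> such that integration against
  \<open>q\<close> annihilates the functions in \<open>A\<close> vanishing at all nodes, while its value on the interpolants
  exceeds the \<open>L\<^sup>1\<close> norm of \<open>q\<close>. On bounded analytic functions this functional can be written as
  \<open>\<psi> \<mapsto> \<langle>\<psi> x, y\<rangle>\<close> with \<open>x\<close>, \<open>y\<close> in the Bergman space and \<open>\<parallel>x\<parallel> \<parallel>y\<parallel>\<close> as close to the \<open>L\<^sup>1\<close> norm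
  of \<open>q\<close> as desired: every point evaluation is \<open>\<psi> \<mapsto> \<langle>\<psi> u, u\<rangle>\<close> for unit vectors \<open>u\<close> almost
  orthogonal to anything given, so sums of evaluations, which are dense, factor up to a small error,
  and the error is removed by iteration. The Pick condition for \<open>\<bar>x\<bar>\<^sup>2 \<mu>\<close> contradicts the
  separation. Hence all these distances vanish, and a minimal norm argument yields one function of
  modulus at most one that is a limit of interpolants in every weighted norm; such limits are
  weak-star limits.\<close>

subsection \<open>Square integrable functions\<close>

text \<open>The Pick condition speaks only about measures |f|^2 \<mu> with one Bergman function f,
  whereas a separating functional is integration against an arbitrary integrable \<open>q\<close>.
  Bridging this gap shapes the proof: once \<open>q\<close> is replaced by a single pair x, y, the
  functional is bounded on the closure of \<open>A\<close> in L^2(|x|^2 \<mu>), its Riesz vector is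
  a combination of kernel vectors, and the Pick matrix applies to it. The factorization must be
  nearly exact in norm, because the separation exceeds the L^1 norm only by a fixed amount; almost
  orthogonal summands achieve this, since their norms add in squares. Separation takes place in
  weighted Hilbert spaces so that the functional automatically has an integrable density. General
  integrable weights occur because a trace class functional leads to a sum of infinitely many |f
  m|^2. Compactness, separation and Riesz representation have one source, the parallelogram law. Two
  degeneracies remain: \<open>A\<close> may identify nodes, which is met by choosing
  representatives, and evaluations may be unbounded, which is met by showing that every node with a
  nonzero coefficient has a bounded one.\<close>

lemma l2_spaceD:
  assumes "g \<in> l2_space M"
  shows "g \<in> borel_measurable M" "integrable M (\<lambda>x. (cmod (g x))\<^sup>2)"
  using assms by (auto simp: l2_space_def)

lemma integrable_l2_cmod_mult:
  assumes "g \<in> l2_space M" "h \<in> l2_space M"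
  shows "integrable M (\<lambda>x. cmod (g x) * cmod (h x))"
proof (rule Bochner_Integration.integrable_bound)
  show "integrable M (\<lambda>x. (cmod (g x))\<^sup>2 + (cmod (h x))\<^sup>2)"
    using assms by (intro Bochner_Integration.integrable_add l2_spaceD)
  show "(\<lambda>x. cmod (g x) * cmod (h x)) \<in> borel_measurable M"
    using assms[THEN l2_spaceD(1)] by measurable
  have "a * b \<le> a\<^sup>2 + b\<^sup>2" if "a \<ge> 0" "b \<ge> 0" for a b :: real
    using that sum_squares_bound[of a b] zero_le_power2[of a] zero_le_power2[of b] mult_nonneg_nonneg[OF that]
    by linarith
  then show "AE x in M. norm (cmod (g x) * cmod (h x)) \<le> norm ((cmod (g x))\<^sup>2 + (cmod (h x))\<^sup>2)"
    by (auto intro!: AE_I2 simp: norm_mult)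
qed

lemma integrable_l2_mult:
  assumes "g \<in> l2_space M" "h \<in> l2_space M"
  shows "integrable M (\<lambda>x. g x * h x)" "integrable M (\<lambda>x. g x * cnj (h x))"
proof -
  have m: "g \<in> borel_measurable M" "h \<in> borel_measurable M"
    using assms by (auto dest: l2_spaceD)
  have "(\<lambda>x. cnj (h x)) \<in> borel_measurable M"
    using borel_measurable_continuous_onI[of cnj] m(2) by (rule measurable_compose[rotated]) (intro continuous_intros)
  then show "integrable M (\<lambda>x. g x * h x)" "integrable M (\<lambda>x. g x * cnj (h x))"
    using integrable_l2_cmod_mult[OF assms] m
    by (auto intro!: Bochner_Integration.integrable_bound[OF integrable_l2_cmod_mult[OF assms]]
        borel_measurable_times simp: norm_mult)
qed

lemma l2_scale [intro]: "g \<in> l2_space M \<Longrightarrow> (\<lambda>x. c * g x) \<in> l2_space M"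
  by (auto simp: l2_space_def norm_mult power_mult_distrib)

lemma l2_add [intro]:
  assumes "g \<in> l2_space M" "h \<in> l2_space M"
  shows "(\<lambda>x. g x + h x) \<in> l2_space M"
proof -
  have m[measurable]: "g \<in> borel_measurable M" "h \<in> borel_measurable M"
    using assms by (auto dest: l2_spaceD)
  have "integrable M (\<lambda>x. (cmod (g x + h x))\<^sup>2)"
  proof (rule Bochner_Integration.integrable_bound)
    show "integrable M (\<lambda>x. (cmod (g x))\<^sup>2 + (cmod (h x))\<^sup>2 + 2 * (cmod (g x) * cmod (h x)))"
      using assms by (intro Bochner_Integration.integrable_add l2_spaceD
          Bochner_Integration.integrable_mult_right integrable_l2_cmod_mult)
    have "(cmod (a + b))\<^sup>2 \<le> (cmod a)\<^sup>2 + (cmod b)\<^sup>2 + 2 * (cmod a * cmod b)" for a b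
      using power_mono[OF norm_triangle_ineq[of a b], of 2] by (simp add: power2_sum)
    then show "AE x in M. norm ((cmod (g x + h x))\<^sup>2) \<le>
        norm ((cmod (g x))\<^sup>2 + (cmod (h x))\<^sup>2 + 2 * (cmod (g x) * cmod (h x)))"
      by (auto intro!: AE_I2)
  qed measurable
  then show ?thesis by (simp add: l2_space_def)
qed

lemma l2_minus [intro]: "g \<in> l2_space M \<Longrightarrow> (\<lambda>x. - g x) \<in> l2_space M"
  using l2_scale[of g M "-1"] by simp

lemma l2_diff [intro]:
  assumes "g \<in> l2_space M" "h \<in> l2_space M"
  shows "(\<lambda>x. g x - h x) \<in> l2_space M"
  using l2_add[OF assms(1) l2_minus[OF assms(2)]] by simp

lemma l2_zero [intro, simp]: "(\<lambda>x. 0) \<in> l2_space M"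
  by (simp add: l2_space_def)

lemma l2_sum [intro]:
  assumes "\<And>i. i \<in> I \<Longrightarrow> g i \<in> l2_space M"
  shows "(\<lambda>x. \<Sum>i\<in>I. g i x) \<in> l2_space M"
  using assms by (induction I rule: infinite_finite_induct) auto

lemma l2_bounded_mult:
  assumes "g \<in> l2_space M" and [measurable]: "\<phi> \<in> borel_measurable M"
    and "\<And>x. x \<in> space M \<Longrightarrow> cmod (\<phi> x) \<le> B"
  shows "(\<lambda>x. \<phi> x * g x) \<in> l2_space M" "l2_norm M (\<lambda>x. \<phi> x * g x) \<le> B * l2_norm M g"
proof -
  have [measurable]: "g \<in> borel_measurable M" and i: "integrable M (\<lambda>x. B\<^sup>2 * (cmod (g x))\<^sup>2)"
    using assms(1) by (auto dest: l2_spaceD)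
  have le: "(cmod (\<phi> x * g x))\<^sup>2 \<le> B\<^sup>2 * (cmod (g x))\<^sup>2" if "x \<in> space M" for x
    using power_mono[OF assms(3)[OF that], of 2] by (simp add: norm_mult power_mult_distrib mult_right_mono)
  have int: "integrable M (\<lambda>x. (cmod (\<phi> x * g x))\<^sup>2)"
    by (rule Bochner_Integration.integrable_bound[OF i]) (use le in \<open>auto intro!: AE_I2\<close>)
  then show "(\<lambda>x. \<phi> x * g x) \<in> l2_space M"
    by (simp add: l2_space_def)
  have B: "B \<ge> 0" if "space M \<noteq> {}"
    using that assms(3) norm_ge_zero order_trans by blast
  have "(\<integral>x. (cmod (\<phi> x * g x))\<^sup>2 \<partial>M) \<le> (\<integral>x. B\<^sup>2 * (cmod (g x))\<^sup>2 \<partial>M)"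
    by (rule integral_mono[OF int i le])
  then have "l2_norm M (\<lambda>x. \<phi> x * g x) \<le> sqrt (B\<^sup>2 * (\<integral>x. (cmod (g x))\<^sup>2 \<partial>M))"
    unfolding l2_norm_def by simp
  also have "\<dots> = \<bar>B\<bar> * l2_norm M g"
    by (simp add: real_sqrt_mult l2_norm_def)
  also have "\<dots> = B * l2_norm M g"
  \<comment> \<open>\<open>B\<close> is known to be nonnegative only if there is a point; over an
    empty space the norm is 0.\<close>
  proof (cases "space M = {}")
    case True
    have "(\<integral>x. (cmod (g x))\<^sup>2 \<partial>M) = (\<integral>x. 0 \<partial>M)"
      by (rule Bochner_Integration.integral_cong) (use True in auto)
    then show ?thesis by (simp add: l2_norm_def)
  qed (use B in simp)
  finally show "l2_norm M (\<lambda>x. \<phi> x * g x) \<le> B * l2_norm M g" .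
qed

lemma l2_norm_nonneg [simp]: "0 \<le> l2_norm M g"
  by (simp add: l2_norm_def)

lemma l2_norm_power2: "(l2_norm M g)\<^sup>2 = (\<integral>x. (cmod (g x))\<^sup>2 \<partial>M)"
  by (simp add: l2_norm_def)

lemma l2_norm_scale: "l2_norm M (\<lambda>x. c * g x) = cmod c * l2_norm M g"
  by (simp add: l2_norm_def norm_mult power_mult_distrib real_sqrt_mult)

lemma l2_norm_zero [simp]: "l2_norm M (\<lambda>x. 0) = 0"
  by (simp add: l2_norm_def)

lemma l2_norm_minus_commute: "l2_norm M (\<lambda>x. g x - h x) = l2_norm M (\<lambda>x. h x - g x)"
  by (simp add: l2_norm_def norm_minus_commute)

section \<open>Inner product and the Cauchy-Schwarz inequality\<close>

lemma l2_inner_add_left: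
  assumes "g \<in> l2_space M" "h \<in> l2_space M" "k \<in> l2_space M"
  shows "l2_inner M (\<lambda>x. g x + h x) k = l2_inner M g k + l2_inner M h k"
  using assms by (simp add: l2_inner_def distrib_right integrable_l2_mult)

lemma l2_inner_diff_left:
  assumes "g \<in> l2_space M" "h \<in> l2_space M" "k \<in> l2_space M"
  shows "l2_inner M (\<lambda>x. g x - h x) k = l2_inner M g k - l2_inner M h k"
  using assms by (simp add: l2_inner_def left_diff_distrib integrable_l2_mult)

lemma l2_inner_scale_left: "l2_inner M (\<lambda>x. c * g x) k = c * l2_inner M g k"
  by (simp add: l2_inner_def mult.assoc)

lemma l2_inner_cnj: "cnj (l2_inner M g h) = l2_inner M h g"
proof -
  have "cnj (l2_inner M g h) = (\<integral>x. cnj (g x * cnj (h x)) \<partial>M)"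
    unfolding l2_inner_def by (rule Bochner_Integration.integral_cnj[symmetric])
  then show ?thesis by (simp add: l2_inner_def mult.commute)
qed

lemma l2_inner_scale_right: "l2_inner M g (\<lambda>x. c * k x) = cnj c * l2_inner M g k"
  using l2_inner_scale_left[of M c k g, THEN arg_cong[where f = cnj]] by (simp add: l2_inner_cnj)

lemma l2_inner_add_right:
  assumes "g \<in> l2_space M" "h \<in> l2_space M" "k \<in> l2_space M"
  shows "l2_inner M k (\<lambda>x. g x + h x) = l2_inner M k g + l2_inner M k h"
  using l2_inner_add_left[OF assms, THEN arg_cong[where f = cnj]] by (simp add: l2_inner_cnj)

lemma l2_inner_diff_right:
  assumes "g \<in> l2_space M" "h \<in> l2_space M" "k \<in> l2_space M"
  shows "l2_inner M k (\<lambda>x. g x - h x) = l2_inner M k g - l2_inner M k h"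
  using l2_inner_diff_left[OF assms, THEN arg_cong[where f = cnj]] by (simp add: l2_inner_cnj)

lemma l2_inner_sum_left:
  assumes "\<And>i. i \<in> I \<Longrightarrow> g i \<in> l2_space M" "k \<in> l2_space M"
  shows "l2_inner M (\<lambda>x. \<Sum>i\<in>I. g i x) k = (\<Sum>i\<in>I. l2_inner M (g i) k)"
  using assms(1)
proof (induction I rule: infinite_finite_induct)
  case (insert i I)
  then show ?case using assms(2) by (simp add: l2_inner_add_left l2_sum)
qed (auto simp: l2_inner_def)

lemma l2_inner_sum_right:
  assumes "\<And>i. i \<in> I \<Longrightarrow> g i \<in> l2_space M" "k \<in> l2_space M"
  shows "l2_inner M k (\<lambda>x. \<Sum>i\<in>I. g i x) = (\<Sum>i\<in>I. l2_inner M k (g i))"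
  using l2_inner_sum_left[OF assms, THEN arg_cong[where f = cnj]] by (simp add: l2_inner_cnj)

lemma l2_inner_self: "l2_inner M g g = of_real ((l2_norm M g)\<^sup>2)"
proof -
  have "l2_inner M g g = (\<integral>x. complex_of_real ((cmod (g x))\<^sup>2) \<partial>M)"
    unfolding l2_inner_def by (simp add: complex_norm_square[symmetric])
  then show ?thesis by (simp only: integral_complex_of_real l2_norm_power2)
qed

text \<open>Integrates 2ab <= t a^2 + b^2 / t. The optimal t is the quotient of the two norms; both
  are enlarged by a small d so that it is defined and positive even for null functions.\<close>

lemma l2_cauchy_schwarz_integral:
  assumes "g \<in> l2_space M" "h \<in> l2_space M"
  shows "(\<integral>x. cmod (g x) * cmod (h x) \<partial>M) \<le> l2_norm M g * l2_norm M h"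
proof -
  have amgm: "2 * (\<integral>x. cmod (g x) * cmod (h x) \<partial>M) \<le> t * (l2_norm M g)\<^sup>2 + (l2_norm M h)\<^sup>2 / t"
    if "t > 0" for t
  proof -
    have pt: "2 * (cmod a * cmod b) \<le> t * (cmod a)\<^sup>2 + (cmod b)\<^sup>2 / t" for a b
    proof -
      have "0 \<le> (t * cmod a - cmod b)\<^sup>2 / t" using that by simp
      also have "\<dots> = t * (cmod a)\<^sup>2 + (cmod b)\<^sup>2 / t - 2 * (cmod a * cmod b)"
        using that by (simp add: power2_eq_square field_simps)
      finally show ?thesis by simp
    qed
    have "2 * (\<integral>x. cmod (g x) * cmod (h x) \<partial>M) = (\<integral>x. 2 * (cmod (g x) * cmod (h x)) \<partial>M)"
      by simp
    also have "\<dots> \<le> (\<integral>x. t * (cmod (g x))\<^sup>2 + (cmod (h x))\<^sup>2 / t \<partial>M)"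
      using assms by (intro integral_mono pt Bochner_Integration.integrable_add l2_spaceD
          Bochner_Integration.integrable_mult_right integrable_l2_cmod_mult
          Bochner_Integration.integrable_divide)
    also have "\<dots> = t * (l2_norm M g)\<^sup>2 + (l2_norm M h)\<^sup>2 / t"
      using assms[THEN l2_spaceD(2)] by (simp add: l2_norm_power2)
    finally show ?thesis .
  qed
  let ?I = "\<integral>x. cmod (g x) * cmod (h x) \<partial>M" and ?a = "l2_norm M g" and ?b = "l2_norm M h"
  have "?I \<le> ?a * ?b + e" if "e > 0" for e
  proof -
    \<comment> \<open>Since d <= 1, the excess d (a + b + d) is at most d (a + b + 1), hence at most
      e.\<close>
    define d where "d = min 1 (e / (?a + ?b + 1))"
    have ab: "?a \<ge> 0" "?b \<ge> 0" by auto
    have d: "d > 0" "d \<le> 1" "d * (?a + ?b + 1) \<le> e"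
    proof -
      have S: "?a + ?b + 1 > 0" using ab by linarith
      show "d > 0" "d \<le> 1" using that S unfolding d_def by auto
      have "d \<le> e / (?a + ?b + 1)" unfolding d_def by simp
      then show "d * (?a + ?b + 1) \<le> e" using S by (simp add: pos_le_divide_eq)
    qed
    have A: "?a + d > 0" and B: "?b + d > 0" using d ab by linarith+
    have 1: "(?b + d) / (?a + d) * ?a\<^sup>2 \<le> (?b + d) * (?a + d)"
    proof -
      have "(?b + d) / (?a + d) * ?a\<^sup>2 \<le> (?b + d) / (?a + d) * (?a + d)\<^sup>2"
        using A B d ab by (intro mult_left_mono power_mono) auto
      also have "\<dots> = (?b + d) * (?a + d)" using A by (simp add: power2_eq_square)
      finally show ?thesis .
    qed
    have 2: "?b\<^sup>2 / ((?b + d) / (?a + d)) \<le> (?b + d) * (?a + d)"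
    proof -
      have "?b\<^sup>2 / ((?b + d) / (?a + d)) \<le> (?b + d)\<^sup>2 / ((?b + d) / (?a + d))"
        using A B d ab by (intro divide_right_mono power_mono) auto
      also have "\<dots> = (?b + d) * (?a + d)" using A B by (simp add: power2_eq_square)
      finally show ?thesis .
    qed
    have "2 * ?I \<le> 2 * ((?b + d) * (?a + d))"
      using amgm[of "(?b + d) / (?a + d)"] 1 2 A B by (simp add: divide_pos_pos)
    then have "?I \<le> ?a * ?b + d * (?a + ?b + d)" by (simp add: algebra_simps)
    also have "d * (?a + ?b + d) \<le> d * (?a + ?b + 1)" using d by (intro mult_left_mono) auto
    finally show ?thesis using d by linarith
  qed
  then show ?thesis by (rule field_le_epsilon)
qed

lemma l2_cauchy_schwarz:
  assumes "g \<in> l2_space M" "h \<in> l2_space M"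
  shows "cmod (l2_inner M g h) \<le> l2_norm M g * l2_norm M h"
proof -
  have "cmod (l2_inner M g h) \<le> (\<integral>x. cmod (g x * cnj (h x)) \<partial>M)"
    unfolding l2_inner_def by (rule integral_norm_bound)
  also have "\<dots> \<le> l2_norm M g * l2_norm M h"
    using l2_cauchy_schwarz_integral[OF assms] by (simp add: norm_mult)
  finally show ?thesis .
qed

lemma l2_norm_add_power2:
  assumes "g \<in> l2_space M" "h \<in> l2_space M"
  shows "(l2_norm M (\<lambda>x. g x + h x))\<^sup>2 = (l2_norm M g)\<^sup>2 + 2 * Re (l2_inner M g h) + (l2_norm M h)\<^sup>2"
proof -
  have "complex_of_real ((l2_norm M (\<lambda>x. g x + h x))\<^sup>2) =
      l2_inner M (\<lambda>x. g x + h x) (\<lambda>x. g x + h x)"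
    by (simp only: l2_inner_self)
  also have "\<dots> = l2_inner M g g + l2_inner M g h + (cnj (l2_inner M g h) + l2_inner M h h)"
    using assms by (simp add: l2_inner_add_left l2_inner_add_right l2_add l2_inner_cnj)
  finally have "Re (complex_of_real ((l2_norm M (\<lambda>x. g x + h x))\<^sup>2)) =
      Re (l2_inner M g g + l2_inner M g h + (cnj (l2_inner M g h) + l2_inner M h h))"
    by simp
  then show ?thesis by (simp add: l2_inner_self del: of_real_power)
qed

lemma l2_norm_triangle:
  assumes "g \<in> l2_space M" "h \<in> l2_space M"
  shows "l2_norm M (\<lambda>x. g x + h x) \<le> l2_norm M g + l2_norm M h"
proof (rule power2_le_imp_le)
  show "(l2_norm M (\<lambda>x. g x + h x))\<^sup>2 \<le> (l2_norm M g + l2_norm M h)\<^sup>2"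
    using l2_norm_add_power2[OF assms] complex_Re_le_cmod[of "l2_inner M g h"]
      l2_cauchy_schwarz[OF assms] by (simp add: power2_sum)
qed simp

lemma l2_norm_triangle_diff:
  assumes "g \<in> l2_space M" "h \<in> l2_space M" "k \<in> l2_space M"
  shows "l2_norm M (\<lambda>x. g x - k x) \<le> l2_norm M (\<lambda>x. g x - h x) + l2_norm M (\<lambda>x. h x - k x)"
  using l2_norm_triangle[of "\<lambda>x. g x - h x" M "\<lambda>x. h x - k x"] assms by auto

lemma l2_norm_le_add_diff:
  assumes "g \<in> l2_space M" "h \<in> l2_space M"
  shows "l2_norm M g \<le> l2_norm M h + l2_norm M (\<lambda>x. g x - h x)"
  using l2_norm_triangle[of h M "\<lambda>x. g x - h x"] assms by auto

text \<open>Stated with the midpoint, so that in a convex set the last term is controlled by the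
  minimal norm.\<close>

lemma l2_parallelogram:
  assumes "g \<in> l2_space M" "h \<in> l2_space M"
  shows "(l2_norm M (\<lambda>x. g x - h x))\<^sup>2 =
    2 * (l2_norm M g)\<^sup>2 + 2 * (l2_norm M h)\<^sup>2 - 4 * (l2_norm M (\<lambda>x. (g x + h x) / 2))\<^sup>2"
proof -
  have 1: "(l2_norm M (\<lambda>x. g x - h x))\<^sup>2 = (l2_norm M g)\<^sup>2 - 2 * Re (l2_inner M g h) + (l2_norm M h)\<^sup>2"
    using l2_norm_add_power2[OF assms(1) l2_scale[OF assms(2), of "-1"]]
      l2_norm_scale[of M "-1" h] l2_inner_scale_right[of M g "-1" h] by simp
  have "4 * (l2_norm M (\<lambda>x. (g x + h x) / 2))\<^sup>2 = (l2_norm M (\<lambda>x. g x + h x))\<^sup>2"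
  proof -
    have "l2_norm M (\<lambda>x. g x + h x) = l2_norm M (\<lambda>x. 2 * ((g x + h x) / 2))"
      by (rule arg_cong[where f = "l2_norm M"]) (rule ext, simp add: field_simps)
    also have "\<dots> = 2 * l2_norm M (\<lambda>x. (g x + h x) / 2)" by (subst l2_norm_scale) simp
    finally show ?thesis by (simp only: power_mult_distrib) simp
  qed
  then show ?thesis
    using 1 l2_norm_add_power2[OF assms] by linarith
qed

section \<open>Finite measures, limits and completeness\<close>

lemma l2_finite_bounded:
  assumes "finite_measure M" and [measurable]: "g \<in> borel_measurable M"
    and "\<And>x. x \<in> space M \<Longrightarrow> cmod (g x) \<le> B"
  shows "g \<in> l2_space M"
proof -
  interpret finite_measure M by fact
  have "(cmod (g x))\<^sup>2 \<le> B\<^sup>2" if "x \<in> space M" for x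
    using assms(3)[OF that] by (simp add: power_mono)
  then have "integrable M (\<lambda>x. (cmod (g x))\<^sup>2)"
    by (intro integrable_const_bound[of _ "B\<^sup>2"]) auto
  then show ?thesis by (simp add: l2_space_def)
qed

lemma l2_norm_one: "finite_measure M \<Longrightarrow> l2_norm M (\<lambda>x. 1) = sqrt (measure M (space M))"
  by (simp add: l2_norm_def)

lemma integrable_l2:
  assumes "finite_measure M" "g \<in> l2_space M"
  shows "integrable M g" "(\<integral>x. cmod (g x) \<partial>M) \<le> l2_norm M g * sqrt (measure M (space M))"
proof -
  have 1: "(\<lambda>x. 1) \<in> l2_space M"
    by (rule l2_finite_bounded[OF assms(1), of _ 1]) auto
  show "integrable M g" using integrable_l2_mult(1)[OF assms(2) 1] by simp
  show "(\<integral>x. cmod (g x) \<partial>M) \<le> l2_norm M g * sqrt (measure M (space M))"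
    using l2_cauchy_schwarz_integral[OF assms(2) 1] l2_norm_one[OF assms(1)] by simp
qed

lemma l2_fatou:
  assumes "\<And>n. s n \<in> l2_space M" "\<And>n. l2_norm M (s n) \<le> C"
    and [measurable]: "g \<in> borel_measurable M" and "AE x in M. (\<lambda>n. s n x) \<longlonglongrightarrow> g x"
  shows "g \<in> l2_space M" "l2_norm M g \<le> C"
proof -
  have C: "C \<ge> 0" using assms(2)[of 0] l2_norm_nonneg order_trans by blast
  have m[measurable]: "s n \<in> borel_measurable M" for n
    using assms(1) by (auto dest: l2_spaceD)
  have lim: "AE x in M. ennreal ((cmod (g x))\<^sup>2) = liminf (\<lambda>n. ennreal ((cmod (s n x))\<^sup>2))"
    using assms(4)
  proof eventually_elim
    case (elim x)
    then have "(\<lambda>n. ennreal ((cmod (s n x))\<^sup>2)) \<longlonglongrightarrow> ennreal ((cmod (g x))\<^sup>2)"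
      by (intro tendsto_ennrealI tendsto_intros)
    then show ?case by (rule lim_imp_Liminf[OF sequentially_bot, symmetric])
  qed
  have b: "(\<integral>\<^sup>+x. ennreal ((cmod (s n x))\<^sup>2) \<partial>M) \<le> ennreal (C\<^sup>2)" for n
  proof -
    have "(\<integral>\<^sup>+x. ennreal ((cmod (s n x))\<^sup>2) \<partial>M) = ennreal ((l2_norm M (s n))\<^sup>2)"
      unfolding l2_norm_power2 by (rule nn_integral_eq_integral) (use assms(1) in \<open>auto dest: l2_spaceD\<close>)
    then show ?thesis using assms(2)[of n] by (simp add: ennreal_leI power_mono)
  qed
  have "(\<integral>\<^sup>+x. ennreal ((cmod (g x))\<^sup>2) \<partial>M) = (\<integral>\<^sup>+x. liminf (\<lambda>n. ennreal ((cmod (s n x))\<^sup>2)) \<partial>M)"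
    by (rule nn_integral_cong_AE[OF lim])
  also have "\<dots> \<le> liminf (\<lambda>n. \<integral>\<^sup>+x. ennreal ((cmod (s n x))\<^sup>2) \<partial>M)"
    by (rule nn_integral_liminf) measurable
  also have "\<dots> \<le> ennreal (C\<^sup>2)"
    using Liminf_mono[of "\<lambda>n. \<integral>\<^sup>+x. ennreal ((cmod (s n x))\<^sup>2) \<partial>M" "\<lambda>n. ennreal (C\<^sup>2)" sequentially]
      b by (simp add: Liminf_const)
  finally have le: "(\<integral>\<^sup>+x. ennreal ((cmod (g x))\<^sup>2) \<partial>M) \<le> ennreal (C\<^sup>2)" .
  have int: "integrable M (\<lambda>x. (cmod (g x))\<^sup>2)"
    by (rule integrableI_bounded) (use le in \<open>auto intro: le_less_trans\<close>)
  then show "g \<in> l2_space M" by (simp add: l2_space_def)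
  have "ennreal ((l2_norm M g)\<^sup>2) \<le> ennreal (C\<^sup>2)"
    using le nn_integral_eq_integral[OF int] by (simp add: l2_norm_power2)
  then have "(l2_norm M g)\<^sup>2 \<le> C\<^sup>2" by (simp add: ennreal_le_iff)
  then show "l2_norm M g \<le> C" using C by (rule power2_le_imp_le)
qed

lemma l2_AE_subseq:
  assumes "\<And>n. s n \<in> l2_space M" "g \<in> l2_space M"
    and "(\<lambda>n. l2_norm M (\<lambda>x. s n x - g x)) \<longlonglongrightarrow> 0"
  shows "\<exists>r::nat\<Rightarrow>nat. strict_mono r \<and> (AE x in M. (\<lambda>n. s (r n) x) \<longlonglongrightarrow> g x)"
proof -
  have "\<exists>r::nat\<Rightarrow>nat. strict_mono r \<and> (AE x in M. (\<lambda>n. (cmod (s (r n) x - g x))\<^sup>2) \<longlonglongrightarrow> 0)"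
  proof (rule tendsto_L1_AE_subseq)
    show "integrable M (\<lambda>x. (cmod (s n x - g x))\<^sup>2)" for n
      using assms by (intro l2_spaceD(2)) auto
    have "(\<lambda>n. (l2_norm M (\<lambda>x. s n x - g x))\<^sup>2) \<longlonglongrightarrow> 0\<^sup>2"
      by (intro tendsto_power assms)
    then show "(\<lambda>n. \<integral>x. norm ((cmod (s n x - g x))\<^sup>2) \<partial>M) \<longlonglongrightarrow> 0"
      by (simp add: l2_norm_power2)
  qed
  then obtain r :: "nat \<Rightarrow> nat" where r: "strict_mono r"
    "AE x in M. (\<lambda>n. (cmod (s (r n) x - g x))\<^sup>2) \<longlonglongrightarrow> 0"
    by blast
  from r(2) have "AE x in M. (\<lambda>n. s (r n) x) \<longlonglongrightarrow> g x"
  proof eventually_elim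
    case (elim x)
    from tendsto_real_sqrt[OF elim] have "(\<lambda>n. cmod (s (r n) x - g x)) \<longlonglongrightarrow> 0" by simp
    then show ?case by (simp add: tendsto_norm_zero_iff LIM_zero_iff)
  qed
  with r(1) show ?thesis by blast
qed

text \<open>Riesz-Fischer. Along a subsequence the increments have norm at most 2^-k; finiteness of
  the measure turns this into summable L^1 norms, so the subsequence converges almost
  everywhere.\<close>

lemma l2_complete:
  assumes fin: "finite_measure M" and s: "\<And>n. s n \<in> l2_space M"
    and cauchy: "\<And>e. e > 0 \<Longrightarrow> \<exists>N. \<forall>m\<ge>N. \<forall>n\<ge>N. l2_norm M (\<lambda>x. s m x - s n x) < e"
  shows "\<exists>g\<in>l2_space M. (\<lambda>n. l2_norm M (\<lambda>x. s n x - g x)) \<longlonglongrightarrow> 0"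
proof -
  have "\<exists>r. \<forall>k::nat. (\<forall>m\<ge>r k. \<forall>n\<ge>r k. l2_norm M (\<lambda>x. s m x - s n x) < (1/2)^k) \<and> r k < r (Suc k)"
  proof (rule dependent_nat_choice)
    show "\<exists>x. \<forall>m\<ge>x. \<forall>n\<ge>x. l2_norm M (\<lambda>x. s m x - s n x) < (1/2)^0"
      by (rule cauchy) simp
    fix x n
    obtain N where N: "\<forall>i\<ge>N. \<forall>j\<ge>N. l2_norm M (\<lambda>x. s i x - s j x) < (1/2)^(Suc n)"
      using cauchy[of "(1/2)^(Suc n)"] by auto
    then show "\<exists>y. (\<forall>i\<ge>y. \<forall>j\<ge>y. l2_norm M (\<lambda>x. s i x - s j x) < (1/2)^(Suc n)) \<and> x < y"
      by (intro exI[of _ "max N (Suc x)"]) auto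
  qed
  then obtain r :: "nat \<Rightarrow> nat" where
    r: "\<And>k m n. m \<ge> r k \<Longrightarrow> n \<ge> r k \<Longrightarrow> l2_norm M (\<lambda>x. s m x - s n x) < (1/2)^k"
      "\<And>k. r k < r (Suc k)"
    by blast
  have mono: "strict_mono r" using r(2) by (simp add: strict_mono_Suc_iff)
  define d where "d k x = s (r (Suc k)) x - s (r k) x" for k x
  have d: "d k \<in> l2_space M" for k unfolding d_def using s by auto
  have dn: "l2_norm M (d k) \<le> (1/2)^k" for k
    unfolding d_def using r(1)[of k "r (Suc k)" "r k"] r(2)[of k] by (simp add: less_imp_le)
  let ?B = "sqrt (measure M (space M))"
  have d1: "integrable M (d k)" "(\<integral>x. cmod (d k x) \<partial>M) \<le> (1/2)^k * ?B" for k
    using integrable_l2[OF fin d[of k]] dn[of k] mult_right_mono[OF dn[of k], of ?B]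
    by (auto intro: order_trans)
  have "(\<integral>\<^sup>+x. (\<Sum>k. ennreal (cmod (d k x))) \<partial>M) = (\<Sum>k. \<integral>\<^sup>+x. ennreal (cmod (d k x)) \<partial>M)"
    by (rule nn_integral_suminf) (use d1(1) in auto)
  also have "\<dots> = (\<Sum>k. ennreal (\<integral>x. cmod (d k x) \<partial>M))"
    by (intro suminf_cong nn_integral_eq_integral) (use d1 in auto)
  also have "\<dots> \<le> (\<Sum>k. ennreal ((1/2)^k * ?B))"
    by (intro suminf_le ennreal_leI d1(2) summableI)
  also have "\<dots> < \<infinity>"
  proof -
    have "summable (\<lambda>k. (1/2::real)^k * ?B)" by (intro summable_mult2 summable_geometric) simp
    then have "(\<Sum>k. ennreal ((1/2)^k * ?B)) \<noteq> top" by (rule ennreal_suminf_neq_top) simp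
    then show ?thesis by (simp add: less_top)
  qed
  finally have "AE x in M. (\<Sum>k. ennreal (cmod (d k x))) \<noteq> \<infinity>"
    using d1(1) by (intro nn_integral_PInf_AE) auto
  then have "AE x in M. convergent (\<lambda>k. s (r k) x)"
  proof eventually_elim
    case (elim x)
    then have "summable (\<lambda>k. cmod (d k x))"
      by (intro summable_suminf_not_top) auto
    then have "summable (\<lambda>k. d k x)" by (rule summable_norm_cancel)
    then have "convergent (\<lambda>n. \<Sum>k<n. d k x)" by (simp add: summable_iff_convergent)
    moreover have "(\<Sum>k<n. d k x) = s (r n) x - s (r 0) x" for n
      unfolding d_def by (rule sum_lessThan_telescope)
    ultimately have "convergent (\<lambda>n. (s (r n) x - s (r 0) x) + s (r 0) x)"
      by (intro convergent_add) (auto simp: convergent_const)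
    then show ?case by simp
  qed
  then have lim: "AE x in M. (\<lambda>k. s (r k) x) \<longlonglongrightarrow> lim (\<lambda>k. s (r k) x)"
    by eventually_elim (simp add: convergent_LIMSEQ_iff)
  define g where "g x = lim (\<lambda>k. s (r k) x)" for x
  have [measurable]: "s n \<in> borel_measurable M" for n using s by (auto dest: l2_spaceD)
  have gm[measurable]: "g \<in> borel_measurable M" unfolding g_def by measurable
  \<comment> \<open>Fatou applied to \<open>s n - s (r (i + k))\<close> as i grows turns the Cauchy
    estimate into a distance from the limit.\<close>
  have key: "(\<lambda>x. s n x - g x) \<in> l2_space M \<and> l2_norm M (\<lambda>x. s n x - g x) \<le> (1/2)^k" if "n \<ge> r k" for n k
  proof -
    have 1: "(\<lambda>x. s n x - s (r (i + k)) x) \<in> l2_space M" for i using s by auto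
    have 2: "l2_norm M (\<lambda>x. s n x - s (r (i + k)) x) \<le> (1/2)^k" for i
      using r(1)[OF that, of "r (i+k)"] mono by (simp add: less_imp_le strict_mono_less_eq)
    have 3: "AE x in M. (\<lambda>i. s n x - s (r (i + k)) x) \<longlonglongrightarrow> s n x - g x"
      using lim unfolding g_def
      by eventually_elim (intro tendsto_intros LIMSEQ_ignore_initial_segment)
    show ?thesis using l2_fatou[OF 1 2 _ 3] by auto
  qed
  have "g \<in> l2_space M"
    using l2_diff[OF s[of "r 0"], of "\<lambda>x. s (r 0) x - g x"] key[of 0 "r 0"] by auto
  moreover have "(\<lambda>n. l2_norm M (\<lambda>x. s n x - g x)) \<longlonglongrightarrow> 0"
  proof (rule LIMSEQ_I)
    fix e :: real assume "e > 0"
    then obtain k where k: "(1/2)^k < e" using real_arch_pow_inv[of e "1/2"] by auto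
    then show "\<exists>no. \<forall>n\<ge>no. norm (l2_norm M (\<lambda>x. s n x - g x) - 0) < e"
      using key[of k] by (intro exI[of _ "r k"]) force
  qed
  ultimately show ?thesis by blast
qed

text \<open>Replaces weak compactness of balls. Let s be the supremum of the minimal squared norms
  of the sets. Near minimisers taken from sets whose minimum is close to s are close to each other:
  a common subset has a minimum that is no smaller and still at most s, so midpoints cannot be much
  shorter. They form a Cauchy sequence, and its limit is near every set of the family.\<close>

lemma l2_directed_convex:
  fixes \<K> :: "('a \<Rightarrow> complex) set set"
  assumes fin: "finite_measure M" and ne: "\<K> \<noteq> {}"
    and sub: "\<And>K. K \<in> \<K> \<Longrightarrow> K \<subseteq> l2_space M"
    and mid: "\<And>K g h. K \<in> \<K> \<Longrightarrow> g \<in> K \<Longrightarrow> h \<in> K \<Longrightarrow> (\<lambda>x. (g x + h x) / 2) \<in> K"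
    and dir: "\<And>K L. K \<in> \<K> \<Longrightarrow> L \<in> \<K> \<Longrightarrow> \<exists>N\<in>\<K>. N \<subseteq> K \<inter> L"
    and bdd: "\<And>K. K \<in> \<K> \<Longrightarrow> \<exists>g\<in>K. l2_norm M g \<le> C"
  shows "\<exists>g\<in>l2_space M. \<forall>K\<in>\<K>. \<forall>e>0. \<exists>h\<in>K. l2_norm M (\<lambda>x. g x - h x) < e"
proof -
  define m where "m K = (INF g\<in>K. (l2_norm M g)\<^sup>2)" for K
  have bb: "bdd_below ((\<lambda>g. (l2_norm M g)\<^sup>2) ` K)" for K
    by (rule bdd_belowI[of _ 0]) auto
  have m_le: "m K \<le> (l2_norm M g)\<^sup>2" if "g \<in> K" for K g
    unfolding m_def by (rule cINF_lower[OF bb that])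
  have m_C: "m K \<le> C\<^sup>2" if K: "K \<in> \<K>" for K
  proof -
    obtain g where "g \<in> K" "l2_norm M g \<le> C" using bdd[OF K] by blast
    then show ?thesis using m_le[of g K] power_mono[of "l2_norm M g" C 2] by simp
  qed
  have m_near: "\<exists>g\<in>K. (l2_norm M g)\<^sup>2 < m K + e" if "K \<in> \<K>" "e > 0" for K e
  proof -
    have "K \<noteq> {}" using bdd[OF that(1)] by blast
    then show ?thesis
      using cINF_less_iff[OF _ bb, of K "m K + e"] that unfolding m_def by auto
  qed
  define s where "s = (SUP K\<in>\<K>. m K)"
  have ba: "bdd_above (m ` \<K>)" using m_C by (auto intro!: bdd_aboveI[of _ "C\<^sup>2"])
  have m_s: "m K \<le> s" if "K \<in> \<K>" for K
    unfolding s_def by (rule cSUP_upper[OF that ba])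
  have s_near: "\<exists>K\<in>\<K>. s - e < m K" if "e > 0" for e
    using less_cSUP_iff[OF ne ba, of "s - e"] that unfolding s_def by auto
  \<comment> \<open>The midpoint has squared norm at least \<open>m K\<close> > s - e, so the
    parallelogram law leaves 2 (s + e) + 2 (s + e) - 4 (s - e) = 8 e.\<close>
  have close: "(l2_norm M (\<lambda>x. a x - c x))\<^sup>2 \<le> 8 * e"
    if "K \<in> \<K>" "s - e < m K" "a \<in> K" "c \<in> K" "(l2_norm M a)\<^sup>2 \<le> s + e" "(l2_norm M c)\<^sup>2 \<le> s + e" for K a c e
  proof -
    have "a \<in> l2_space M" "c \<in> l2_space M" using sub that by auto
    from l2_parallelogram[OF this] m_le[OF mid[OF that(1,3,4)]] that(2,5,6) show ?thesis by linarith
  qed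
  have "\<forall>n. \<exists>K d. K \<in> \<K> \<and> s - 1 / Suc n < m K \<and> d \<in> K \<and> (l2_norm M d)\<^sup>2 \<le> s + 1 / Suc n"
  proof
    fix n
    obtain K where K: "K \<in> \<K>" "s - 1 / Suc n < m K" using s_near[of "1 / Suc n"] by auto
    moreover obtain d where "d \<in> K" "(l2_norm M d)\<^sup>2 < m K + 1 / Suc n"
      using m_near[OF K(1), of "1 / Suc n"] by auto
    ultimately show "\<exists>K d. K \<in> \<K> \<and> s - 1 / Suc n < m K \<and> d \<in> K \<and> (l2_norm M d)\<^sup>2 \<le> s + 1 / Suc n"
      using m_s[OF K(1)] by (intro exI[of _ K] exI[of _ d]) auto
  qed
  then obtain K d where Kd: "\<And>n. K n \<in> \<K>" "\<And>n. s - 1 / Suc n < m (K n)" "\<And>n. d n \<in> K n"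
      "\<And>n. (l2_norm M (d n))\<^sup>2 \<le> s + 1 / Suc n"
    by metis
  have dl: "d n \<in> l2_space M" for n using Kd(1,3) sub by blast
  \<comment> \<open>both elements are compared with a nearly minimal element of a common subset\<close>
  have common: "\<exists>c\<in>L. l2_norm M (\<lambda>x. d n x - c x) \<le> sqrt (8 / Suc n) \<and>
      (\<forall>k\<ge>n. d k \<in> L \<and> s - 1 / Suc n < m L \<longrightarrow> l2_norm M (\<lambda>x. d k x - c x) \<le> sqrt (8 / Suc n))"
    if L: "L \<in> \<K>" for L n
  proof -
    obtain N where N: "N \<in> \<K>" "N \<subseteq> K n \<inter> L" using dir[OF Kd(1) L] by blast
    obtain c where c: "c \<in> N" "(l2_norm M c)\<^sup>2 < m N + 1 / Suc n" using m_near[OF N(1), of "1 / Suc n"] by auto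
    have cs: "(l2_norm M c)\<^sup>2 \<le> s + 1 / Suc n" using c(2) m_s[OF N(1)] by linarith
    have "(l2_norm M (\<lambda>x. d n x - c x))\<^sup>2 \<le> 8 * (1 / Suc n)"
      by (rule close[OF Kd(1) Kd(2) Kd(3)]) (use c N cs Kd(4) in auto)
    then have 1: "l2_norm M (\<lambda>x. d n x - c x) \<le> sqrt (8 / Suc n)"
      by (intro real_le_rsqrt) simp
    have 2: "l2_norm M (\<lambda>x. d k x - c x) \<le> sqrt (8 / Suc n)" if "k \<ge> n" "d k \<in> L" "s - 1 / Suc n < m L" for k
    proof -
      have "1 / Suc k \<le> 1 / Suc n" using that(1) by (simp add: frac_le)
      then have "(l2_norm M (\<lambda>x. d k x - c x))\<^sup>2 \<le> 8 * (1 / Suc n)"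
        by (intro close[OF L that(3) that(2)]) (use c N cs Kd(4)[of k] in auto)
      then show ?thesis by (intro real_le_rsqrt) simp
    qed
    show ?thesis using 1 2 c(1) N(2) by blast
  qed
  have lim0: "(\<lambda>n. 2 * sqrt (8 / Suc n)) \<longlonglongrightarrow> 0"
    using tendsto_mult[OF tendsto_const tendsto_real_sqrt[OF lim_const_over_n[of 8, THEN LIMSEQ_Suc]], of 2]
    by simp
  have cau: "l2_norm M (\<lambda>x. d i x - d j x) \<le> 2 * sqrt (8 / Suc i)" if "i \<le> j" for i j
  proof -
    have "1 / Suc j \<le> 1 / Suc i" using that by (simp add: frac_le)
    then have "s - 1 / Suc i < m (K j)" using Kd(2)[of j] by linarith
    moreover obtain c where c: "c \<in> K j" "l2_norm M (\<lambda>x. d i x - c x) \<le> sqrt (8 / Suc i)"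
      and c': "\<forall>k\<ge>i. d k \<in> K j \<and> s - 1 / Suc i < m (K j) \<longrightarrow> l2_norm M (\<lambda>x. d k x - c x) \<le> sqrt (8 / Suc i)"
      using common[OF Kd(1)[of j], of i] by (elim bexE conjE)
    ultimately have "l2_norm M (\<lambda>x. d j x - c x) \<le> sqrt (8 / Suc i)"
      using c'[rule_format, OF that] Kd(3)[of j] by simp
    note c = c this
    have "c \<in> l2_space M" using c(1) Kd(1) sub by blast
    from l2_norm_triangle_diff[OF dl[of i] this dl[of j]] c l2_norm_minus_commute[of M c "d j"]
    show ?thesis by simp
  qed
  have "\<exists>g\<in>l2_space M. (\<lambda>n. l2_norm M (\<lambda>x. d n x - g x)) \<longlonglongrightarrow> 0"
  proof (rule l2_complete[OF fin dl])
    fix e :: real assume "e > 0"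
    obtain N where N0: "\<forall>n\<ge>N. norm (2 * sqrt (8 / Suc n) - 0) < e"
      using LIMSEQ_D[OF lim0 \<open>e > 0\<close>] by blast
    have N: "\<bar>2 * sqrt (8 / Suc n)\<bar> < e" if "n \<ge> N" for n
      using N0[rule_format, OF that] by (simp only: diff_zero real_norm_def)
    have "l2_norm M (\<lambda>x. d i x - d j x) < e" if "i \<ge> N" "j \<ge> N" for i j
    proof (cases "i \<le> j")
      case True
      then show ?thesis using cau[OF True] N[OF that(1)] by linarith
    next
      case False
      then show ?thesis using cau[of j i] N[OF that(2)] l2_norm_minus_commute[of M "d i" "d j"] by simp
    qed
    then show "\<exists>N. \<forall>m\<ge>N. \<forall>n\<ge>N. l2_norm M (\<lambda>x. d m x - d n x) < e" by blast
  qed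
  then obtain g where g: "g \<in> l2_space M" "(\<lambda>n. l2_norm M (\<lambda>x. d n x - g x)) \<longlonglongrightarrow> 0" by blast
  have "\<exists>h\<in>L. l2_norm M (\<lambda>x. g x - h x) < e" if L: "L \<in> \<K>" and e: "e > 0" for L e
  proof -
    have "(\<lambda>n. l2_norm M (\<lambda>x. d n x - g x) + 2 * sqrt (8 / Suc n)) \<longlonglongrightarrow> 0 + 0"
      by (intro tendsto_add g lim0)
    then obtain n where n: "\<bar>l2_norm M (\<lambda>x. d n x - g x) + 2 * sqrt (8 / Suc n)\<bar> < e"
      using LIMSEQ_D[of _ 0 e] e by force
    have n': "l2_norm M (\<lambda>x. d n x - g x) + 2 * sqrt (8 / Suc n) < e" using n by linarith
    obtain c where c: "c \<in> L" "l2_norm M (\<lambda>x. d n x - c x) \<le> sqrt (8 / Suc n)"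
      using common[OF L] by blast
    have "c \<in> l2_space M" using c(1) L sub by blast
    from l2_norm_triangle_diff[OF g(1) dl[of n] this] c(2) n' l2_norm_minus_commute[of M g "d n"]
    have "l2_norm M (\<lambda>x. g x - c x) < e" by (smt (verit) real_sqrt_ge_zero zero_le_divide_iff of_nat_0_le_iff)
    then show ?thesis using c by blast
  qed
  with g(1) show ?thesis by blast
qed

section \<open>Norm closures, nearest points and the Riesz representation\<close>

lemma l2_inner_tendsto:
  assumes "\<And>n. s n \<in> l2_space M" "g \<in> l2_space M" "k \<in> l2_space M"
    and "(\<lambda>n. l2_norm M (\<lambda>x. s n x - g x)) \<longlonglongrightarrow> 0"
  shows "(\<lambda>n. l2_inner M (s n) k) \<longlonglongrightarrow> l2_inner M g k"
proof -
  have "(\<lambda>n. l2_inner M (s n) k - l2_inner M g k) \<longlonglongrightarrow> 0"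
  proof (rule Lim_null_comparison)
    have "norm (l2_inner M (s n) k - l2_inner M g k) \<le> l2_norm M (\<lambda>x. s n x - g x) * l2_norm M k" for n
      using l2_cauchy_schwarz[of "\<lambda>x. s n x - g x" M k] assms(1)[of n] assms(2,3)
      by (simp add: l2_inner_diff_left l2_diff)
    then show "\<forall>\<^sub>F n in sequentially. norm (l2_inner M (s n) k - l2_inner M g k) \<le>
        l2_norm M (\<lambda>x. s n x - g x) * l2_norm M k"
      by simp
    show "(\<lambda>n. l2_norm M (\<lambda>x. s n x - g x) * l2_norm M k) \<longlonglongrightarrow> 0"
      using tendsto_mult_right[OF assms(4), of "l2_norm M k"] by simp
  qed
  then show ?thesis by (simp add: LIM_zero_iff)
qed

lemma l2_norm_tendsto:
  assumes "\<And>n. s n \<in> l2_space M" "g \<in> l2_space M"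
    and "(\<lambda>n. l2_norm M (\<lambda>x. s n x - g x)) \<longlonglongrightarrow> 0"
  shows "(\<lambda>n. l2_norm M (s n)) \<longlonglongrightarrow> l2_norm M g"
proof -
  have "(\<lambda>n. l2_norm M (s n) - l2_norm M g) \<longlonglongrightarrow> 0"
  proof (rule Lim_null_comparison[OF _ assms(3)])
    have "norm (l2_norm M (s n) - l2_norm M g) \<le> l2_norm M (\<lambda>x. s n x - g x)" for n
      using l2_norm_le_add_diff[OF assms(1)[of n] assms(2)] l2_norm_le_add_diff[OF assms(2) assms(1)[of n]]
        l2_norm_minus_commute[of M g "s n"] by (simp add: abs_le_iff)
    then show "\<forall>\<^sub>F n in sequentially. norm (l2_norm M (s n) - l2_norm M g) \<le> l2_norm M (\<lambda>x. s n x - g x)"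
      by simp
  qed
  then show ?thesis by (simp add: LIM_zero_iff)
qed

lemma l2_closureD:
  assumes "g \<in> l2_closure M A" "A \<subseteq> l2_space M"
  obtains s where "\<And>n. s n \<in> A" "(\<lambda>n. l2_norm M (\<lambda>x. s n x - g x)) \<longlonglongrightarrow> 0"
proof -
  have "\<forall>n. \<exists>\<phi>\<in>A. l2_norm M (\<lambda>x. g x - \<phi> x) < 1 / Suc n"
  proof
    fix n
    have "(0::real) < 1 / Suc n" by simp
    then show "\<exists>\<phi>\<in>A. l2_norm M (\<lambda>x. g x - \<phi> x) < 1 / Suc n"
      using assms(1) unfolding l2_closure_def by blast
  qed
  then obtain s where s: "\<And>n. s n \<in> A" "\<And>n. l2_norm M (\<lambda>x. g x - s n x) < 1 / Suc n" by metis
  have "(\<lambda>n. l2_norm M (\<lambda>x. s n x - g x)) \<longlonglongrightarrow> 0"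
  proof (rule Lim_null_comparison)
    show "\<forall>\<^sub>F n in sequentially. norm (l2_norm M (\<lambda>x. s n x - g x)) \<le> 1 / Suc n"
      using s(2) by (auto simp: l2_norm_minus_commute[of M _ g] less_imp_le)
    show "(\<lambda>n. 1 / real (Suc n)) \<longlonglongrightarrow> 0" by (rule LIMSEQ_Suc[OF lim_const_over_n])
  qed
  with s(1) show thesis by (rule that)
qed

lemma l2_closureI:
  assumes "g \<in> l2_space M" "\<And>n. s n \<in> A" "A \<subseteq> l2_space M"
    and "(\<lambda>n. l2_norm M (\<lambda>x. s n x - g x)) \<longlonglongrightarrow> 0"
  shows "g \<in> l2_closure M A"
proof -
  have "\<exists>\<phi>\<in>A \<inter> l2_space M. l2_norm M (\<lambda>x. g x - \<phi> x) < e" if "e > 0" for e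
  proof -
    obtain n where n: "\<forall>i\<ge>n. norm (l2_norm M (\<lambda>x. s i x - g x) - 0) < e"
      using LIMSEQ_D[OF assms(4) \<open>e > 0\<close>] by (elim exE)
    have "l2_norm M (\<lambda>x. g x - s n x) < e"
      using n[rule_format, OF order_refl] l2_norm_minus_commute[of M g "s n"] by simp
    then show ?thesis using assms(2)[of n] assms(3) by (intro bexI[of _ "s n"]) auto
  qed
  then show ?thesis using assms(1) by (auto simp: l2_closure_def)
qed

lemma l2_closure_subset: "l2_closure M A \<subseteq> l2_space M"
  by (auto simp: l2_closure_def)

lemma l2_subset_closure:
  assumes "A \<subseteq> l2_space M"
  shows "A \<subseteq> l2_closure M A"
proof
  fix g assume g: "g \<in> A"
  have "l2_norm M (\<lambda>x. g x - g x) = 0" by simp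
  then show "g \<in> l2_closure M A" using g assms unfolding l2_closure_def by force
qed

text \<open>The point of the closure nearest to the origin; the inequality says that
  \<open>S\<close> lies in the half-space that v determines. It yields both the Riesz representation
  and the separation of convex sets. The sets of near minimisers are nested, hence directed.\<close>

lemma l2_min_norm:
  fixes S :: "('a \<Rightarrow> complex) set"
  assumes fin: "finite_measure M" and sub: "S \<subseteq> l2_space M" and ne: "S \<noteq> {}"
    and conv: "\<And>g h t. g \<in> S \<Longrightarrow> h \<in> S \<Longrightarrow> 0 \<le> t \<Longrightarrow> t \<le> 1 \<Longrightarrow>
      (\<lambda>x. g x + complex_of_real t * (h x - g x)) \<in> S"
  shows "\<exists>v\<in>l2_closure M S. \<forall>g\<in>S. (l2_norm M v)\<^sup>2 \<le> Re (l2_inner M g v)"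
proof -
  define m where "m = (INF g\<in>S. (l2_norm M g)\<^sup>2)"
  have bb: "bdd_below ((\<lambda>g. (l2_norm M g)\<^sup>2) ` S)"
    by (rule bdd_belowI[of _ 0]) auto
  have m_le: "m \<le> (l2_norm M g)\<^sup>2" if "g \<in> S" for g
    unfolding m_def by (rule cINF_lower[OF bb that])
  have m0: "m \<ge> 0" unfolding m_def by (rule cINF_greatest[OF ne]) simp
  have m_near: "\<exists>g\<in>S. (l2_norm M g)\<^sup>2 < m + e" if "e > 0" for e
    using cINF_less_iff[OF ne bb, of "m + e"] that unfolding m_def by auto
  define K where "K n = {g\<in>S. (l2_norm M g)\<^sup>2 \<le> m + 1 / Suc n}" for n
  have "\<exists>v\<in>l2_space M. \<forall>L\<in>range K. \<forall>e>0. \<exists>h\<in>L. l2_norm M (\<lambda>x. v x - h x) < e"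
  proof (rule l2_directed_convex[OF fin, where C = "sqrt (m + 1)"])
    show "L \<subseteq> l2_space M" if "L \<in> range K" for L using that sub by (auto simp: K_def)
    show "(\<lambda>x. (g x + h x) / 2) \<in> L" if L: "L \<in> range K" "g \<in> L" "h \<in> L" for L g h
    proof -
      obtain n where n: "L = K n" using L by blast
      then have gh: "g \<in> S" "h \<in> S" "(l2_norm M g)\<^sup>2 \<le> m + 1 / Suc n" "(l2_norm M h)\<^sup>2 \<le> m + 1 / Suc n"
        using L by (auto simp: K_def)
      have "(\<lambda>x. g x + complex_of_real (1/2) * (h x - g x)) = (\<lambda>x. (g x + h x) / 2)"
        by (auto simp: field_simps)
      then have S: "(\<lambda>x. (g x + h x) / 2) \<in> S" using conv[OF gh(1,2), of "1/2"] by simp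
      have "0 \<le> (l2_norm M (\<lambda>x. g x - h x))\<^sup>2" by simp
      then have "(l2_norm M (\<lambda>x. (g x + h x) / 2))\<^sup>2 \<le> m + 1 / Suc n"
        using l2_parallelogram[of g M h] gh subsetD[OF sub gh(1)] subsetD[OF sub gh(2)] by linarith
      with S show ?thesis using n by (simp add: K_def)
    qed
    show "\<exists>N\<in>range K. N \<subseteq> L1 \<inter> L2" if L: "L1 \<in> range K" "L2 \<in> range K" for L1 L2
    proof -
      obtain i j where ij: "L1 = K i" "L2 = K j" using L by blast
      have "K k \<subseteq> K l" if "l \<le> k" for k l
        using that frac_le[of 1 1 "Suc l" "Suc k"] unfolding K_def by force
      then have "K (max i j) \<subseteq> K i \<inter> K j" by simp
      then show ?thesis using ij by blast
    qed
    show "\<exists>g\<in>L. l2_norm M g \<le> sqrt (m + 1)" if L: "L \<in> range K" for L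
    proof -
      obtain n where n: "L = K n" using L by blast
      obtain g where g: "g \<in> S" "(l2_norm M g)\<^sup>2 < m + 1 / Suc n" using m_near[of "1 / Suc n"] by auto
      have "1 / real (Suc n) \<le> 1" by simp
      then have "(l2_norm M g)\<^sup>2 \<le> m + 1" using g(2) by linarith
      then have "l2_norm M g \<le> sqrt (m + 1)" by (rule real_le_rsqrt)
      then show ?thesis using g n by (auto simp: K_def)
    qed
  qed auto
  then obtain v where v: "v \<in> l2_space M" "\<And>n e. e > 0 \<Longrightarrow> \<exists>h\<in>K n. l2_norm M (\<lambda>x. v x - h x) < e"
    by blast
  have "\<forall>n. \<exists>h\<in>K n. l2_norm M (\<lambda>x. v x - h x) < 1 / Suc n" using v(2) by simp
  then obtain s where s: "\<And>n. s n \<in> K n" "\<And>n. l2_norm M (\<lambda>x. v x - s n x) < 1 / Suc n" by metis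
  have sS: "s n \<in> S" for n using s(1)[of n] by (simp add: K_def)
  have lim1: "(\<lambda>n. 1 / real (Suc n)) \<longlonglongrightarrow> 0" by (rule LIMSEQ_Suc[OF lim_const_over_n])
  have lim: "(\<lambda>n. l2_norm M (\<lambda>x. s n x - v x)) \<longlonglongrightarrow> 0"
    using s(2) by (intro Lim_null_comparison[OF _ lim1])
      (auto simp: l2_norm_minus_commute[of M _ v] less_imp_le)
  have vcl: "v \<in> l2_closure M S"
    by (rule l2_closureI[OF v(1) sS sub lim])
  have sl: "s n \<in> l2_space M" for n using sS sub by blast
  have vm: "(l2_norm M v)\<^sup>2 \<le> m"
  proof (rule LIMSEQ_le)
    show "(\<lambda>n. (l2_norm M (s n))\<^sup>2) \<longlonglongrightarrow> (l2_norm M v)\<^sup>2"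
      by (intro tendsto_power l2_norm_tendsto[OF sl v(1) lim])
    show "(\<lambda>n. m + 1 / real (Suc n)) \<longlonglongrightarrow> m" using tendsto_add[OF tendsto_const lim1] by simp
    show "\<exists>N. \<forall>n\<ge>N. (l2_norm M (s n))\<^sup>2 \<le> m + 1 / real (Suc n)" using s(1) by (auto simp: K_def)
  qed
  have "(l2_norm M v)\<^sup>2 \<le> Re (l2_inner M g v)" if g: "g \<in> S" for g
  proof -
    have gl: "g \<in> l2_space M" using g sub by blast
    \<comment> \<open>First variation along the segment from v to g, divided by t. As v is only in
      the closure, minimality is obtained for \<open>s n\<close> in its place and passed to the
      limit.\<close>
    have var: "0 \<le> 2 * Re (l2_inner M (\<lambda>x. g x - v x) v) + t * (l2_norm M (\<lambda>x. g x - v x))\<^sup>2"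
      if t: "0 < t" "t \<le> 1" for t
    proof -
      have "m \<le> (l2_norm M (\<lambda>x. v x + complex_of_real t * (g x - v x)))\<^sup>2"
      proof (rule LIMSEQ_le_const)
        have "(\<lambda>n. cmod (1 - complex_of_real t) * l2_norm M (\<lambda>x. s n x - v x)) \<longlonglongrightarrow> 0"
          using tendsto_mult_left[OF lim] by simp
        then have "(\<lambda>n. l2_norm M (\<lambda>x. (s n x + complex_of_real t * (g x - s n x)) -
            (v x + complex_of_real t * (g x - v x)))) \<longlonglongrightarrow> 0"
          by (simp add: l2_norm_scale[symmetric] algebra_simps)
        then show "(\<lambda>n. (l2_norm M (\<lambda>x. s n x + complex_of_real t * (g x - s n x)))\<^sup>2) \<longlonglongrightarrow>
            (l2_norm M (\<lambda>x. v x + complex_of_real t * (g x - v x)))\<^sup>2"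
          using gl sl v(1) by (intro tendsto_power l2_norm_tendsto l2_add l2_scale l2_diff)
        show "\<exists>N. \<forall>n\<ge>N. m \<le> (l2_norm M (\<lambda>x. s n x + complex_of_real t * (g x - s n x)))\<^sup>2"
          using m_le[OF conv[OF sS g]] t by auto
      qed
      also have "\<dots> = (l2_norm M v)\<^sup>2 + 2 * t * Re (l2_inner M (\<lambda>x. g x - v x) v)
          + t\<^sup>2 * (l2_norm M (\<lambda>x. g x - v x))\<^sup>2"
      proof -
        have "Re (l2_inner M v (\<lambda>x. g x - v x)) = Re (l2_inner M (\<lambda>x. g x - v x) v)"
          using l2_inner_cnj[of M v "\<lambda>x. g x - v x"] by (metis complex_cnj(1) complex.sel(1) complex_surj)
        then show ?thesis
          using l2_norm_add_power2[OF v(1) l2_scale[OF l2_diff[OF gl v(1)], of "complex_of_real t"]]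
          by (simp add: l2_norm_scale l2_inner_scale_right power_mult_distrib)
      qed
      finally have "0 \<le> 2 * t * Re (l2_inner M (\<lambda>x. g x - v x) v) + t\<^sup>2 * (l2_norm M (\<lambda>x. g x - v x))\<^sup>2"
        using vm by linarith
      also have "\<dots> = t * (2 * Re (l2_inner M (\<lambda>x. g x - v x) v) + t * (l2_norm M (\<lambda>x. g x - v x))\<^sup>2)"
        by (simp add: algebra_simps power2_eq_square)
      finally show ?thesis using t by (simp add: zero_le_mult_iff)
    qed
    let ?a = "Re (l2_inner M (\<lambda>x. g x - v x) v)" and ?b = "(l2_norm M (\<lambda>x. g x - v x))\<^sup>2"
    have "(\<lambda>n. 2 * ?a + 1 / real (Suc n) * ?b) \<longlonglongrightarrow> 2 * ?a + 0 * ?b"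
      by (intro tendsto_intros lim1)
    moreover have "\<exists>N. \<forall>n\<ge>N. 0 \<le> 2 * ?a + 1 / real (Suc n) * ?b"
      using var by (intro exI[of _ 0] allI impI var) auto
    ultimately have "0 \<le> 2 * ?a + 0 * ?b" by (rule LIMSEQ_le_const)
    then have "0 \<le> ?a" by simp
    then show ?thesis
      using gl v(1) by (simp add: l2_inner_diff_left l2_inner_self)
  qed
  with vcl show ?thesis by blast
qed

definition complex_subspace :: "('a \<Rightarrow> complex) set \<Rightarrow> bool" where
  "complex_subspace V \<longleftrightarrow> (\<lambda>x. 0) \<in> V \<and> (\<forall>g\<in>V. \<forall>h\<in>V. (\<lambda>x. g x + h x) \<in> V) \<and> (\<forall>c. \<forall>g\<in>V. (\<lambda>x. c * g x) \<in> V)"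

lemma complex_subspaceD:
  assumes "complex_subspace V" "g \<in> V" "h \<in> V"
  shows "(\<lambda>x. g x + h x) \<in> V" "(\<lambda>x. c * g x) \<in> V" "(\<lambda>x. g x - h x) \<in> V"
proof -
  show 1: "(\<lambda>x. g x + h x) \<in> V" "(\<lambda>x. c * g x) \<in> V"
    using assms by (auto simp: complex_subspace_def)
  have add: "(\<lambda>x. a x + b x) \<in> V" if "a \<in> V" "b \<in> V" for a b
    using assms(1) that by (simp add: complex_subspace_def)
  have "(\<lambda>x. - 1 * h x) \<in> V" using assms unfolding complex_subspace_def by blast
  from add[OF assms(2) this] show "(\<lambda>x. g x - h x) \<in> V" by simp
qed

text \<open>The nearest point v of the affine set L = 1 is orthogonal to the kernel of L, and v
  divided by its squared norm represents L. \<open>V\<close> is not assumed closed, so the vector is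
  found in its closure.\<close>

lemma l2_riesz:
  assumes fin: "finite_measure M" and sub: "V \<subseteq> l2_space M" and V: "complex_subspace V"
    and add: "\<And>g h. g \<in> V \<Longrightarrow> h \<in> V \<Longrightarrow> L (\<lambda>x. g x + h x) = L g + L h"
    and scale: "\<And>c g. g \<in> V \<Longrightarrow> L (\<lambda>x. c * g x) = c * L g"
    and bound: "\<And>g. g \<in> V \<Longrightarrow> cmod (L g) \<le> C * l2_norm M g" and C: "C \<ge> 0"
  shows "\<exists>k\<in>l2_closure M V. l2_norm M k \<le> C \<and> (\<forall>g\<in>V. L g = l2_inner M g k)"
proof (cases "\<forall>g\<in>V. L g = 0")
  case True
  have "(\<lambda>x. 0) \<in> l2_closure M V"
    using l2_subset_closure[OF sub] V by (auto simp: complex_subspace_def)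
  moreover have "l2_inner M g (\<lambda>x. 0) = 0" for g by (simp add: l2_inner_def)
  ultimately show ?thesis using True C by (intro bexI[of _ "\<lambda>x. 0"]) auto
next
  case False
  then obtain g0 where g0: "g0 \<in> V" "L g0 \<noteq> 0" by blast
  note VD = complex_subspaceD[OF V]
  have Ldiff: "L (\<lambda>x. g x - h x) = L g - L h" if "g \<in> V" "h \<in> V" for g h
    using add[of g "\<lambda>x. -1 * h x"] scale[of h "-1"] VD(2)[OF that(2,2), of "-1"] that by simp
  define S where "S = {g\<in>V. L g = 1}"
  have S_sub: "S \<subseteq> l2_space M" using sub by (auto simp: S_def)
  have "\<exists>v\<in>l2_closure M S. \<forall>g\<in>S. (l2_norm M v)\<^sup>2 \<le> Re (l2_inner M g v)"
  proof (rule l2_min_norm[OF fin S_sub])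
    show "S \<noteq> {}" using g0 scale[OF g0(1), of "1 / L g0"] VD(2)[OF g0(1) g0(1), of "1 / L g0"]
      unfolding S_def by auto
    show "(\<lambda>x. g x + complex_of_real t * (h x - g x)) \<in> S" if "g \<in> S" "h \<in> S" for g h t
    proof -
      have gh: "g \<in> V" "h \<in> V" "L g = 1" "L h = 1" using that by (auto simp: S_def)
      note d = VD(3)[OF gh(2,1)]
      note d2 = VD(2)[OF d d, of "complex_of_real t"]
      show ?thesis using VD(1)[OF gh(1) d2] add[OF gh(1) d2] scale[OF d] Ldiff[OF gh(2,1)] gh
        by (simp add: S_def)
    qed
  qed
  then obtain v where v: "v \<in> l2_closure M S" "\<And>g. g \<in> S \<Longrightarrow> (l2_norm M v)\<^sup>2 \<le> Re (l2_inner M g v)"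
    by blast
  obtain s where s: "\<And>n. s n \<in> S" "(\<lambda>n. l2_norm M (\<lambda>x. s n x - v x)) \<longlonglongrightarrow> 0"
    using l2_closureD[OF v(1) S_sub] by blast
  have vl: "v \<in> l2_space M" using v(1) l2_closure_subset by blast
  have sl: "s n \<in> l2_space M" for n using s(1) S_sub by blast
  have norm_lim: "(\<lambda>n. l2_norm M (s n)) \<longlonglongrightarrow> l2_norm M v"
    by (rule l2_norm_tendsto[OF sl vl s(2)])
  \<comment> \<open>L is 1 along the sequence \<open>s n\<close>, so its bound survives in the
    limit. This gives v \<noteq> 0 and, after normalisation, the norm bound 1 / ||v|| <= C.\<close>
  have "1 \<le> C * l2_norm M v"
  proof (rule LIMSEQ_le_const)
    show "(\<lambda>n. C * l2_norm M (s n)) \<longlonglongrightarrow> C * l2_norm M v" by (intro tendsto_intros norm_lim)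
    show "\<exists>N. \<forall>n\<ge>N. 1 \<le> C * l2_norm M (s n)"
      using bound s(1) by (metis (mono_tags, lifting) S_def mem_Collect_eq norm_one)
  qed
  then have vpos: "l2_norm M v > 0" using C
    by (metis l2_norm_nonneg less_eq_real_def mult_zero_right not_one_le_zero)
  have ker: "l2_inner M g v = 0" if g: "g \<in> V" "L g = 0" for g
  proof -
    have gl: "g \<in> l2_space M" using g sub by blast
    have 1: "(l2_norm M v)\<^sup>2 \<le> Re (l2_inner M (s 0) v) + Re (c * l2_inner M g v)" for c
    proof -
      have "(\<lambda>x. s 0 x + c * g x) \<in> S"
        using s(1)[of 0] VD(2)[OF g(1) g(1), of c] VD(1)[of "s 0" "\<lambda>x. c * g x"] add[of "s 0" "\<lambda>x. c * g x"]
          scale[OF g(1), of c] g(2) by (simp add: S_def)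
      from v(2)[OF this] show ?thesis
        using sl vl gl by (simp add: l2_inner_add_left l2_inner_scale_left l2_scale)
    qed
    let ?z = "l2_inner M g v" and ?r = "Re (l2_inner M (s 0) v)"
    \<comment> \<open>For c = -t times the conjugate of the inner product z, the perturbation is -t
      |z|^2; since t is free, z must be 0.\<close>
    have 2: "(l2_norm M v)\<^sup>2 \<le> ?r - t * (cmod ?z)\<^sup>2" for t
    proof -
      have "- complex_of_real t * cnj ?z * ?z = complex_of_real (- t * (cmod ?z)\<^sup>2)"
        using complex_norm_square[of ?z] by (simp add: mult.commute)
      then have "Re (- complex_of_real t * cnj ?z * ?z) = - t * (cmod ?z)\<^sup>2"
        by (metis Re_complex_of_real)
      with 1[of "- complex_of_real t * cnj ?z"] show ?thesis by simp
    qed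
    show ?thesis
    proof (rule ccontr)
      assume "?z \<noteq> 0"
      then have "(cmod ?z)\<^sup>2 > 0" by simp
      with 2[of "(?r + 1) / (cmod ?z)\<^sup>2"] have "(l2_norm M v)\<^sup>2 \<le> - 1" by simp
      then show False using zero_le_power2[of "l2_norm M v"] by linarith
    qed
  qed
  have on_S: "l2_inner M g v = of_real ((l2_norm M v)\<^sup>2)" if g: "g \<in> S" for g
  proof -
    have "l2_inner M (s n) v = l2_inner M g v" for n
    proof -
      have "l2_inner M (\<lambda>x. s n x - g x) v = 0"
        using s(1)[of n] g by (intro ker) (auto simp: S_def VD(3) Ldiff)
      then show ?thesis using sl g S_sub vl by (simp add: l2_inner_diff_left subset_iff)
    qed
    with l2_inner_tendsto[OF sl vl vl s(2)] have "(\<lambda>n::nat. l2_inner M g v) \<longlonglongrightarrow> l2_inner M v v" by simp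
    then show ?thesis by (simp add: LIMSEQ_const_iff l2_inner_self)
  qed
  define c where "c = complex_of_real (1 / (l2_norm M v)\<^sup>2)"
  have cn: "cnj c = c" by (simp add: c_def)
  have repr: "L g = l2_inner M g (\<lambda>x. c * v x)" if g: "g \<in> V" for g
  proof -
    have gl: "g \<in> l2_space M" and s0: "s 0 \<in> V" "L (s 0) = 1" using g sub s(1)[of 0] by (auto simp: S_def)
    note d = VD(2)[OF s0(1) s0(1), of "L g"]
    have "l2_inner M (\<lambda>x. g x - L g * s 0 x) v = 0"
      using VD(3)[OF g d] Ldiff[OF g d] scale[OF s0(1)] s0 by (intro ker) auto
    then have "l2_inner M g v = L g * of_real ((l2_norm M v)\<^sup>2)"
      using gl sl vl on_S[OF s(1)[of 0]] by (simp add: l2_inner_diff_left l2_inner_scale_left l2_scale)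
    then show ?thesis using vpos by (simp add: l2_inner_scale_right cn) (simp add: c_def)
  qed
  have kcl: "(\<lambda>x. c * v x) \<in> l2_closure M V"
  proof (rule l2_closureI[where s = "\<lambda>n x. c * s n x"])
    show "(\<lambda>x. c * v x) \<in> l2_space M" using vl by auto
    show "(\<lambda>x. c * s n x) \<in> V" for n using s(1)[of n] VD(2)[of "s n" "s n" c] by (simp add: S_def)
    show "(\<lambda>n. l2_norm M (\<lambda>x. c * s n x - c * v x)) \<longlonglongrightarrow> 0"
      using tendsto_mult_left[OF s(2), of "cmod c"] by (simp add: right_diff_distrib[symmetric] l2_norm_scale)
  qed fact
  have "l2_norm M (\<lambda>x. c * v x) = 1 / l2_norm M v"
    using vpos by (subst l2_norm_scale) (simp add: c_def norm_divide norm_power norm_mult power2_eq_square)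
  also have "\<dots> \<le> C" using \<open>1 \<le> C * l2_norm M v\<close> vpos by (simp add: field_simps)
  finally have "l2_norm M (\<lambda>x. c * v x) \<le> C" .
  with kcl repr show ?thesis by blast
qed

text \<open>Testing with approximants of t itself gives ||t||^2 <= C ||t||. Thus a vector known only
  through its pairings with \<open>V\<close> can be estimated.\<close>

lemma l2_closure_norm_le:
  assumes "t \<in> l2_closure M V" "V \<subseteq> l2_space M"
    and "\<And>g. g \<in> V \<Longrightarrow> cmod (l2_inner M g t) \<le> C * l2_norm M g" and C: "C \<ge> 0"
  shows "l2_norm M t \<le> C"
proof -
  obtain s where s: "\<And>n. s n \<in> V" "(\<lambda>n. l2_norm M (\<lambda>x. s n x - t x)) \<longlonglongrightarrow> 0"
    using l2_closureD[OF assms(1,2)] by blast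
  have tl: "t \<in> l2_space M" and sl: "\<And>n. s n \<in> l2_space M"
    using assms(1,2) l2_closure_subset s(1) by blast+
  have "cmod (l2_inner M t t) \<le> C * l2_norm M t"
  proof (rule LIMSEQ_le)
    show "(\<lambda>n. cmod (l2_inner M (s n) t)) \<longlonglongrightarrow> cmod (l2_inner M t t)"
      by (intro tendsto_norm l2_inner_tendsto[OF sl tl tl s(2)])
    show "(\<lambda>n. C * l2_norm M (s n)) \<longlonglongrightarrow> C * l2_norm M t"
      by (intro tendsto_intros l2_norm_tendsto[OF sl tl s(2)])
    show "\<exists>N. \<forall>n\<ge>N. cmod (l2_inner M (s n) t) \<le> C * l2_norm M (s n)" using assms(3) s(1) by blast
  qed
  then have "l2_norm M t * l2_norm M t \<le> C * l2_norm M t"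
    by (simp add: l2_inner_self norm_power power2_eq_square norm_mult)
  then show ?thesis
    using C l2_norm_nonneg[of M t] by (smt (verit) mult_le_cancel_right)
qed

subsection \<open>Analytic functions of several variables\<close>

lemma norm_vector_smult: "norm (c *s v) = cmod c * norm v" for v :: "complex^'d"
  unfolding norm_vec_def by (simp add: norm_mult L2_set_right_distrib)

lemma bounded_linear_smult_left: "bounded_linear (\<lambda>t. t *s v)" for v :: "complex^'d"
proof
  show "(r *\<^sub>R t) *s v = r *\<^sub>R (t *s v)" for r t by (simp add: vec_eq_iff)
  show "\<exists>K. \<forall>t. norm (t *s v) \<le> norm t * K" by (auto simp: norm_vector_smult intro!: exI[of _ "norm v"])
qed (simp add: vec_eq_iff algebra_simps)

lemma analytic_inE:
  assumes "analytic_in f \<Omega>"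
  obtains D where "\<And>z. z \<in> \<Omega> \<Longrightarrow> (f has_derivative D z) (at z)"
    "\<And>z c v. z \<in> \<Omega> \<Longrightarrow> D z (c *s v) = c * D z v"
proof -
  have "\<forall>z\<in>\<Omega>. \<exists>D. (f has_derivative D) (at z) \<and> (\<forall>c v. D (c *s v) = c * D v)"
    using assms by (simp add: analytic_in_def)
  from bchoice[OF this] obtain D where
    "\<forall>z\<in>\<Omega>. (f has_derivative D z) (at z) \<and> (\<forall>c v. D z (c *s v) = c * D z v)" ..
  then show thesis by (intro that[of D]) auto
qed

lemma analytic_in_subset: "analytic_in f \<Omega> \<Longrightarrow> S \<subseteq> \<Omega> \<Longrightarrow> analytic_in f S"
  by (auto simp: analytic_in_def)

lemma analytic_in_cong:
  assumes "analytic_in f \<Omega>" "open \<Omega>" "\<And>z. z \<in> \<Omega> \<Longrightarrow> f z = g z"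
  shows "analytic_in g \<Omega>"
proof -
  obtain D where D: "\<And>z. z \<in> \<Omega> \<Longrightarrow> (f has_derivative D z) (at z)"
    "\<And>z c v. z \<in> \<Omega> \<Longrightarrow> D z (c *s v) = c * D z v"
    using analytic_inE[OF assms(1)] by blast
  have "(g has_derivative D z) (at z)" if "z \<in> \<Omega>" for z
    by (rule has_derivative_transform_within_open[OF D(1)[OF that] assms(2) that assms(3)])
  with D(2) show ?thesis unfolding analytic_in_def by blast
qed

lemma analytic_in_const: "analytic_in (\<lambda>z. c) \<Omega>"
  unfolding analytic_in_def by (intro ballI exI[of _ "\<lambda>v. 0"]) auto

lemma analytic_in_component: "analytic_in (\<lambda>z. z $ j) \<Omega>"
  unfolding analytic_in_def
proof (intro ballI exI[of _ "\<lambda>v. v $ j"] conjI allI)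
  show "((\<lambda>z. z $ j) has_derivative (\<lambda>v. v $ j)) (at z)" for z :: "complex^'a"
    by (rule bounded_linear_imp_has_derivative[OF bounded_linear_vec_nth])
qed simp

lemma analytic_in_add:
  assumes "analytic_in f \<Omega>" "analytic_in g \<Omega>"
  shows "analytic_in (\<lambda>z. f z + g z) \<Omega>"
proof -
  obtain D E where D: "\<And>z. z \<in> \<Omega> \<Longrightarrow> (f has_derivative D z) (at z)"
      "\<And>z c v. z \<in> \<Omega> \<Longrightarrow> D z (c *s v) = c * D z v"
    and E: "\<And>z. z \<in> \<Omega> \<Longrightarrow> (g has_derivative E z) (at z)"
      "\<And>z c v. z \<in> \<Omega> \<Longrightarrow> E z (c *s v) = c * E z v"
    using analytic_inE[OF assms(1)] analytic_inE[OF assms(2)] by metis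
  show ?thesis unfolding analytic_in_def
  proof (intro ballI)
    fix z assume z: "z \<in> \<Omega>"
    show "\<exists>F. ((\<lambda>z. f z + g z) has_derivative F) (at z) \<and> (\<forall>c v. F (c *s v) = c * F v)"
      by (intro exI[of _ "\<lambda>v. D z v + E z v"] conjI has_derivative_add D(1) E(1) z)
        (simp add: D(2)[OF z] E(2)[OF z] distrib_left)
  qed
qed

lemma analytic_in_mult:
  assumes "analytic_in f \<Omega>" "analytic_in g \<Omega>"
  shows "analytic_in (\<lambda>z. f z * g z) \<Omega>"
proof -
  obtain D E where D: "\<And>z. z \<in> \<Omega> \<Longrightarrow> (f has_derivative D z) (at z)"
      "\<And>z c v. z \<in> \<Omega> \<Longrightarrow> D z (c *s v) = c * D z v"
    and E: "\<And>z. z \<in> \<Omega> \<Longrightarrow> (g has_derivative E z) (at z)"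
      "\<And>z c v. z \<in> \<Omega> \<Longrightarrow> E z (c *s v) = c * E z v"
    using analytic_inE[OF assms(1)] analytic_inE[OF assms(2)] by metis
  show ?thesis unfolding analytic_in_def
  proof (intro ballI)
    fix z assume z: "z \<in> \<Omega>"
    show "\<exists>F. ((\<lambda>z. f z * g z) has_derivative F) (at z) \<and> (\<forall>c v. F (c *s v) = c * F v)"
      by (intro exI[of _ "\<lambda>v. f z * E z v + D z v * g z"] conjI has_derivative_mult D(1) E(1) z)
        (simp add: D(2)[OF z] E(2)[OF z] algebra_simps)
  qed
qed

lemma analytic_in_scale: "analytic_in f \<Omega> \<Longrightarrow> analytic_in (\<lambda>z. c * f z) \<Omega>"
  by (rule analytic_in_mult[OF analytic_in_const])

lemma analytic_in_diff:
  assumes "analytic_in f \<Omega>" "analytic_in g \<Omega>"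
  shows "analytic_in (\<lambda>z. f z - g z) \<Omega>"
  using analytic_in_add[OF assms(1) analytic_in_scale[OF assms(2), of "-1"]] by simp

lemma analytic_in_continuous: "analytic_in f \<Omega> \<Longrightarrow> continuous_on \<Omega> f"
  unfolding analytic_in_def
  by (meson continuous_at_imp_continuous_on has_derivative_continuous)

text \<open>On the complex line through z in the direction of v, complex linearity of the derivative
  makes f a holomorphic function of one variable, and Cauchy's inequality applies at the centre of
  the disc.\<close>

lemma analytic_deriv_bound:
  fixes f :: "complex^'d \<Rightarrow> complex"
  assumes f: "analytic_in f (cball z r)" and r: "r > 0"
    and B: "\<And>x. x \<in> cball z r \<Longrightarrow> cmod (f x) \<le> B"
    and D: "(f has_derivative D) (at z)" "\<And>c v. D (c *s v) = c * D v"
  shows "cmod (D v) \<le> B / r * norm v"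
proof (cases "v = 0")
  case True
  then show ?thesis using D(2)[of 0 0] by simp
next
  case False
  define e where "e = complex_of_real (1 / norm v) *s v"
  have ne: "norm e = 1" using False by (simp add: e_def norm_vector_smult norm_divide)
  have v: "v = complex_of_real (norm v) *s e"
    using False by (simp add: e_def vec_eq_iff)
  obtain E where E: "\<And>x. x \<in> cball z r \<Longrightarrow> (f has_derivative E x) (at x)"
    "\<And>x c v. x \<in> cball z r \<Longrightarrow> E x (c *s v) = c * E x v"
    using analytic_inE[OF f] by blast
  define g where "g t = f (z + t *s e)" for t
  have line: "((\<lambda>t. z + t *s e) has_derivative (\<lambda>h. h *s e)) (at t)" for t
  proof -
    have "((\<lambda>t. z + t *s e) has_derivative (\<lambda>h. 0 + h *s e)) (at t)"
      by (intro has_derivative_add has_derivative_const bounded_linear_imp_has_derivative bounded_linear_smult_left)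
    then show ?thesis by simp
  qed
  have der: "(g has_field_derivative F e) (at t)"
    if "(f has_derivative F) (at (z + t *s e))" "\<And>c v. F (c *s v) = c * F v" for F t
  proof -
    have "(f \<circ> (\<lambda>t. z + t *s e) has_derivative F \<circ> (\<lambda>h. h *s e)) (at t)"
      by (rule diff_chain_at[OF line that(1)])
    moreover have "F \<circ> (\<lambda>h. h *s e) = (*) (F e)" using that(2) by (auto simp: mult.commute)
    moreover have "f \<circ> (\<lambda>t. z + t *s e) = g" by (auto simp: g_def)
    ultimately show ?thesis by (simp add: has_field_derivative_def)
  qed
  have inb: "z + t *s e \<in> cball z r" if "cmod t \<le> r" for t
    using that by (simp add: dist_norm norm_vector_smult ne)
  have hol: "g field_differentiable at t" if "t \<in> cball 0 r" for t
    using der[OF E(1) E(2), OF inb inb] that unfolding field_differentiable_def by auto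
  have "norm ((deriv ^^ 1) g 0) \<le> fact 1 * B / r ^ 1"
  proof (rule Cauchy_inequality[OF _ _ r])
    show "g holomorphic_on ball 0 r"
      unfolding holomorphic_on_def by (rule ballI, rule field_differentiable_at_within, rule hol) simp
    show "continuous_on (cball 0 r) g"
      by (intro continuous_at_imp_continuous_on ballI field_differentiable_imp_continuous_at hol)
    show "norm (g x) \<le> B" if "norm (0 - x) = r" for x
      unfolding g_def using that by (intro B inb) simp
  qed
  moreover have "deriv g 0 = D e" using der[of D 0] D by (simp add: DERIV_imp_deriv)
  ultimately have "cmod (D e) \<le> B / r" by simp
  have "cmod (D v) = norm v * cmod (D e)" by (subst v) (simp add: D(2) norm_mult)
  also have "\<dots> \<le> norm v * (B / r)" by (rule mult_left_mono) (fact, simp)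
  finally show ?thesis by (simp add: mult.commute)
qed

text \<open>Each point of the half ball is the centre of a ball of radius r inside the large one, so
  the derivative estimate is uniform on the half ball.\<close>

lemma analytic_lipschitz:
  fixes f :: "complex^'d \<Rightarrow> complex"
  assumes f: "analytic_in f (cball z (2 * r))" and r: "r > 0"
    and B: "\<And>x. x \<in> cball z (2 * r) \<Longrightarrow> cmod (f x) \<le> B"
    and xy: "x \<in> cball z r" "y \<in> cball z r"
  shows "cmod (f x - f y) \<le> B / r * norm (x - y)"
proof -
  obtain E where E: "\<And>x. x \<in> cball z (2 * r) \<Longrightarrow> (f has_derivative E x) (at x)"
    "\<And>x c v. x \<in> cball z (2 * r) \<Longrightarrow> E x (c *s v) = c * E x v"
    using analytic_inE[OF f] by blast
  have sub: "cball x r \<subseteq> cball z (2 * r)" if "x \<in> cball z r" for x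
    using that by (auto simp: dist_norm) (smt (verit) dist_norm dist_triangle)
  show ?thesis
  proof (rule differentiable_bound[OF convex_cball _ _ xy])
    fix x assume x: "x \<in> cball z r"
    have x2: "x \<in> cball z (2 * r)" using subsetD[OF sub[OF x], of x] r by simp
    show "(f has_derivative E x) (at x within cball z r)"
      by (rule has_derivative_at_withinI[OF E(1)[OF x2]])
    show "onorm (E x) \<le> B / r"
    proof (rule onorm_bound)
      show "0 \<le> B / r" using B[OF x2] r by (meson divide_nonneg_pos norm_ge_zero order_trans)
      show "norm (E x v) \<le> B / r * norm v" for v
        by (rule analytic_deriv_bound[OF analytic_in_subset[OF f sub[OF x]] r B E(1)[OF x2] E(2)[OF x2]])
          (use sub[OF x] in auto)
    qed
  qed
qed

section \<open>The Bergman space: local bounds and completeness\<close>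

lemma bergmanD:
  assumes "f \<in> bergman \<Omega>"
  shows "f \<in> l2_space (lebesgue_on \<Omega>)" "analytic_in f \<Omega>" "z \<notin> \<Omega> \<Longrightarrow> f z = 0"
  using assms by (auto simp: bergman_def)

lemma bergman_subspace: "complex_subspace (bergman \<Omega>)"
  unfolding complex_subspace_def bergman_def
  by (auto intro: analytic_in_const analytic_in_add analytic_in_scale)

lemma bergman_diff: "f \<in> bergman \<Omega> \<Longrightarrow> g \<in> bergman \<Omega> \<Longrightarrow> (\<lambda>z. f z - g z) \<in> bergman \<Omega>"
  by (rule complex_subspaceD[OF bergman_subspace])

text \<open>The mean value property would need a change of variables on \<open>\<complex>\<^sup>d\<close>. Instead, maximise
  \<open>\<bar>f\<bar> \<cdot> \<rho> ^ D\<close>, where \<open>\<rho>\<close> is the distance to the sphere and \<open>D\<close> the real dimension: near a maximum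
  point \<open>\<bar>f\<bar>\<close> at most multiplies by \<open>2 ^ D\<close>, so by Cauchy's estimate \<open>\<bar>f\<bar>\<close> is comparable to its
  maximal value on a ball of radius proportional to \<open>\<rho>\<close>.\<close>

lemma bergman_eval_bound:
  fixes R :: real
  assumes R: "R > 0"
  obtains C where "C \<ge> 0" "\<And>\<Omega> f (z::complex^'d). open \<Omega> \<Longrightarrow> f \<in> bergman \<Omega> \<Longrightarrow> cball z R \<subseteq> \<Omega> \<Longrightarrow>
    cmod (f z) \<le> C * l2_norm (lebesgue_on \<Omega>) f"
proof -
  define D where "D = DIM(complex^'d)"
  define V where "V = measure lborel (ball (0::complex^'d) 1)"
  have V: "V > 0" unfolding V_def by (rule content_ball_pos) simp
  \<comment> \<open>Within distance c \<rho> of the maximum point the Lipschitz constant 2^D |f z0|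
    / (\<rho> / 4) allows a change of at most 4 c 2^D |f z0| = |f z0| / 2.\<close>
  define c :: real where "c = 1 / 2 ^ (D + 3)"
  have c: "c > 0" "c \<le> 1/4"
  proof -
    have 4: "(4::real) \<le> 2 ^ (D + 3)"     proof -
      have "(1::real) \<le> 2 ^ D" by simp
      moreover have "(2::real) ^ (D + 3) = 8 * 2 ^ D" by (simp add: power_add)
      ultimately show ?thesis by linarith
    qed
    show "c > 0" by (simp add: c_def)
    show "c \<le> 1/4" unfolding c_def by (rule divide_left_mono[OF 4]) auto
  qed
  \<comment> \<open>Combines |f z| R^D <= |f z0| \<rho>^D with the lower bound |f z0| / 2 on a ball
    of volume (c \<rho>)^D V. Of the two factors \<rho>^D one cancels against the volume, the other
    is at most R^D.\<close>
  define C where "C = sqrt (4 / (V * c ^ D * R ^ D))"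
  show thesis
  proof (rule that[of C])
    show "C \<ge> 0" unfolding C_def using V c R by simp
    fix \<Omega> f and z :: "complex^'d"
    assume \<Omega>: "open \<Omega>" and f: "f \<in> bergman \<Omega>" and sub: "cball z R \<subseteq> \<Omega>"
    note fa = bergmanD(2)[OF f] and fl = l2_spaceD[OF bergmanD(1)[OF f]]
    define h where "h x = cmod (f x) * (R - dist z x) ^ D" for x
    have "continuous_on (cball z R) h"
      unfolding h_def using analytic_in_continuous[OF analytic_in_subset[OF fa sub]]
      by (intro continuous_intros)
    then obtain z0 where z0: "z0 \<in> cball z R" "\<And>x. x \<in> cball z R \<Longrightarrow> h x \<le> h z0"
      using continuous_attains_sup[OF compact_cball, of z R h] R by (metis cball_eq_empty less_eq_real_def not_less)
    have hz: "cmod (f z) * R ^ D \<le> h z0" using z0(2)[of z] R by (simp add: h_def)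
    show "cmod (f z) \<le> C * l2_norm (lebesgue_on \<Omega>) f"
    proof (cases "f z = 0")
      case True
      then show ?thesis using \<open>C \<ge> 0\<close> by simp
    next
      case False
      then have "h z0 > 0" using hz R by (smt (verit) mult_pos_pos zero_less_norm_iff zero_less_power)
      define \<rho> where "\<rho> = R - dist z z0"
      have \<rho>0: "\<rho> \<ge> 0" "\<rho> \<le> R" using z0(1) by (auto simp: \<rho>_def)
      have D0: "D > 0" unfolding D_def by simp
      have \<rho>: "\<rho> > 0" and a: "cmod (f z0) > 0"
        using \<open>h z0 > 0\<close> \<rho>0 D0 unfolding h_def \<rho>_def[symmetric]
        by (cases "\<rho> = 0"; auto simp: zero_less_mult_iff power_0_left)+
      have loc: "cball z0 (2 * (\<rho> / 4)) \<subseteq> cball z R"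
      proof
        fix x assume "x \<in> cball z0 (2 * (\<rho> / 4))"
        then show "x \<in> cball z R" using dist_triangle[of z x z0] \<rho> by (auto simp: \<rho>_def dist_commute)
      qed
      have bd: "cmod (f x) \<le> 2 ^ D * cmod (f z0)" if x: "x \<in> cball z0 (2 * (\<rho> / 4))" for x
      proof -
        have "\<rho> / 2 \<le> R - dist z x" using x dist_triangle[of z x z0] by (auto simp: \<rho>_def dist_commute)
        then have "cmod (f x) * (\<rho> / 2) ^ D \<le> h x"
          unfolding h_def using \<rho> by (intro mult_left_mono power_mono) auto
        also have "h x \<le> cmod (f z0) * \<rho> ^ D" using z0(2) loc x by (auto simp: h_def \<rho>_def)
        finally show ?thesis using \<rho> by (simp add: power_divide field_simps)
      qed
      have low: "cmod (f z0) / 2 \<le> cmod (f x)" if x: "x \<in> ball z0 (c * \<rho>)" for x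
      proof -
        have "c * \<rho> \<le> 1/4 * \<rho>" using c \<rho> by (intro mult_right_mono) auto
        then have x': "x \<in> cball z0 (\<rho> / 4)" using x by auto
        have "cmod (f z0 - f x) \<le> 2 ^ D * cmod (f z0) / (\<rho> / 4) * norm (z0 - x)"
          by (rule analytic_lipschitz[OF analytic_in_subset[OF fa] _ bd _ x'])
            (use loc sub \<rho> in auto)
        also have "\<dots> \<le> 2 ^ D * cmod (f z0) / (\<rho> / 4) * (c * \<rho>)"
          using x \<rho> by (intro mult_left_mono) (auto simp: dist_norm)
        also have "\<dots> = cmod (f z0) / 2" using \<rho> by (simp add: c_def power_add field_simps)
        finally show ?thesis using norm_triangle_ineq2[of "f z0" "f x"] by linarith
      qed
      let ?S = "ball z0 (c * \<rho>)"
      have S: "?S \<subseteq> \<Omega>"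
      proof
        fix x assume "x \<in> ?S"
        moreover have "c * \<rho> \<le> 1/4 * \<rho>" using c \<rho> by (intro mult_right_mono) auto
        ultimately have "dist z0 x \<le> 2 * (\<rho> / 4)" using \<rho> unfolding mem_ball by linarith
        then have "x \<in> cball z0 (2 * (\<rho> / 4))" by simp
        then show "x \<in> \<Omega>" using loc sub by blast
      qed
      have meas: "\<Omega> \<in> sets lebesgue" using \<Omega> by auto
      have Sm: "?S \<in> sets (lebesgue_on \<Omega>)"
        using S meas by (simp add: sets_restrict_space_iff)
      have mS: "measure (lebesgue_on \<Omega>) ?S = (c * \<rho>) ^ D * V"
      proof -
        have "measure (lebesgue_on \<Omega>) ?S = measure lebesgue ?S"
          using S meas by (intro measure_restrict_space) auto
        also have "\<dots> = measure lborel ?S" by simp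
        also have "\<dots> = (c * \<rho>) ^ D * V"
          unfolding D_def V_def using c \<rho> by (intro content_ball_conv_unit_ball) simp
        finally show ?thesis .
      qed
      have "measure (lebesgue_on \<Omega>) ?S * (cmod (f z0) / 2)\<^sup>2 =
          (\<integral>x. indicator ?S x * (cmod (f z0) / 2)\<^sup>2 \<partial>lebesgue_on \<Omega>)"
        using Sm S by (simp add: Int_absorb1 Int_absorb2)
      also have "\<dots> \<le> (\<integral>x. (cmod (f x))\<^sup>2 \<partial>lebesgue_on \<Omega>)"
      proof (rule integral_mono[OF _ fl(2)])
        have "emeasure (lebesgue_on \<Omega>) ?S < \<infinity>"
          using S meas emeasure_lborel_ball_finite[of z0 "c * \<rho>"] by (simp add: emeasure_restrict_space)
        then show "integrable (lebesgue_on \<Omega>) (\<lambda>x. indicator ?S x * (cmod (f z0) / 2)\<^sup>2)"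
          using Sm S by (intro integrable_mult_left) (simp add: integrable_indicator_iff Int_absorb2)
        show "indicator ?S x * (cmod (f z0) / 2)\<^sup>2 \<le> (cmod (f x))\<^sup>2" for x
          using low[of x] power_mono[of "cmod (f z0) / 2" "cmod (f x)" 2] by (auto simp: indicator_def)
      qed
      also have "\<dots> = (l2_norm (lebesgue_on \<Omega>) f)\<^sup>2" by (simp add: l2_norm_power2)
      finally have 1: "(c * \<rho>) ^ D * V * (cmod (f z0) / 2)\<^sup>2 \<le> (l2_norm (lebesgue_on \<Omega>) f)\<^sup>2"
        by (simp add: mS)
      have "(cmod (f z) * R ^ D)\<^sup>2 \<le> (cmod (f z0) * \<rho> ^ D)\<^sup>2"
        using hz R by (intro power_mono) (auto simp: h_def \<rho>_def)
      also have "\<dots> = (cmod (f z0))\<^sup>2 * \<rho> ^ D * \<rho> ^ D" by (simp add: power_mult_distrib power2_eq_square)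
      also have "\<dots> \<le> (cmod (f z0))\<^sup>2 * \<rho> ^ D * R ^ D"
        using \<rho>0 by (intro mult_left_mono power_mono) auto
      also have "\<dots> = 4 / (V * c ^ D) * ((c * \<rho>) ^ D * V * (cmod (f z0) / 2)\<^sup>2) * R ^ D"
        using V c by (simp add: power_mult_distrib power_divide field_simps)
      also have "\<dots> \<le> 4 / (V * c ^ D) * (l2_norm (lebesgue_on \<Omega>) f)\<^sup>2 * R ^ D"
        using 1 V c R by (intro mult_right_mono mult_left_mono) auto
      finally have "(cmod (f z))\<^sup>2 * R ^ D * R ^ D \<le> 4 / (V * c ^ D) * (l2_norm (lebesgue_on \<Omega>) f)\<^sup>2 * R ^ D"
        by (simp add: power_mult_distrib power2_eq_square mult_ac)
      then have "(cmod (f z))\<^sup>2 * R ^ D \<le> 4 / (V * c ^ D) * (l2_norm (lebesgue_on \<Omega>) f)\<^sup>2"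
        using R by (subst (asm) mult_le_cancel_right) auto
      then have "(cmod (f z))\<^sup>2 \<le> 4 / (V * c ^ D * R ^ D) * (l2_norm (lebesgue_on \<Omega>) f)\<^sup>2"
        using R V c by (simp add: field_simps)
      also have "\<dots> = (C * l2_norm (lebesgue_on \<Omega>) f)\<^sup>2"
        unfolding C_def power_mult_distrib using V c R by simp
      finally show ?thesis using \<open>C \<ge> 0\<close> by (intro power2_le_imp_le[of "cmod (f z)"]) auto
    qed
  qed
qed

text \<open>The constant of \<open>bergman_eval_bound\<close> depends only on the radius, so it
  serves all points near z at once; r is a quarter of the available radius, which leaves a ball of
  radius 2 r around each point of \<open>cball z (2 * r)\<close>.\<close>

lemma bergman_local_bound:
  fixes \<Omega> :: "(complex^'d) set"
  assumes \<Omega>: "open \<Omega>" and z: "z \<in> \<Omega>"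
  obtains r C where "r > 0" "C \<ge> 0" "cball z (2 * r) \<subseteq> \<Omega>"
    "\<And>f x. f \<in> bergman \<Omega> \<Longrightarrow> x \<in> cball z (2 * r) \<Longrightarrow> cmod (f x) \<le> C * l2_norm (lebesgue_on \<Omega>) f"
    "\<And>f x y. f \<in> bergman \<Omega> \<Longrightarrow> x \<in> cball z r \<Longrightarrow> y \<in> cball z r \<Longrightarrow>
      cmod (f x - f y) \<le> C * l2_norm (lebesgue_on \<Omega>) f * norm (x - y)"
proof -
  obtain e where e: "e > 0" "cball z e \<subseteq> \<Omega>" using \<Omega> z open_contains_cball by blast
  define r where "r = e / 4"
  have r: "r > 0" "cball z (4 * r) \<subseteq> \<Omega>" using e by (auto simp: r_def)
  obtain C where C: "C \<ge> 0" "\<And>\<Omega> f (z::complex^'d). open \<Omega> \<Longrightarrow> f \<in> bergman \<Omega> \<Longrightarrow> cball z (2 * r) \<subseteq> \<Omega> \<Longrightarrow>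
      cmod (f z) \<le> C * l2_norm (lebesgue_on \<Omega>) f"
    using bergman_eval_bound[of "2 * r"] r(1) by (metis mult_pos_pos zero_less_numeral)
  have sub: "cball x (2 * r) \<subseteq> \<Omega>" if "x \<in> cball z (2 * r)" for x
  proof
    fix y assume "y \<in> cball x (2 * r)"
    then have "y \<in> cball z (4 * r)" using that dist_triangle[of z y x] by auto
    then show "y \<in> \<Omega>" using r(2) by blast
  qed
  have sub0: "cball z (2 * r) \<subseteq> \<Omega>" using sub[of z] r by auto
  have bd: "cmod (f x) \<le> C * l2_norm (lebesgue_on \<Omega>) f" if "f \<in> bergman \<Omega>" "x \<in> cball z (2 * r)" for f x
    by (rule C(2)[OF \<Omega> that(1) sub[OF that(2)]])
  show thesis
  proof (rule that[of r "max C (C / r)"])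
    fix f x assume f: "f \<in> bergman \<Omega>" and x: "x \<in> cball z (2 * r)"
    have "C * l2_norm (lebesgue_on \<Omega>) f \<le> max C (C / r) * l2_norm (lebesgue_on \<Omega>) f"
      by (intro mult_right_mono) auto
    then show "cmod (f x) \<le> max C (C / r) * l2_norm (lebesgue_on \<Omega>) f" using bd[OF f x] by linarith
  next
    fix f x y assume f: "f \<in> bergman \<Omega>" and xy: "x \<in> cball z r" "y \<in> cball z r"
    have "cmod (f x - f y) \<le> C * l2_norm (lebesgue_on \<Omega>) f / r * norm (x - y)"
      by (rule analytic_lipschitz[OF analytic_in_subset[OF bergmanD(2)[OF f] sub0] r(1) bd[OF f] xy])
    also have "\<dots> = C / r * l2_norm (lebesgue_on \<Omega>) f * norm (x - y)" by simp
    also have "\<dots> \<le> max C (C / r) * l2_norm (lebesgue_on \<Omega>) f * norm (x - y)"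
      by (intro mult_right_mono) auto
    finally show "cmod (f x - f y) \<le> max C (C / r) * l2_norm (lebesgue_on \<Omega>) f * norm (x - y)" .
  qed (use r C sub0 in auto)
qed

text \<open>A norm Cauchy sequence is locally uniformly Cauchy, and by Cauchy's estimate so are its
  derivatives; hence the limit is differentiable and its derivative, as a pointwise limit, is
  complex linear. The limit is the pointwise one, so values at points remain meaningful.\<close>

lemma bergman_complete:
  fixes \<Omega> :: "(complex^'d) set"
  assumes \<Omega>: "open \<Omega>" and s: "\<And>n. s n \<in> bergman \<Omega>"
    and cauchy: "\<And>e. e > 0 \<Longrightarrow> \<exists>N. \<forall>m\<ge>N. \<forall>n\<ge>N. l2_norm (lebesgue_on \<Omega>) (\<lambda>x. s m x - s n x) < e"
  obtains g where "g \<in> bergman \<Omega>" "(\<lambda>n. l2_norm (lebesgue_on \<Omega>) (\<lambda>x. s n x - g x)) \<longlonglongrightarrow> 0"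
    "\<And>z. (\<lambda>n. s n z) \<longlonglongrightarrow> g z"
proof -
  let ?M = "lebesgue_on \<Omega>"
  define D where "D n z = (SOME D. (s n has_derivative D) (at z) \<and> (\<forall>c v. D (c *s v) = c * D v))" for n z
  have "\<exists>D. (s n has_derivative D) (at z) \<and> (\<forall>c v. D (c *s v) = c * D v)" if "z \<in> \<Omega>" for n z
    using bergmanD(2)[OF s[of n]] that by (auto simp: analytic_in_def)
  from someI_ex[OF this] have D: "\<And>n z. z \<in> \<Omega> \<Longrightarrow> (s n has_derivative D n z) (at z)"
      "\<And>n z c v. z \<in> \<Omega> \<Longrightarrow> D n z (c *s v) = c * D n z v"
    unfolding D_def by blast+
  have diff: "(\<lambda>x. s m x - s n x) \<in> bergman \<Omega>" for m n by (rule bergman_diff[OF s s])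
  have conv: "convergent (\<lambda>n. s n z)" for z
  proof (cases "z \<in> \<Omega>")
    case True
    then obtain r C where r: "r > 0" "C \<ge> 0"
      "\<And>f x. f \<in> bergman \<Omega> \<Longrightarrow> x \<in> cball z (2 * r) \<Longrightarrow> cmod (f x) \<le> C * l2_norm ?M f"
      using bergman_local_bound[OF \<Omega> True] by metis
    have "Cauchy (\<lambda>n. s n z)"
    proof (rule metric_CauchyI)
      fix e :: real assume e: "e > 0"
      then have "e / (C + 1) > 0" using r(2) by simp
      from cauchy[OF this] obtain N where
        N: "\<And>m n. m \<ge> N \<Longrightarrow> n \<ge> N \<Longrightarrow> l2_norm ?M (\<lambda>x. s m x - s n x) < e / (C + 1)" by blast
      have "dist (s m z) (s n z) < e" if "m \<ge> N" "n \<ge> N" for m n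
      proof -
        have "dist (s m z) (s n z) \<le> C * l2_norm ?M (\<lambda>x. s m x - s n x)"
          using r(3)[OF diff, of z m n] r(1) by (simp add: dist_norm)
        also have "\<dots> \<le> C * (e / (C + 1))" using N[OF that] r(2) by (intro mult_left_mono) auto
        also have "\<dots> < e" using e r(2) by (simp add: field_simps)
        finally show ?thesis .
      qed
      then show "\<exists>N. \<forall>m\<ge>N. \<forall>n\<ge>N. dist (s m z) (s n z) < e" by blast
    qed
    then show ?thesis by (rule Cauchy_convergent)
  next
    case False
    then have "(\<lambda>n. s n z) = (\<lambda>n. 0)" using bergmanD(3)[OF s] by auto
    then show ?thesis by (simp add: convergent_const)
  qed
  define g where "g z = lim (\<lambda>n. s n z)" for z
  have lim: "(\<lambda>n. s n z) \<longlonglongrightarrow> g z" for z using conv[of z] by (simp add: g_def convergent_LIMSEQ_iff)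
  have g0: "g z = 0" if "z \<notin> \<Omega>" for z
    using lim[of z] bergmanD(3)[OF s that] by (simp add: LIMSEQ_const_iff)
  have ana: "analytic_in g \<Omega>"
    unfolding analytic_in_def
  proof
    fix z assume z: "z \<in> \<Omega>"
    obtain r C where r: "r > 0" "C \<ge> 0" "cball z (2 * r) \<subseteq> \<Omega>"
      "\<And>f x. f \<in> bergman \<Omega> \<Longrightarrow> x \<in> cball z (2 * r) \<Longrightarrow> cmod (f x) \<le> C * l2_norm ?M f"
      using bergman_local_bound[OF \<Omega> z] by metis
    have sub: "cball x r \<subseteq> cball z (2 * r)" if "x \<in> ball z r" for x
    proof
      fix y assume "y \<in> cball x r"
      then show "y \<in> cball z (2 * r)" using that dist_triangle[of z y x] by auto
    qed
    have Dd: "cmod (D m x v - D n x v) \<le> C * l2_norm ?M (\<lambda>x. s m x - s n x) / r * norm v"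
      if x: "x \<in> ball z r" for x v m n
    proof (rule analytic_deriv_bound[where f = "\<lambda>x. s m x - s n x" and z = x and r = r and D = "\<lambda>v. D m x v - D n x v"])
      have x\<Omega>: "x \<in> \<Omega>" using subsetD[OF sub[OF x], of x] r by auto
      show "analytic_in (\<lambda>x. s m x - s n x) (cball x r)"
        using sub[OF x] r(3) by (intro analytic_in_subset[OF bergmanD(2)[OF diff]]) auto
      show "cmod (s m y - s n y) \<le> C * l2_norm ?M (\<lambda>x. s m x - s n x)" if "y \<in> cball x r" for y
        using r(4)[OF diff, of y m n] sub[OF x] that by auto
      show "((\<lambda>x. s m x - s n x) has_derivative (\<lambda>v. D m x v - D n x v)) (at x)"
        by (intro has_derivative_diff D(1) x\<Omega>)
      show "D m x (c *s v) - D n x (c *s v) = c * (D m x v - D n x v)" for c v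
        by (simp add: D(2)[OF x\<Omega>] right_diff_distrib)
    qed fact
    have unif: "\<exists>N. \<forall>m\<ge>N. \<forall>n\<ge>N. \<forall>x\<in>ball z r. \<forall>v. cmod (D m x v - D n x v) \<le> e * norm v" if e: "e > 0" for e
    proof -
      have "e * r / (C + 1) > 0" using e r by simp
      from cauchy[OF this] obtain N where
        N: "\<And>m n. m \<ge> N \<Longrightarrow> n \<ge> N \<Longrightarrow> l2_norm ?M (\<lambda>x. s m x - s n x) < e * r / (C + 1)" by blast
      have "cmod (D m x v - D n x v) \<le> e * norm v" if "m \<ge> N" "n \<ge> N" "x \<in> ball z r" for m n x v
      proof -
        have "C * l2_norm ?M (\<lambda>x. s m x - s n x) \<le> C * (e * r / (C + 1))"
          using N[OF that(1,2)] r(2) by (intro mult_left_mono) auto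
        also have "\<dots> \<le> e * r" using e r by (simp add: field_simps)
        finally have "C * l2_norm ?M (\<lambda>x. s m x - s n x) / r \<le> e" using r(1) by (simp add: field_simps)
        then show ?thesis using Dd[OF that(3), of m v n] mult_right_mono[of _ e "norm v"] by (meson norm_ge_zero order_trans)
      qed
      then show ?thesis by blast
    qed
    define g' where "g' x v = lim (\<lambda>n. D n x v)" for x v
    have limD: "(\<lambda>n. D n x v) \<longlonglongrightarrow> g' x v" if x: "x \<in> ball z r" for x v
    proof -
      have "Cauchy (\<lambda>n. D n x v)"
      proof (rule metric_CauchyI)
        fix e :: real assume e: "e > 0"
        define e' where "e' = e / (norm v + 1)"
        have e': "e' > 0" "e' * norm v < e"
          unfolding e'_def using e norm_ge_zero[of v] by (auto simp: field_simps add_pos_nonneg intro!: divide_pos_pos)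
        obtain N where N: "\<forall>m\<ge>N. \<forall>n\<ge>N. \<forall>x\<in>ball z r. \<forall>v. cmod (D m x v - D n x v) \<le> e' * norm v"
          using unif[OF e'(1)] by blast
        then show "\<exists>N. \<forall>m\<ge>N. \<forall>n\<ge>N. dist (D m x v) (D n x v) < e"
          using x e'(2) unfolding dist_norm by (meson le_less_trans)
      qed
      then show ?thesis by (simp add: g'_def Cauchy_convergent convergent_LIMSEQ_iff[symmetric])
    qed
    have "\<exists>G. \<forall>x\<in>ball z r. (\<lambda>n. s n x) \<longlonglongrightarrow> G x \<and> (G has_derivative g' x) (at x within ball z r)"
    proof (rule has_derivative_sequence[OF convex_ball, where f' = D and f = s and ?x0.0 = z and l = "g z"])
      show "(s n has_derivative D n x) (at x within ball z r)" if x: "x \<in> ball z r" for n x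
        using subsetD[OF sub[OF x], of x] r by (intro has_derivative_at_withinI[OF D(1)]) auto
      fix e :: real assume e: "e > 0"
      obtain N where N: "\<And>m n x v. m \<ge> N \<Longrightarrow> n \<ge> N \<Longrightarrow> x \<in> ball z r \<Longrightarrow> cmod (D m x v - D n x v) \<le> e * norm v"
        using unif[OF e] by blast
      have "norm (D n x v - g' x v) \<le> e * norm v" if "n \<ge> N" "x \<in> ball z r" for n x v
      proof (rule LIMSEQ_le_const2)
        show "(\<lambda>m. norm (D n x v - D m x v)) \<longlonglongrightarrow> norm (D n x v - g' x v)"
          by (intro tendsto_intros limD that)
        show "\<exists>M. \<forall>m\<ge>M. norm (D n x v - D m x v) \<le> e * norm v" using N that by blast
      qed
      then show "\<forall>\<^sub>F n in sequentially. \<forall>x\<in>ball z r. \<forall>v. norm (D n x v - g' x v) \<le> e * norm v"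
        unfolding eventually_sequentially by blast
    qed (use r lim in auto)
    then obtain G where G: "\<And>x. x \<in> ball z r \<Longrightarrow> (\<lambda>n. s n x) \<longlonglongrightarrow> G x"
      "\<And>x. x \<in> ball z r \<Longrightarrow> (G has_derivative g' x) (at x within ball z r)" by blast
    have zb: "z \<in> ball z r" using r by simp
    have "(G has_derivative g' z) (at z)" using G(2)[OF zb] at_within_open[OF zb open_ball] by simp
    then have "(g has_derivative g' z) (at z)"
      by (rule has_derivative_transform_within_open[OF _ open_ball zb]) (use G(1) lim LIMSEQ_unique in blast)
    moreover have "g' z (c *s v) = c * g' z v" for c v
    proof (rule LIMSEQ_unique)
      show "(\<lambda>n. D n z (c *s v)) \<longlonglongrightarrow> g' z (c *s v)" by (rule limD[OF zb])
      show "(\<lambda>n. D n z (c *s v)) \<longlonglongrightarrow> c * g' z v" unfolding D(2)[OF z] by (intro tendsto_intros limD[OF zb])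
    qed
    ultimately show "\<exists>D. (g has_derivative D) (at z) \<and> (\<forall>c v. D (c *s v) = c * D v)" by blast
  qed
  have sl: "s n \<in> l2_space ?M" for n by (rule bergmanD(1)[OF s])
  have gm: "g \<in> borel_measurable ?M"
    by (rule borel_measurable_LIMSEQ_metric[OF l2_spaceD(1)[OF sl]]) (rule lim)
  have key: "(\<lambda>x. s n x - g x) \<in> l2_space ?M \<and> l2_norm ?M (\<lambda>x. s n x - g x) \<le> e"
    if N: "\<And>i j. i \<ge> N \<Longrightarrow> j \<ge> N \<Longrightarrow> l2_norm ?M (\<lambda>x. s i x - s j x) < e" and n: "n \<ge> N" for N n e
  proof -
    have 1: "(\<lambda>x. s n x - s (i + N) x) \<in> l2_space ?M" for i using sl by auto
    have 2: "l2_norm ?M (\<lambda>x. s n x - s (i + N) x) \<le> e" for i using N[of n "i + N"] n by simp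
    have 3: "AE x in ?M. (\<lambda>i. s n x - s (i + N) x) \<longlonglongrightarrow> s n x - g x"
      by (intro AE_I2 tendsto_intros LIMSEQ_ignore_initial_segment[OF lim])
    show ?thesis
      using l2_fatou[OF 1 2 _ 3] gm l2_spaceD(1)[OF sl[of n]] by (auto intro: borel_measurable_diff)
  qed
  have "g \<in> l2_space ?M"
  proof -
    obtain N where N: "\<And>i j. i \<ge> N \<Longrightarrow> j \<ge> N \<Longrightarrow> l2_norm ?M (\<lambda>x. s i x - s j x) < 1"
      using cauchy[of 1] by auto
    from key[OF N, of N] have "(\<lambda>x. s N x - g x) \<in> l2_space ?M" by simp
    from l2_diff[OF sl[of N] this] show ?thesis by simp
  qed
  then have gb: "g \<in> bergman \<Omega>" using ana g0 by (simp add: bergman_def)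
  have "(\<lambda>n. l2_norm ?M (\<lambda>x. s n x - g x)) \<longlonglongrightarrow> 0"
  proof (rule LIMSEQ_I)
    fix e :: real assume "e > 0"
    then have "e / 2 > 0" by simp
    from cauchy[OF this] obtain N where
      N: "\<And>i j. i \<ge> N \<Longrightarrow> j \<ge> N \<Longrightarrow> l2_norm ?M (\<lambda>x. s i x - s j x) < e / 2" by blast
    show "\<exists>N. \<forall>n\<ge>N. norm (l2_norm ?M (\<lambda>x. s n x - g x) - 0) < e"
    proof (intro exI[of _ N] allI impI)
      fix n assume "n \<ge> N"
      from key[OF N this] \<open>e > 0\<close> show "norm (l2_norm ?M (\<lambda>x. s n x - g x) - 0) < e" by simp
    qed
  qed
  with gb lim show thesis by (intro that)
qed

subsection \<open>Point evaluations as vector functionals\<close>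

lemma l2_convergent_cauchy:
  assumes "\<And>n. s n \<in> l2_space M" "g \<in> l2_space M"
    and "(\<lambda>n. l2_norm M (\<lambda>x. s n x - g x)) \<longlonglongrightarrow> 0" and "e > 0"
  shows "\<exists>N. \<forall>m\<ge>N. \<forall>n\<ge>N. l2_norm M (\<lambda>x. s m x - s n x) < e"
proof -
  have "e / 2 > 0" using assms(4) by simp
  from LIMSEQ_D[OF assms(3) this] obtain N
    where N: "\<forall>n\<ge>N. norm (l2_norm M (\<lambda>x. s n x - g x) - 0) < e / 2" by (elim exE)
  have "l2_norm M (\<lambda>x. s m x - s n x) < e" if "m \<ge> N" "n \<ge> N" for m n
    using l2_norm_triangle_diff[OF assms(1)[of m] assms(2) assms(1)[of n]] N[rule_format, OF that(1)]
      N[rule_format, OF that(2)] l2_norm_minus_commute[of M g "s n"] by simp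
  then show ?thesis by blast
qed

lemma l2_cmod: "g \<in> l2_space M \<Longrightarrow> (\<lambda>x. complex_of_real (cmod (g x))) \<in> l2_space M"
  by (auto simp: l2_space_def)

lemma l2_inner_cong_norm0:
  assumes "g \<in> l2_space M" "h \<in> l2_space M" "k \<in> l2_space M" "l2_norm M (\<lambda>x. g x - h x) = 0"
  shows "l2_inner M k g = l2_inner M k h" "l2_norm M g = l2_norm M h"
proof -
  have "cmod (l2_inner M k (\<lambda>x. g x - h x)) \<le> 0"
    using l2_cauchy_schwarz[OF assms(3) l2_diff[OF assms(1,2)]] assms(4) by simp
  then show "l2_inner M k g = l2_inner M k h" using assms by (simp add: l2_inner_diff_right)
  show "l2_norm M g = l2_norm M h"
    using l2_norm_le_add_diff[OF assms(1,2)] l2_norm_le_add_diff[OF assms(2,1)] assms(4)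
      l2_norm_minus_commute[of M g h] by simp
qed

text \<open>More than weak convergence, because of the absolute values under the integral. Cut |u n|
  off at height R |p|: the cut part tends to 0 by dominated convergence, and where |u n| exceeds the
  height, |p| |u n| is at most |u n|^2 / R.\<close>

lemma l2_pointwise_null_weak:
  fixes u :: "nat \<Rightarrow> 'a \<Rightarrow> complex"
  assumes u: "\<And>n. u n \<in> l2_space M" "\<And>n. l2_norm M (u n) \<le> 1" "\<And>x. x \<in> space M \<Longrightarrow> (\<lambda>n. u n x) \<longlonglongrightarrow> 0"
    and p: "p \<in> l2_space M"
  shows "(\<lambda>n. \<integral>x. cmod (p x) * cmod (u n x) \<partial>M) \<longlonglongrightarrow> 0"
proof (rule LIMSEQ_I)
  fix e :: real assume e: "e > 0"
  \<comment> \<open>The part above the cut contributes at most 1 / R = e / 2.\<close>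
  define R where "R = 2 / e"
  have R: "R > 0" using e by (simp add: R_def)
  have [measurable]: "p \<in> borel_measurable M" "u n \<in> borel_measurable M" for n
    using u p by (auto dest: l2_spaceD)
  let ?m = "\<lambda>n x. cmod (p x) * min (cmod (u n x)) (R * cmod (p x))"
  have dom: "integrable M (\<lambda>x. R * (cmod (p x))\<^sup>2)" using p by (auto dest: l2_spaceD)
  have le: "?m n x \<le> R * (cmod (p x))\<^sup>2" for n :: nat and x :: 'a
    using mult_left_mono[of "min (cmod (u n x)) (R * cmod (p x))" "R * cmod (p x)" "cmod (p x)"]
    by (simp add: power2_eq_square mult_ac)
  have m0: "0 \<le> ?m n x" for n x using R by simp
  have int: "integrable M (?m n)" for n
    by (rule Bochner_Integration.integrable_bound[OF dom]) (use le m0 R in \<open>auto intro!: AE_I2 simp: abs_of_nonneg\<close>)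
  have "(\<lambda>n. \<integral>x. ?m n x \<partial>M) \<longlonglongrightarrow> (\<integral>x. 0 \<partial>M)"
  proof (rule integral_dominated_convergence[OF _ _ dom])
    show "AE x in M. (\<lambda>n. ?m n x) \<longlonglongrightarrow> 0"
    proof (intro AE_I2)
      fix x assume "x \<in> space M"
      then have lim: "(\<lambda>n. cmod (p x) * cmod (u n x)) \<longlonglongrightarrow> 0"
        using tendsto_mult_left[OF tendsto_norm[OF u(3)], of x "cmod (p x)"] by simp
      have bd: "norm (?m n x) \<le> cmod (p x) * cmod (u n x)" for n
      proof -
        have "norm (?m n x) = ?m n x" using m0[of x n] by (simp only: real_norm_def abs_of_nonneg)
        also have "\<dots> \<le> cmod (p x) * cmod (u n x)" by (intro mult_left_mono) auto
        finally show ?thesis .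
      qed
      show "(\<lambda>n. ?m n x) \<longlonglongrightarrow> 0"
        by (rule Lim_null_comparison[OF always_eventually lim]) (use bd in blast)
    qed
    show "AE x in M. norm (?m n x) \<le> R * (cmod (p x))\<^sup>2" for n
      using le m0 by (intro AE_I2) (simp add: abs_of_nonneg)
  qed measurable
  then have lim0: "(\<lambda>n. \<integral>x. ?m n x \<partial>M) \<longlonglongrightarrow> 0" by simp
  have "e / 2 > 0" using e by simp
  from LIMSEQ_D[OF lim0 this] obtain N
    where N: "\<forall>n\<ge>N. norm ((\<integral>x. ?m n x \<partial>M) - 0) < e / 2" by (elim exE)
  have "norm ((\<integral>x. cmod (p x) * cmod (u n x) \<partial>M) - 0) < e" if n: "n \<ge> N" for n
  proof -
    have pt: "cmod (p x) * cmod (u n x) \<le> (cmod (u n x))\<^sup>2 / R + ?m n x" for x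
    proof (cases "cmod (u n x) \<le> R * cmod (p x)")
      case True
      then show ?thesis using R by (simp add: min_absorb1)
    next
      case False
      then have "cmod (p x) \<le> cmod (u n x) / R" using R by (simp add: field_simps)
      from mult_right_mono[OF this, of "cmod (u n x)"] show ?thesis
        using m0[of x n] by (simp add: power2_eq_square)
    qed
    have "(\<integral>x. cmod (p x) * cmod (u n x) \<partial>M) \<le> (\<integral>x. (cmod (u n x))\<^sup>2 / R + ?m n x \<partial>M)"
      using u p int by (intro integral_mono pt integrable_l2_cmod_mult Bochner_Integration.integrable_add
          Bochner_Integration.integrable_divide) (auto dest: l2_spaceD)
    also have "\<dots> = (l2_norm M (u n))\<^sup>2 / R + (\<integral>x. ?m n x \<partial>M)"
      using int l2_spaceD(2)[OF u(1)[of n]] by (simp add: l2_norm_power2)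
    also have "\<dots> < e"
    proof -
      have "(l2_norm M (u n))\<^sup>2 \<le> 1" using u(2)[of n] by (simp add: power_le_one)
      then have "(l2_norm M (u n))\<^sup>2 / R \<le> e / 2" using R e by (simp add: R_def field_simps)
      then show ?thesis using N[rule_format, OF n] unfolding real_norm_def diff_zero by linarith
    qed
    finally show ?thesis by (simp add: abs_of_nonneg)
  qed
  then show "\<exists>N. \<forall>n\<ge>N. norm ((\<integral>x. cmod (p x) * cmod (u n x) \<partial>M) - 0) < e" by blast
qed

section \<open>Bounded analytic functions as multipliers, and extremal functions with prescribed
  zeros\<close>

locale bounded_open =
  fixes \<Omega> :: "(complex^'d) set"
  assumes open_\<Omega>: "open \<Omega>" and bounded_\<Omega>: "bounded \<Omega>"
begin

abbreviation \<mu> :: "(complex^'d) measure" where "\<mu> \<equiv> lebesgue_on \<Omega>"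

lemma finite_\<mu>: "finite_measure \<mu>"
  using lmeasurable_open[OF bounded_\<Omega> open_\<Omega>] by (rule finite_measure_lebesgue_on)

lemma sets_\<Omega>: "\<Omega> \<in> sets lebesgue"
  using open_\<Omega> by auto

lemma Hinf_measurable: "\<phi> \<in> Hinf \<Omega> \<Longrightarrow> \<phi> \<in> borel_measurable \<mu>"
  using continuous_imp_measurable_on_sets_lebesgue[OF analytic_in_continuous sets_\<Omega>] by (auto simp: Hinf_def)

lemma Hinf_bound:
  assumes "\<phi> \<in> Hinf \<Omega>"
  obtains B where "B \<ge> 0" "\<And>x. cmod (\<phi> x) \<le> B"
proof -
  obtain B where B: "\<And>x. x \<in> \<Omega> \<Longrightarrow> cmod (\<phi> x) \<le> B"
    using assms by (auto simp: Hinf_def bounded_iff)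
  have "cmod (\<phi> x) \<le> max B 0" for x
    using B[of x] assms by (cases "x \<in> \<Omega>") (auto simp: Hinf_def)
  then show thesis by (intro that[of "max B 0"]) auto
qed

lemma Hinf_mult_l2:
  assumes "\<phi> \<in> Hinf \<Omega>" "f \<in> l2_space \<mu>"
  shows "(\<lambda>z. \<phi> z * f z) \<in> l2_space \<mu>"
  using Hinf_bound[OF assms(1)] l2_bounded_mult(1)[OF assms(2) Hinf_measurable[OF assms(1)]] by metis

lemma Hinf_mult_bergman:
  assumes "\<phi> \<in> Hinf \<Omega>" "f \<in> bergman \<Omega>"
  shows "(\<lambda>z. \<phi> z * f z) \<in> bergman \<Omega>"
  using Hinf_mult_l2[OF assms(1) bergmanD(1)[OF assms(2)]] assms
  by (auto simp: bergman_def Hinf_def intro: analytic_in_mult)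

lemma indicator_Hinf: "indicator \<Omega> \<in> Hinf \<Omega>"
proof -
  have "analytic_in (indicator \<Omega> :: _ \<Rightarrow> complex) \<Omega>"
    by (rule analytic_in_cong[OF analytic_in_const[of 1] open_\<Omega>]) simp
  moreover have "bounded ((indicator \<Omega> :: _ \<Rightarrow> complex) ` \<Omega>)"
    by (rule boundedI[of _ 1]) auto
  ultimately show ?thesis by (simp add: Hinf_def)
qed

lemma Hinf_add: "\<phi> \<in> Hinf \<Omega> \<Longrightarrow> \<psi> \<in> Hinf \<Omega> \<Longrightarrow> (\<lambda>z. \<phi> z + \<psi> z) \<in> Hinf \<Omega>"
  by (auto simp: Hinf_def intro: analytic_in_add bounded_plus_comp)

lemma Hinf_mult:
  assumes "\<phi> \<in> Hinf \<Omega>" "\<psi> \<in> Hinf \<Omega>"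
  shows "(\<lambda>z. \<phi> z * \<psi> z) \<in> Hinf \<Omega>"
proof -
  obtain B C where "B \<ge> 0" "\<And>x. cmod (\<phi> x) \<le> B" "\<And>x. cmod (\<psi> x) \<le> C"
    using Hinf_bound[OF assms(1)] Hinf_bound[OF assms(2)] by metis
  then have "bounded ((\<lambda>z. \<phi> z * \<psi> z) ` \<Omega>)"
    by (auto intro!: boundedI[of _ "B * C"] mult_mono simp: norm_mult)
  with assms show ?thesis by (auto simp: Hinf_def intro: analytic_in_mult)
qed

lemma Hinf_scale: "\<phi> \<in> Hinf \<Omega> \<Longrightarrow> (\<lambda>z. c * \<phi> z) \<in> Hinf \<Omega>"
proof -
  assume a: "\<phi> \<in> Hinf \<Omega>"
  obtain B where "B \<ge> 0" "\<And>x. cmod (\<phi> x) \<le> B" using Hinf_bound[OF a] by blast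
  then have "bounded ((\<lambda>z. c * \<phi> z) ` \<Omega>)"
    by (auto intro!: boundedI[of _ "cmod c * B"] mult_left_mono simp: norm_mult)
  with a show ?thesis by (auto simp: Hinf_def intro: analytic_in_scale)
qed

lemma Hinf_diff: "\<phi> \<in> Hinf \<Omega> \<Longrightarrow> \<psi> \<in> Hinf \<Omega> \<Longrightarrow> (\<lambda>z. \<phi> z - \<psi> z) \<in> Hinf \<Omega>"
  using Hinf_add[of \<phi> "\<lambda>z. -1 * \<psi> z"] Hinf_scale[of \<psi> "-1"] by simp

lemma Hinf_subset_bergman: "Hinf \<Omega> \<subseteq> bergman \<Omega>"
proof
  fix \<phi> assume a: "\<phi> \<in> Hinf \<Omega>"
  obtain B where "B \<ge> 0" "\<And>x. cmod (\<phi> x) \<le> B" using Hinf_bound[OF a] by blast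
  then have "\<phi> \<in> l2_space \<mu>" by (intro l2_finite_bounded[OF finite_\<mu> Hinf_measurable[OF a]])
  with a show "\<phi> \<in> bergman \<Omega>" by (auto simp: bergman_def Hinf_def)
qed

text \<open>A product of normalised coordinate differences; these are bounded because the domain
  is.\<close>

lemma Hinf_separate:
  assumes "a \<in> \<Omega>" "finite F" "a \<notin> F"
  shows "\<exists>h\<in>Hinf \<Omega>. h a = 1 \<and> (\<forall>\<zeta>\<in>F. h \<zeta> = 0)"
  using assms(2,3)
proof (induction F)
  case empty
  then show ?case using indicator_Hinf assms(1) by (intro bexI[of _ "indicator \<Omega>"]) auto
next
  case (insert \<zeta> F)
  then obtain h where h: "h \<in> Hinf \<Omega>" "h a = 1" "\<forall>\<zeta>\<in>F. h \<zeta> = 0" by auto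
  obtain j where j: "a $ j \<noteq> \<zeta> $ j" using insert.prems by (auto simp: vec_eq_iff)
  define l where "l x = indicator \<Omega> x * ((x $ j - \<zeta> $ j) / (a $ j - \<zeta> $ j))" for x
  have "analytic_in (\<lambda>x. (1 / (a $ j - \<zeta> $ j)) * (x $ j - \<zeta> $ j)) \<Omega>"
    by (intro analytic_in_scale analytic_in_diff analytic_in_component analytic_in_const)
  then have "analytic_in l \<Omega>"
    by (rule analytic_in_cong[OF _ open_\<Omega>]) (simp add: l_def)
  moreover have "bounded (l ` \<Omega>)"
  proof -
    obtain B where B: "\<And>x. x \<in> \<Omega> \<Longrightarrow> norm x \<le> B" using bounded_\<Omega> by (auto simp: bounded_iff)
    have "cmod (l x) \<le> (B + cmod (\<zeta> $ j)) / cmod (a $ j - \<zeta> $ j)" if x: "x \<in> \<Omega>" for x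
    proof -
      have "cmod (x $ j - \<zeta> $ j) \<le> B + cmod (\<zeta> $ j)"
        using norm_triangle_ineq4[of "x $ j" "\<zeta> $ j"] Finite_Cartesian_Product.norm_nth_le[of x j] B[OF x] by linarith
      then show ?thesis using x by (simp add: l_def norm_divide divide_right_mono)
    qed
    then show ?thesis by (intro boundedI) auto
  qed
  ultimately have "l \<in> Hinf \<Omega>" by (auto simp: Hinf_def l_def)
  moreover have "l a = 1" "l \<zeta> = 0" using j assms(1) by (auto simp: l_def)
  ultimately show ?case using h by (intro bexI[of _ "\<lambda>x. h x * l x"] Hinf_mult) auto
qed

lemma bergman_l2: "f \<in> bergman \<Omega> \<Longrightarrow> f \<in> l2_space \<mu>"
  by (rule bergmanD)

text \<open>Elements of \<open>l2_closure\<close> matter only up to null sets. Norm limits in the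
  Bergman space are also pointwise limits, so stability of \<open>S\<close> under pointwise limits
  provides a representative inside \<open>S\<close>.\<close>

lemma bergman_closure_representative:
  assumes "v \<in> l2_closure \<mu> S" "S \<subseteq> bergman \<Omega>"
    and closed: "\<And>s g. (\<And>n. s n \<in> S) \<Longrightarrow> g \<in> bergman \<Omega> \<Longrightarrow> (\<And>z. (\<lambda>n. s n z) \<longlonglongrightarrow> g z) \<Longrightarrow> g \<in> S"
  shows "\<exists>g\<in>S. l2_norm \<mu> (\<lambda>x. v x - g x) = 0"
proof -
  have sub: "S \<subseteq> l2_space \<mu>" using assms(2) bergman_l2 by blast
  obtain s where s: "\<And>n. s n \<in> S" "(\<lambda>n. l2_norm \<mu> (\<lambda>x. s n x - v x)) \<longlonglongrightarrow> 0"
    using l2_closureD[OF assms(1) sub] by blast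
  have sl: "s n \<in> l2_space \<mu>" and sb: "s n \<in> bergman \<Omega>" for n using s(1) sub assms(2) by blast+
  have vl: "v \<in> l2_space \<mu>" using assms(1) l2_closure_subset by blast
  obtain g where g: "g \<in> bergman \<Omega>" "(\<lambda>n. l2_norm \<mu> (\<lambda>x. s n x - g x)) \<longlonglongrightarrow> 0"
    "\<And>z. (\<lambda>n. s n z) \<longlonglongrightarrow> g z"
    using bergman_complete[OF open_\<Omega> sb l2_convergent_cauchy[OF sl vl s(2)]] by blast
  have gl: "g \<in> l2_space \<mu>" using g(1) bergman_l2 by blast
  have "l2_norm \<mu> (\<lambda>x. v x - g x) \<le> 0"
  proof (rule LIMSEQ_le_const)
    show "(\<lambda>n. l2_norm \<mu> (\<lambda>x. s n x - v x) + l2_norm \<mu> (\<lambda>x. s n x - g x)) \<longlonglongrightarrow> 0"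
      using tendsto_add[OF s(2) g(2)] by simp
    have "l2_norm \<mu> (\<lambda>x. v x - g x) \<le> l2_norm \<mu> (\<lambda>x. s n x - v x) + l2_norm \<mu> (\<lambda>x. s n x - g x)" for n
      using l2_norm_triangle_diff[OF vl sl[of n] gl] l2_norm_minus_commute[of \<mu> v "s n"] by simp
    then show "\<exists>N. \<forall>n\<ge>N. l2_norm \<mu> (\<lambda>x. v x - g x) \<le> l2_norm \<mu> (\<lambda>x. s n x - v x) + l2_norm \<mu> (\<lambda>x. s n x - g x)"
      by blast
  qed
  then have "l2_norm \<mu> (\<lambda>x. v x - g x) = 0" using l2_norm_nonneg[of \<mu> "\<lambda>x. v x - g x"] by linarith
  moreover have "g \<in> S" by (rule closed[OF s(1) g(1,3)])
  ultimately show ?thesis by blast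
qed

text \<open>Sharpens \<open>l2_min_norm\<close> to a minimiser in \<open>S\<close> itself, whose
  point values can then be used.\<close>

lemma bergman_min_norm:
  assumes S: "S \<subseteq> bergman \<Omega>" "S \<noteq> {}"
    and conv: "\<And>g h t. g \<in> S \<Longrightarrow> h \<in> S \<Longrightarrow> 0 \<le> t \<Longrightarrow> t \<le> 1 \<Longrightarrow>
      (\<lambda>x. g x + complex_of_real t * (h x - g x)) \<in> S"
    and closed: "\<And>s g. (\<And>n. s n \<in> S) \<Longrightarrow> g \<in> bergman \<Omega> \<Longrightarrow> (\<And>z. (\<lambda>n. s n z) \<longlonglongrightarrow> g z) \<Longrightarrow> g \<in> S"
  shows "\<exists>v\<in>S. \<forall>g\<in>S. (l2_norm \<mu> v)\<^sup>2 \<le> Re (l2_inner \<mu> g v)"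
proof -
  have sub: "S \<subseteq> l2_space \<mu>" using S(1) bergman_l2 by blast
  obtain v where v: "v \<in> l2_closure \<mu> S" "\<And>g. g \<in> S \<Longrightarrow> (l2_norm \<mu> v)\<^sup>2 \<le> Re (l2_inner \<mu> g v)"
    using l2_min_norm[OF finite_\<mu> sub S(2) conv] by blast
  obtain w where w: "w \<in> S" "l2_norm \<mu> (\<lambda>x. v x - w x) = 0"
    using bergman_closure_representative[OF v(1) S(1)] closed by blast
  have l: "v \<in> l2_space \<mu>" "w \<in> l2_space \<mu>" using v(1) l2_closure_subset w(1) sub by blast+
  have "(l2_norm \<mu> w)\<^sup>2 \<le> Re (l2_inner \<mu> g w)" if g: "g \<in> S" for g
    using v(2)[OF g] l2_inner_cong_norm0[OF l subsetD[OF sub g] w(2)] by simp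
  with w(1) show ?thesis by blast
qed

definition vanishing :: "(nat \<Rightarrow> complex^'d) \<Rightarrow> nat \<Rightarrow> (complex^'d \<Rightarrow> complex) set" where
  "vanishing \<zeta> n = {g \<in> bergman \<Omega>. \<forall>k<n. g (\<zeta> k) = 0}"

lemma vanishing_subspace: "complex_subspace (vanishing \<zeta> n)"
  using bergman_subspace[of \<Omega>] by (auto simp: complex_subspace_def vanishing_def)

text \<open>Otherwise rescaling gives functions with value 1 at z, norms at most 1 / e and more and
  more prescribed zeros. Then \<open>l2_directed_convex\<close> produces a Bergman function with
  value 1 at z that vanishes on a dense sequence, contradicting continuity.\<close>

lemma vanishing_small:
  assumes dense: "\<And>U. open U \<Longrightarrow> U \<noteq> {} \<Longrightarrow> \<exists>k. \<zeta> k \<in> U" and z: "z \<in> \<Omega>" and e: "e > 0"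
  shows "\<exists>N. \<forall>n\<ge>N. \<forall>g\<in>vanishing \<zeta> n. l2_norm \<mu> g \<le> 1 \<longrightarrow> cmod (g z) < e"
proof (rule ccontr)
  assume neg: "\<not> ?thesis"
  have mono: "vanishing \<zeta> n \<subseteq> vanishing \<zeta> m" if "m \<le> n" for m n
    using that by (auto simp: vanishing_def)
  have neg': "\<exists>g\<in>vanishing \<zeta> N. l2_norm \<mu> g \<le> 1 \<and> e \<le> cmod (g z)" for N
  proof -
    from neg obtain n g where "n \<ge> N" "g \<in> vanishing \<zeta> n" "l2_norm \<mu> g \<le> 1" "\<not> cmod (g z) < e" by blast
    then show ?thesis using mono[of N n] by (intro bexI[of _ g]) auto
  qed
  define S where "S n = {g \<in> vanishing \<zeta> n. g z = 1}" for n
  have Sl: "S n \<subseteq> l2_space \<mu>" for n using bergman_l2 by (auto simp: S_def vanishing_def)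
  have "\<exists>g\<in>l2_space \<mu>. \<forall>K\<in>range S. \<forall>e>0. \<exists>h\<in>K. l2_norm \<mu> (\<lambda>x. g x - h x) < e"
  proof (rule l2_directed_convex[OF finite_\<mu>, where C = "1 / e"])
    show "K \<subseteq> l2_space \<mu>" if "K \<in> range S" for K using that Sl by blast
    show "(\<lambda>x. (g x + h x) / 2) \<in> K" if K: "K \<in> range S" "g \<in> K" "h \<in> K" for K g h
    proof -
      obtain n where n: "K = S n" using K by blast
      then have gh: "g \<in> vanishing \<zeta> n" "h \<in> vanishing \<zeta> n" "g z = 1" "h z = 1" using K by (auto simp: S_def)
      have "(\<lambda>x. (1/2) * (g x + h x)) \<in> vanishing \<zeta> n"
        by (rule complex_subspaceD(2)[OF vanishing_subspace]) (rule complex_subspaceD(1)[OF vanishing_subspace gh(1,2)])+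
      then show ?thesis using gh n by (simp add: S_def)
    qed
    show "\<exists>N\<in>range S. N \<subseteq> K \<inter> L" if KL: "K \<in> range S" "L \<in> range S" for K L
    proof -
      obtain i j where ij: "K = S i" "L = S j" using KL by blast
      have "S (max i j) \<subseteq> S i \<inter> S j" using mono[of i "max i j"] mono[of j "max i j"] by (auto simp: S_def)
      then show ?thesis using ij by blast
    qed
    show "\<exists>g\<in>K. l2_norm \<mu> g \<le> 1 / e" if K: "K \<in> range S" for K
    proof -
      obtain n where n: "K = S n" using K by blast
      obtain g where g: "g \<in> vanishing \<zeta> n" "l2_norm \<mu> g \<le> 1" "e \<le> cmod (g z)" using neg' by blast
      have gz: "g z \<noteq> 0" using g(3) e by auto
      have "l2_norm \<mu> (\<lambda>x. (1 / g z) * g x) = l2_norm \<mu> g / cmod (g z)"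
        by (subst l2_norm_scale) (simp add: norm_divide)
      also have "\<dots> \<le> 1 / e" using g e by (intro frac_le) auto
      finally show ?thesis
        using complex_subspaceD(2)[OF vanishing_subspace g(1) g(1), of "1 / g z"] gz n
        by (intro bexI[of _ "\<lambda>x. (1 / g z) * g x"]) (auto simp: S_def)
    qed
  qed auto
  then obtain g where g: "g \<in> l2_space \<mu>" "\<And>n e. e > 0 \<Longrightarrow> \<exists>h\<in>S n. l2_norm \<mu> (\<lambda>x. g x - h x) < e" by blast
  have "\<forall>n. \<exists>h. h \<in> S n \<and> l2_norm \<mu> (\<lambda>x. g x - h x) < 1 / Suc n"
  proof
    fix n
    show "\<exists>h. h \<in> S n \<and> l2_norm \<mu> (\<lambda>x. g x - h x) < 1 / Suc n" using g(2)[of "1 / Suc n" n] by auto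
  qed
  from choice[OF this] obtain s where "\<forall>n. s n \<in> S n \<and> l2_norm \<mu> (\<lambda>x. g x - s n x) < 1 / Suc n"
    by (elim exE)
  then have s: "\<And>n. s n \<in> S n" "\<And>n. l2_norm \<mu> (\<lambda>x. g x - s n x) < 1 / Suc n" by auto
  have sb: "s n \<in> bergman \<Omega>" and sl: "s n \<in> l2_space \<mu>" for n
    using s(1)[of n] Sl[of n] by (auto simp: S_def vanishing_def)
  have lim: "(\<lambda>n. l2_norm \<mu> (\<lambda>x. s n x - g x)) \<longlonglongrightarrow> 0"
  proof (rule Lim_null_comparison[OF _ LIMSEQ_Suc[OF lim_const_over_n[of 1]]])
    have "norm (l2_norm \<mu> (\<lambda>x. s n x - g x)) \<le> 1 / Suc n" for n
      using s(2)[of n] l2_norm_minus_commute[of \<mu> g "s n"] by simp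
    then show "\<forall>\<^sub>F n in sequentially. norm (l2_norm \<mu> (\<lambda>x. s n x - g x)) \<le> 1 / real (Suc n)" by simp
  qed
  obtain h where h: "h \<in> bergman \<Omega>" "(\<lambda>n. l2_norm \<mu> (\<lambda>x. s n x - h x)) \<longlonglongrightarrow> 0"
      "\<And>z. (\<lambda>n. s n z) \<longlonglongrightarrow> h z"
    by (rule bergman_complete[OF open_\<Omega> sb l2_convergent_cauchy[OF sl g(1) lim]]) (assumption, rule that)
  note h = h(1,3)
  have hz: "h z = 1"
    using h(2)[of z] s(1) by (simp add: S_def LIMSEQ_const_iff)
  have h0: "h (\<zeta> k) = 0" for k
  proof (rule LIMSEQ_unique[OF h(2)])
    have "\<forall>\<^sub>F n in sequentially. s n (\<zeta> k) = 0"
      using s(1) by (intro eventually_sequentiallyI[of "Suc k"]) (auto simp: S_def vanishing_def)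
    then show "(\<lambda>n. s n (\<zeta> k)) \<longlonglongrightarrow> 0" by (rule tendsto_eventually)
  qed
  define U where "U = {x \<in> \<Omega>. h x \<noteq> 0}"
  have "open U"
  proof -
    have "open (\<Omega> \<inter> h -` (- {0}))"
      by (rule continuous_open_preimage[OF analytic_in_continuous[OF bergmanD(2)[OF h(1)]] open_\<Omega>]) auto
    moreover have "\<Omega> \<inter> h -` (- {0}) = U" by (auto simp: U_def)
    ultimately show ?thesis by simp
  qed
  moreover have "z \<in> U" using hz z by (simp add: U_def)
  ultimately obtain k where "\<zeta> k \<in> U" using dense by blast
  then show False using h0[of k] by (simp add: U_def)
qed

text \<open>Evaluation at a point is the vector functional of every reproducing kernel of an invariant
  subspace that is not annihilated by it. Kernels of the spaces of functions vanishing at more and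
  more points of a dense sequence are almost orthogonal to any prescribed function.\<close>

lemma evaluation_vector:
  assumes a: "a \<in> \<Omega>" and p: "p \<in> l2_space \<mu>" and e: "e > 0"
  shows "\<exists>u\<in>bergman \<Omega>. l2_norm \<mu> u = 1 \<and> (\<forall>\<psi>\<in>Hinf \<Omega>. l2_inner \<mu> (\<lambda>x. \<psi> x * u x) u = \<psi> a) \<and>
    (\<integral>x. cmod (p x) * cmod (u x) \<partial>\<mu>) < e"
proof -
  obtain X :: "(complex^'d) set" where X: "countable X" "\<And>U. open U \<Longrightarrow> U \<noteq> {} \<Longrightarrow> \<exists>d\<in>X. d \<in> U"
    using countable_dense_exists by blast
  \<comment> \<open>The point a must stay off the list of zeros; removing it keeps density because a
    single point is not open.\<close>
  have dense0: "\<exists>d\<in>X - {a}. d \<in> U" if "open U" "U \<noteq> {}" for U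
  proof -
    have "U \<noteq> {a}" using that not_open_singleton by blast
    then have "U - {a} \<noteq> {}" "open (U - {a})" using that by (auto intro: open_delete)
    then show ?thesis using X(2) by blast
  qed
  define \<zeta> where "\<zeta> = from_nat_into (X - {a})"
  have ne: "X - {a} \<noteq> {}" using dense0[of UNIV] by auto
  have range: "range \<zeta> = X - {a}" unfolding \<zeta>_def using ne X(1) by (intro range_from_nat_into) auto
  have dense: "\<exists>k. \<zeta> k \<in> U" if "open U" "U \<noteq> {}" for U using dense0[OF that] range by (metis imageE)
  have \<zeta>a: "\<zeta> k \<noteq> a" for k using range by (metis Diff_iff rangeI singletonI)
  have "\<exists>u. u \<in> vanishing \<zeta> n \<and> l2_norm \<mu> u = 1 \<and> (\<forall>\<psi>\<in>Hinf \<Omega>. l2_inner \<mu> (\<lambda>x. \<psi> x * u x) u = \<psi> a)" for n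
  proof -
    define S where "S = {g \<in> vanishing \<zeta> n. g a = 1}"
    have Sb: "S \<subseteq> bergman \<Omega>" by (auto simp: S_def vanishing_def)
    \<comment> \<open>The element of least norm with value 1 at a is a multiple of the reproducing
      kernel at a of the space of functions with the prescribed zeros.\<close>
    have "\<exists>v\<in>S. \<forall>g\<in>S. (l2_norm \<mu> v)\<^sup>2 \<le> Re (l2_inner \<mu> g v)"
    proof (rule bergman_min_norm[OF Sb])
      obtain h where "h \<in> Hinf \<Omega>" "h a = 1" "\<forall>x\<in>\<zeta> ` {..<n}. h x = 0"
        using Hinf_separate[OF a, of "\<zeta> ` {..<n}"] \<zeta>a by (metis finite_imageI finite_lessThan imageE)
      then have "h \<in> S" using Hinf_subset_bergman by (auto simp: S_def vanishing_def)
      then show "S \<noteq> {}" by blast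
      show "(\<lambda>x. g x + complex_of_real t * (h x - g x)) \<in> S" if "g \<in> S" "h \<in> S" for g h t
      proof -
        have gh: "g \<in> vanishing \<zeta> n" "h \<in> vanishing \<zeta> n" "g a = 1" "h a = 1" using that by (auto simp: S_def)
        note VD = complex_subspaceD[OF vanishing_subspace]
        show ?thesis using VD(1)[OF gh(1) VD(2)[OF VD(3)[OF gh(2,1)] gh(1)], of "complex_of_real t"] gh
          by (simp add: S_def)
      qed
      show "g \<in> S" if s: "\<And>i. s i \<in> S" and g: "g \<in> bergman \<Omega>" and lim: "\<And>z. (\<lambda>i. s i z) \<longlonglongrightarrow> g z" for s g
      proof -
        have "g a = 1" using lim[of a] s by (simp add: S_def LIMSEQ_const_iff)
        moreover have "g (\<zeta> k) = 0" if "k < n" for k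
          using lim[of "\<zeta> k"] s that by (simp add: S_def vanishing_def LIMSEQ_const_iff)
        ultimately show ?thesis using g by (simp add: S_def vanishing_def)
      qed
    qed
    then obtain v where v: "v \<in> S" "\<And>g. g \<in> S \<Longrightarrow> (l2_norm \<mu> v)\<^sup>2 \<le> Re (l2_inner \<mu> g v)" by blast
    have vv: "v \<in> vanishing \<zeta> n" "v a = 1" "v \<in> bergman \<Omega>" using v(1) Sb by (auto simp: S_def)
    have vl: "v \<in> l2_space \<mu>" using vv(3) by (rule bergman_l2)
    have orth: "l2_inner \<mu> g v = 0" if g: "g \<in> vanishing \<zeta> n" "g a = 0" for g
    proof -
      have gl: "g \<in> l2_space \<mu>" using g bergman_l2 by (auto simp: vanishing_def)
      have "0 \<le> Re (c * l2_inner \<mu> g v)" for c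
      proof -
        have "(\<lambda>x. v x + c * g x) \<in> S"
          using complex_subspaceD(1)[OF vanishing_subspace vv(1) complex_subspaceD(2)[OF vanishing_subspace g(1) g(1)]]
            vv(2) g(2) by (simp add: S_def)
        from v(2)[OF this] show ?thesis
          using vl gl by (simp add: l2_inner_add_left l2_inner_scale_left l2_scale l2_inner_self)
      qed
      from this[of "- cnj (l2_inner \<mu> g v)"]
      have "0 \<le> Re (- complex_of_real ((cmod (l2_inner \<mu> g v))\<^sup>2))"
        by (simp add: complex_norm_square mult.commute del: of_real_power)
      then show ?thesis by simp
    qed
    have vpos: "l2_norm \<mu> v > 0"
    proof (rule ccontr)
      assume "\<not> ?thesis"
      then have 0: "l2_norm \<mu> v = 0" using l2_norm_nonneg[of \<mu> v] by linarith
      obtain r C where "r > 0" "\<And>f x. f \<in> bergman \<Omega> \<Longrightarrow> x \<in> cball a (2 * r) \<Longrightarrow> cmod (f x) \<le> C * l2_norm \<mu> f"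
        using bergman_local_bound[OF open_\<Omega> a] by metis
      then have "cmod (v a) \<le> C * 0" using vv(3) 0 by (metis centre_in_cball less_imp_le mult_pos_pos zero_less_numeral)
      then show False using vv(2) by simp
    qed
    \<comment> \<open>Multiplication by \<psi> preserves the prescribed zeros, so \<psi> v -
      \<psi>(a) v lies in the space and vanishes at a; hence it is orthogonal to v.\<close>
    have repr: "l2_inner \<mu> (\<lambda>x. \<psi> x * v x) v = \<psi> a * of_real ((l2_norm \<mu> v)\<^sup>2)" if \<psi>: "\<psi> \<in> Hinf \<Omega>" for \<psi>
    proof -
      have \<psi>v: "(\<lambda>x. \<psi> x * v x) \<in> vanishing \<zeta> n"
        using Hinf_mult_bergman[OF \<psi> vv(3)] vv(1) by (simp add: vanishing_def)
      have "l2_inner \<mu> (\<lambda>x. \<psi> x * v x - \<psi> a * v x) v = 0"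
        using complex_subspaceD(3)[OF vanishing_subspace \<psi>v complex_subspaceD(2)[OF vanishing_subspace vv(1,1)]]
        by (intro orth) (auto simp: vv(2))
      then show ?thesis
        using Hinf_mult_l2[OF \<psi> vl] vl by (simp add: l2_inner_diff_left l2_inner_scale_left l2_scale l2_inner_self)
    qed
    define c where "c = complex_of_real (1 / l2_norm \<mu> v)"
    show ?thesis
    proof (intro exI[of _ "\<lambda>x. c * v x"] conjI ballI)
      show "l2_norm \<mu> (\<lambda>x. c * v x) = 1" using vpos by (subst l2_norm_scale) (simp add: c_def norm_divide)
      show "(\<lambda>x. c * v x) \<in> vanishing \<zeta> n" by (rule complex_subspaceD(2)[OF vanishing_subspace vv(1,1)])
      fix \<psi> assume \<psi>: "\<psi> \<in> Hinf \<Omega>"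
      have "l2_inner \<mu> (\<lambda>x. \<psi> x * (c * v x)) (\<lambda>x. c * v x) = c * cnj c * l2_inner \<mu> (\<lambda>x. \<psi> x * v x) v"
        using l2_inner_scale_left[of \<mu> c "\<lambda>x. \<psi> x * v x" "\<lambda>x. c * v x"]
        by (simp add: l2_inner_scale_right mult_ac)
      also have "\<dots> = \<psi> a"
        unfolding repr[OF \<psi>] using vpos by (simp add: c_def power2_eq_square)
      finally show "l2_inner \<mu> (\<lambda>x. \<psi> x * (c * v x)) (\<lambda>x. c * v x) = \<psi> a" .
    qed
  qed
  then have "\<forall>n. \<exists>u. u \<in> vanishing \<zeta> n \<and> l2_norm \<mu> u = 1 \<and>
      (\<forall>\<psi>\<in>Hinf \<Omega>. l2_inner \<mu> (\<lambda>x. \<psi> x * u x) u = \<psi> a)" ..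
  from choice[OF this] obtain u where "\<forall>n. u n \<in> vanishing \<zeta> n \<and> l2_norm \<mu> (u n) = 1 \<and>
      (\<forall>\<psi>\<in>Hinf \<Omega>. l2_inner \<mu> (\<lambda>x. \<psi> x * u n x) (u n) = \<psi> a)" by (elim exE)
  then have u: "\<And>n. u n \<in> vanishing \<zeta> n" "\<And>n. l2_norm \<mu> (u n) = 1"
    "\<And>n \<psi>. \<psi> \<in> Hinf \<Omega> \<Longrightarrow> l2_inner \<mu> (\<lambda>x. \<psi> x * u n x) (u n) = \<psi> a" by simp_all
  have ub: "u n \<in> bergman \<Omega>" for n using u(1)[of n] by (simp add: vanishing_def)
  have "(\<lambda>n. \<integral>x. cmod (p x) * cmod (u n x) \<partial>\<mu>) \<longlonglongrightarrow> 0"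
  proof (rule l2_pointwise_null_weak[OF _ _ _ p])
    show "u n \<in> l2_space \<mu>" for n by (rule bergman_l2[OF ub])
    show "l2_norm \<mu> (u n) \<le> 1" for n by (simp add: u(2))
    show "(\<lambda>n. u n x) \<longlonglongrightarrow> 0" if "x \<in> space \<mu>" for x
    proof (rule LIMSEQ_I)
      fix d :: real assume d: "d > 0"
      have "x \<in> \<Omega>" using that by simp
      then have "\<exists>N. \<forall>n\<ge>N. \<forall>g\<in>vanishing \<zeta> n. l2_norm \<mu> g \<le> 1 \<longrightarrow> cmod (g x) < d"
        by (intro vanishing_small[OF _ _ d] dense)
      then obtain N where N: "\<forall>n\<ge>N. \<forall>g\<in>vanishing \<zeta> n. l2_norm \<mu> g \<le> 1 \<longrightarrow> cmod (g x) < d" by (elim exE)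
      have "norm (u n x - 0) < d" if "n \<ge> N" for n
        using N[rule_format, OF that u(1)] u(2)[of n] by simp
      then show "\<exists>N. \<forall>n\<ge>N. norm (u n x - 0) < d" by blast
    qed
  qed
  from LIMSEQ_D[OF this e] obtain n where "norm ((\<integral>x. cmod (p x) * cmod (u n x) \<partial>\<mu>) - 0) < e" by blast
  then have "(\<integral>x. cmod (p x) * cmod (u n x) \<partial>\<mu>) < e" by (simp add: abs_less_iff)
  with ub u(2,3) show ?thesis by blast
qed

end

subsection \<open>Factorization of functionals on bounded analytic functions\<close>

context bounded_open
begin

text \<open>Densities are compared only through this functional on \<open>Hinf \<Omega>\<close>, so
  a density may be exchanged for any other that induces the same one.\<close>

definition pairing :: "(complex^'d \<Rightarrow> complex) \<Rightarrow> (complex^'d \<Rightarrow> complex) \<Rightarrow> complex" where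
  "pairing q \<psi> = (\<integral>x. \<psi> x * q x \<partial>\<mu>)"

definition l1_norm :: "(complex^'d \<Rightarrow> complex) \<Rightarrow> real" where
  "l1_norm q = (\<integral>x. cmod (q x) \<partial>\<mu>)"

lemma l1_norm_nonneg [simp]: "0 \<le> l1_norm q"
  by (simp add: l1_norm_def)

lemma Hinf_mult_integrable:
  assumes "\<psi> \<in> Hinf \<Omega>" "integrable \<mu> q"
  shows "integrable \<mu> (\<lambda>x. \<psi> x * q x)"
proof -
  obtain B where B: "B \<ge> 0" "\<And>x. cmod (\<psi> x) \<le> B" using Hinf_bound[OF assms(1)] by blast
  show ?thesis
  proof (rule Bochner_Integration.integrable_bound)
    show "integrable \<mu> (\<lambda>x. B * cmod (q x))" using assms(2) by simp
    show "(\<lambda>x. \<psi> x * q x) \<in> borel_measurable \<mu>"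
      using Hinf_measurable[OF assms(1)] assms(2) by (intro borel_measurable_times) auto
    show "AE x in \<mu>. norm (\<psi> x * q x) \<le> norm (B * cmod (q x))"
      using B by (intro AE_I2) (simp add: norm_mult mult_right_mono)
  qed
qed

lemma pairing_add: "\<psi> \<in> Hinf \<Omega> \<Longrightarrow> integrable \<mu> q \<Longrightarrow> integrable \<mu> r \<Longrightarrow>
    pairing (\<lambda>x. q x + r x) \<psi> = pairing q \<psi> + pairing r \<psi>"
  by (simp add: pairing_def distrib_left Hinf_mult_integrable)

lemma pairing_diff: "\<psi> \<in> Hinf \<Omega> \<Longrightarrow> integrable \<mu> q \<Longrightarrow> integrable \<mu> r \<Longrightarrow>
    pairing (\<lambda>x. q x - r x) \<psi> = pairing q \<psi> - pairing r \<psi>"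
  by (simp add: pairing_def right_diff_distrib Hinf_mult_integrable)

lemma pairing_l2: "pairing (\<lambda>x. u x * cnj (v x)) \<psi> = l2_inner \<mu> (\<lambda>x. \<psi> x * u x) v"
  by (simp add: pairing_def l2_inner_def mult.assoc)

lemma pairing_bound:
  assumes "\<And>x. cmod (\<psi> x) \<le> B" "\<psi> \<in> Hinf \<Omega>" "integrable \<mu> q"
  shows "cmod (pairing q \<psi>) \<le> B * l1_norm q"
proof -
  have "cmod (pairing q \<psi>) \<le> (\<integral>x. cmod (\<psi> x * q x) \<partial>\<mu>)"
    unfolding pairing_def by (rule integral_norm_bound)
  also have "\<dots> \<le> (\<integral>x. B * cmod (q x) \<partial>\<mu>)"
  proof (rule integral_mono)
    show "integrable \<mu> (\<lambda>x. cmod (\<psi> x * q x))"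
      by (rule integrable_norm[OF Hinf_mult_integrable[OF assms(2,3)]])
    show "integrable \<mu> (\<lambda>x. B * cmod (q x))" using assms(3) by simp
    show "cmod (\<psi> x * q x) \<le> B * cmod (q x)" for x using assms(1)[of x] by (simp add: norm_mult mult_right_mono)
  qed
  finally show ?thesis by (simp add: l1_norm_def)
qed

lemma l1_norm_add:
  assumes "integrable \<mu> q" "integrable \<mu> r"
  shows "l1_norm (\<lambda>x. q x + r x) \<le> l1_norm q + l1_norm r"
proof -
  have "(\<integral>x. cmod (q x + r x) \<partial>\<mu>) \<le> (\<integral>x. cmod (q x) + cmod (r x) \<partial>\<mu>)"
  proof (rule integral_mono)
    show "integrable \<mu> (\<lambda>x. cmod (q x + r x))" "integrable \<mu> (\<lambda>x. cmod (q x) + cmod (r x))"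
      using assms by auto
  qed (rule norm_triangle_ineq)
  also have "\<dots> = l1_norm q + l1_norm r" using assms by (simp add: l1_norm_def)
  finally show ?thesis by (simp add: l1_norm_def)
qed

lemma l1_norm_diff:
  assumes "integrable \<mu> q" "integrable \<mu> r"
  shows "l1_norm (\<lambda>x. q x - r x) \<le> l1_norm q + l1_norm r"
proof -
  have "(\<integral>x. cmod (q x - r x) \<partial>\<mu>) \<le> (\<integral>x. cmod (q x) + cmod (r x) \<partial>\<mu>)"
  proof (rule integral_mono)
    show "integrable \<mu> (\<lambda>x. cmod (q x - r x))" "integrable \<mu> (\<lambda>x. cmod (q x) + cmod (r x))"
      using assms by auto
  qed (rule norm_triangle_ineq4)
  also have "\<dots> = l1_norm q + l1_norm r" using assms by (simp add: l1_norm_def)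
  finally show ?thesis by (simp add: l1_norm_def)
qed

lemma l1_norm_l2: "l1_norm (\<lambda>x. u x * cnj (v x)) = (\<integral>x. cmod (u x) * cmod (v x) \<partial>\<mu>)"
  by (simp add: l1_norm_def norm_mult)

text \<open>The remainder \<open>r\<close> is measured in the predual norm; \<open>p\<close> controls the cross terms with the
  vectors chosen earlier.\<close>

definition approx_factor ::
    "((complex^'d \<Rightarrow> complex) \<Rightarrow> complex) \<Rightarrow> real \<Rightarrow> (complex^'d \<Rightarrow> complex) \<Rightarrow> real \<Rightarrow> bool" where
  "approx_factor F B p e \<longleftrightarrow> (\<exists>u v r. u \<in> bergman \<Omega> \<and> v \<in> bergman \<Omega> \<and> integrable \<mu> r \<and>
     (\<forall>\<psi>\<in>Hinf \<Omega>. F \<psi> = l2_inner \<mu> (\<lambda>x. \<psi> x * u x) v + pairing r \<psi>) \<and> l1_norm r \<le> e \<and>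
     (l2_norm \<mu> u)\<^sup>2 \<le> B + e \<and> (l2_norm \<mu> v)\<^sup>2 \<le> B + e \<and>
     (\<integral>x. cmod (p x) * cmod (u x) \<partial>\<mu>) \<le> e \<and> (\<integral>x. cmod (p x) * cmod (v x) \<partial>\<mu>) \<le> e)"

lemma approx_factorE:
  assumes "approx_factor F B p e"
  obtains u v r where "u \<in> bergman \<Omega>" "v \<in> bergman \<Omega>" "integrable \<mu> r"
    "\<And>\<psi>. \<psi> \<in> Hinf \<Omega> \<Longrightarrow> F \<psi> = l2_inner \<mu> (\<lambda>x. \<psi> x * u x) v + pairing r \<psi>" "l1_norm r \<le> e"
    "(l2_norm \<mu> u)\<^sup>2 \<le> B + e" "(l2_norm \<mu> v)\<^sup>2 \<le> B + e"
    "(\<integral>x. cmod (p x) * cmod (u x) \<partial>\<mu>) \<le> e" "(\<integral>x. cmod (p x) * cmod (v x) \<partial>\<mu>) \<le> e"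
  using assms unfolding approx_factor_def by blast

lemma inner_expand:
  assumes \<psi>: "\<psi> \<in> Hinf \<Omega>" and "a \<in> l2_space \<mu>" "b \<in> l2_space \<mu>" "c \<in> l2_space \<mu>" "d \<in> l2_space \<mu>"
  shows "l2_inner \<mu> (\<lambda>x. \<psi> x * (a x + b x)) (\<lambda>x. c x + d x) =
    l2_inner \<mu> (\<lambda>x. \<psi> x * a x) c + l2_inner \<mu> (\<lambda>x. \<psi> x * a x) d +
    l2_inner \<mu> (\<lambda>x. \<psi> x * b x) c + l2_inner \<mu> (\<lambda>x. \<psi> x * b x) d"
  using assms(2-) Hinf_mult_l2[OF \<psi>]
  by (simp add: distrib_left l2_inner_add_left l2_inner_add_right l2_add)

lemma l2_integral_add:
  assumes "p \<in> l2_space \<mu>" "a \<in> l2_space \<mu>" "b \<in> l2_space \<mu>"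
  shows "(\<integral>x. cmod (p x) * cmod (a x + b x) \<partial>\<mu>) \<le>
    (\<integral>x. cmod (p x) * cmod (a x) \<partial>\<mu>) + (\<integral>x. cmod (p x) * cmod (b x) \<partial>\<mu>)"
proof -
  have "(\<integral>x. cmod (p x) * cmod (a x + b x) \<partial>\<mu>) \<le>
      (\<integral>x. cmod (p x) * cmod (a x) + cmod (p x) * cmod (b x) \<partial>\<mu>)"
    using assms integrable_l2_cmod_mult
    by (intro integral_mono Bochner_Integration.integrable_add integrable_l2_cmod_mult l2_add)
      (auto simp: distrib_left[symmetric] intro: mult_left_mono norm_triangle_ineq)
  then show ?thesis using assms by (simp add: integrable_l2_cmod_mult)
qed

lemma l2_integral_scale:
  "(\<integral>x. cmod (p x) * cmod (c * b x) \<partial>\<mu>) = cmod c * (\<integral>x. cmod (p x) * cmod (b x) \<partial>\<mu>)"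
  by (simp add: norm_mult mult.left_commute)

lemma l2_integral_mono_left:
  assumes "p \<in> l2_space \<mu>" "p' \<in> l2_space \<mu>" "w \<in> l2_space \<mu>" "\<And>x. cmod (p x) \<le> cmod (p' x)"
  shows "(\<integral>x. cmod (p x) * cmod (w x) \<partial>\<mu>) \<le> (\<integral>x. cmod (p' x) * cmod (w x) \<partial>\<mu>)"
  using assms by (intro integral_mono integrable_l2_cmod_mult mult_right_mono) auto

text \<open>Induction on the number of evaluations. The term c i \<psi>(a i) is \<psi> -> <\<psi>
  \<alpha> w, \<beta> w> for the unit vector w of \<open>evaluation_vector\<close>, with |\<alpha>|
  and |\<beta>| at most the square root of |c i|. Because w is almost orthogonal to the earlier u
  and v, the cross terms go into the remainder and the squared norms add up to the sum of the |c
  i|.\<close>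

lemma approx_factor_evaluations:
  assumes I: "finite I" "\<And>i. i \<in> I \<Longrightarrow> a i \<in> \<Omega>" and p: "p \<in> l2_space \<mu>" and e: "e > 0"
  shows "approx_factor (\<lambda>\<psi>. \<Sum>i\<in>I. c i * \<psi> (a i)) (\<Sum>i\<in>I. cmod (c i)) p e"
  using I e
proof (induction I arbitrary: e)
  case empty
  show ?case unfolding approx_factor_def
    using empty.prems bergman_subspace[of \<Omega>]
    by (intro exI[of _ "\<lambda>x. 0"] conjI) (auto simp: pairing_def l2_inner_def l1_norm_def complex_subspace_def)
next
  case (insert i I)
  have e: "e > 0" "e / 4 > 0" using insert.prems by auto
  have ai: "a i \<in> \<Omega>" using insert.prems by simp
  have "approx_factor (\<lambda>\<psi>. \<Sum>i\<in>I. c i * \<psi> (a i)) (\<Sum>i\<in>I. cmod (c i)) p (e / 4)"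
    by (rule insert.IH) (use insert.prems e in auto)
  then obtain u v r where u: "u \<in> bergman \<Omega>" and v: "v \<in> bergman \<Omega>" and r: "integrable \<mu> r"
    and F: "\<And>\<psi>. \<psi> \<in> Hinf \<Omega> \<Longrightarrow> (\<Sum>i\<in>I. c i * \<psi> (a i)) = l2_inner \<mu> (\<lambda>x. \<psi> x * u x) v + pairing r \<psi>"
    and re: "l1_norm r \<le> e / 4" and un: "(l2_norm \<mu> u)\<^sup>2 \<le> (\<Sum>i\<in>I. cmod (c i)) + e / 4"
    and vn: "(l2_norm \<mu> v)\<^sup>2 \<le> (\<Sum>i\<in>I. cmod (c i)) + e / 4"
    and pu: "(\<integral>x. cmod (p x) * cmod (u x) \<partial>\<mu>) \<le> e / 4" and pv: "(\<integral>x. cmod (p x) * cmod (v x) \<partial>\<mu>) \<le> e / 4"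
    by (rule approx_factorE) (rule that)
  note ul = bergman_l2[OF u] and vl = bergman_l2[OF v]
  define s where "s = sqrt (cmod (c i))"
  have s: "s \<ge> 0" "s\<^sup>2 = cmod (c i)" "s * s = cmod (c i)" by (auto simp: s_def)
  \<comment> \<open>Gives s e' <= e / 4; the summand 1 covers s = 0. The error of the induction
    hypothesis and each cross term take one quarter of e.\<close>
  define e' where "e' = e / (4 * (s + 1))"
  have e': "e' > 0" "s * e' \<le> e / 4" using e s by (auto simp: e'_def field_simps)
  \<comment> \<open>Dominates p, u and v together, so one smallness condition on w controls all
    three integrals.\<close>
  define P where "P x = complex_of_real (cmod (p x)) + (complex_of_real (cmod (u x)) + complex_of_real (cmod (v x)))" for x
  have Pl: "P \<in> l2_space \<mu>" unfolding P_def using p ul vl by (intro l2_add l2_cmod)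
  have P_cmod: "cmod (P x) = cmod (p x) + (cmod (u x) + cmod (v x))" for x
    unfolding P_def of_real_add[symmetric] norm_of_real by simp
  obtain w where w: "w \<in> bergman \<Omega>" "l2_norm \<mu> w = 1"
      "\<forall>\<psi>\<in>Hinf \<Omega>. l2_inner \<mu> (\<lambda>x. \<psi> x * w x) w = \<psi> (a i)" "(\<integral>x. cmod (P x) * cmod (w x) \<partial>\<mu>) < e'"
    using evaluation_vector[OF ai Pl e'(1)] by blast
  note wl = bergman_l2[OF w(1)]
  have small: "(\<integral>x. cmod (f x) * cmod (w x) \<partial>\<mu>) \<le> e'" if "f \<in> l2_space \<mu>" "\<And>x. cmod (f x) \<le> cmod (P x)" for f
    using l2_integral_mono_left[OF that(1) Pl wl that(2)] w(4) by simp
  have small3: "(\<integral>x. cmod (p x) * cmod (w x) \<partial>\<mu>) \<le> e'" "(\<integral>x. cmod (u x) * cmod (w x) \<partial>\<mu>) \<le> e'"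
      "(\<integral>x. cmod (v x) * cmod (w x) \<partial>\<mu>) \<le> e'"
    by (rule small, fact, simp add: P_cmod)+
  define \<alpha> where "\<alpha> = complex_of_real s"
  \<comment> \<open>Carries the phase of c i; since \<open>sgn 0 = 0\<close>, its modulus is only
    bounded by s.\<close>
  define \<beta> where "\<beta> = complex_of_real s * cnj (sgn (c i))"
  have n\<alpha>: "cmod \<alpha> = s" using s by (simp add: \<alpha>_def)
  have n\<beta>: "cmod \<beta> \<le> s" using s by (simp add: \<beta>_def norm_mult norm_sgn)
  have \<alpha>\<beta>: "\<alpha> * cnj \<beta> = c i"
  proof -
    have "\<alpha> * cnj \<beta> = complex_of_real (cmod (c i)) * sgn (c i)"
      by (simp add: \<alpha>_def \<beta>_def s(3)[symmetric])
    then show ?thesis by (cases "c i = 0") (simp_all add: complex_sgn_def scaleR_conv_of_real sgn_div_norm)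
  qed
  let ?u = "\<lambda>x. \<alpha> * w x" and ?v = "\<lambda>x. \<beta> * w x"
  have ub: "?u \<in> bergman \<Omega>" "?v \<in> bergman \<Omega>" using complex_subspaceD(2)[OF bergman_subspace w(1) w(1)] by auto
  note ul' = bergman_l2[OF ub(1)] and vl' = bergman_l2[OF ub(2)]
  define R where "R x = r x - (u x * cnj (?v x) + ?u x * cnj (v x))" for x
  have i1: "integrable \<mu> (\<lambda>x. u x * cnj (?v x))" and i2: "integrable \<mu> (\<lambda>x. ?u x * cnj (v x))"
    by (rule integrable_l2_mult(2)[OF ul vl'], rule integrable_l2_mult(2)[OF ul' vl])
  have cr: "cmod k * (\<integral>x. cmod (f x) * cmod (w x) \<partial>\<mu>) \<le> e / 4"
    if "cmod k \<le> s" "(\<integral>x. cmod (f x) * cmod (w x) \<partial>\<mu>) \<le> e'" for k f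
  proof -
    have "cmod k * (\<integral>x. cmod (f x) * cmod (w x) \<partial>\<mu>) \<le> s * e'"
      using that s by (intro mult_mono) auto
    then show ?thesis using e'(2) by linarith
  qed
  \<comment> \<open>Pythagoras up to the cross term, which contributes at most 2 (e / 4).\<close>
  have norm_bd: "(l2_norm \<mu> (\<lambda>x. f x + k * w x))\<^sup>2 \<le> (\<Sum>j\<in>insert i I. cmod (c j)) + e"
    if f: "f \<in> l2_space \<mu>" "(l2_norm \<mu> f)\<^sup>2 \<le> (\<Sum>i\<in>I. cmod (c i)) + e / 4" and k: "cmod k \<le> s"
      and fw: "(\<integral>x. cmod (f x) * cmod (w x) \<partial>\<mu>) \<le> e'" for f k
  proof -
    have "Re (l2_inner \<mu> f (\<lambda>x. k * w x)) \<le> cmod (l2_inner \<mu> f (\<lambda>x. k * w x))" by (rule complex_Re_le_cmod)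
    also have "\<dots> \<le> (\<integral>x. cmod (f x * cnj (k * w x)) \<partial>\<mu>)" unfolding l2_inner_def by (rule integral_norm_bound)
    also have "\<dots> = cmod k * (\<integral>x. cmod (f x) * cmod (w x) \<partial>\<mu>)"
      by (simp add: norm_mult mult.left_commute)
    also have "\<dots> \<le> e / 4" by (rule cr[OF k fw])
    finally have 1: "Re (l2_inner \<mu> f (\<lambda>x. k * w x)) \<le> e / 4" .
    have "(l2_norm \<mu> (\<lambda>x. k * w x))\<^sup>2 \<le> cmod (c i)"
      using power_mono[OF k, of 2] w(2) s by (simp add: l2_norm_scale)
    moreover have "(\<Sum>j\<in>insert i I. cmod (c j)) = cmod (c i) + (\<Sum>j\<in>I. cmod (c j))"
      using insert.hyps by simp
    ultimately show ?thesis
      using l2_norm_add_power2[OF f(1) l2_scale[OF wl, of k]] 1 f(2) e by linarith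
  qed
  show ?case unfolding approx_factor_def
  proof (rule exI[of _ "\<lambda>x. u x + ?u x"], rule exI[of _ "\<lambda>x. v x + ?v x"], rule exI[of _ R], intro conjI ballI)
    show "(\<lambda>x. u x + ?u x) \<in> bergman \<Omega>" "(\<lambda>x. v x + ?v x) \<in> bergman \<Omega>"
      using complex_subspaceD(1)[OF bergman_subspace] u v ub by auto
    show "integrable \<mu> R" unfolding R_def using r i1 i2 by auto
    show "l1_norm R \<le> e"
    proof -
      have "l1_norm R \<le> l1_norm r + (l1_norm (\<lambda>x. u x * cnj (?v x)) + l1_norm (\<lambda>x. ?u x * cnj (v x)))"
        unfolding R_def using l1_norm_diff[OF r Bochner_Integration.integrable_add[OF i1 i2]]
          l1_norm_add[OF i1 i2] by linarith
      moreover have "l1_norm (\<lambda>x. u x * cnj (?v x)) \<le> e / 4"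
        using cr[OF n\<beta> small3(2)] unfolding l1_norm_l2 l2_integral_scale by simp
      moreover have "l1_norm (\<lambda>x. ?u x * cnj (v x)) \<le> e / 4"
        using cr[of \<alpha> v] n\<alpha> small3(3) l2_integral_scale[of v \<alpha> w] unfolding l1_norm_l2 by (simp add: mult.commute)
      ultimately show ?thesis using re e by linarith
    qed
    show "(l2_norm \<mu> (\<lambda>x. u x + ?u x))\<^sup>2 \<le> (\<Sum>j\<in>insert i I. cmod (c j)) + e"
      by (rule norm_bd[OF ul un]) (use n\<alpha> small3 in auto)
    show "(l2_norm \<mu> (\<lambda>x. v x + ?v x))\<^sup>2 \<le> (\<Sum>j\<in>insert i I. cmod (c j)) + e"
      by (rule norm_bd[OF vl vn]) (use n\<beta> small3 in auto)
    show "(\<integral>x. cmod (p x) * cmod (u x + ?u x) \<partial>\<mu>) \<le> e"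
      using l2_integral_add[OF p ul ul'] pu cr[of \<alpha> p] n\<alpha> small3(1) e unfolding l2_integral_scale by simp
    show "(\<integral>x. cmod (p x) * cmod (v x + ?v x) \<partial>\<mu>) \<le> e"
      using l2_integral_add[OF p vl vl'] pv cr[OF n\<beta> small3(1)] e unfolding l2_integral_scale by simp
    fix \<psi> assume \<psi>: "\<psi> \<in> Hinf \<Omega>"
    have "l2_inner \<mu> (\<lambda>x. \<psi> x * ?u x) ?v = \<alpha> * cnj \<beta> * l2_inner \<mu> (\<lambda>x. \<psi> x * w x) w"
      using l2_inner_scale_left[of \<mu> \<alpha> "\<lambda>x. \<psi> x * w x" ?v] by (simp add: l2_inner_scale_right mult_ac)
    then have main: "l2_inner \<mu> (\<lambda>x. \<psi> x * ?u x) ?v = c i * \<psi> (a i)" using w(3) \<psi> \<alpha>\<beta> by simp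
    have "pairing R \<psi> = pairing r \<psi> - (l2_inner \<mu> (\<lambda>x. \<psi> x * u x) ?v + l2_inner \<mu> (\<lambda>x. \<psi> x * ?u x) v)"
      unfolding R_def
      by (simp add: pairing_diff[OF \<psi> r Bochner_Integration.integrable_add[OF i1 i2]]
          pairing_add[OF \<psi> i1 i2] pairing_l2[of u ?v] pairing_l2[of ?u v] del: complex_cnj_mult)
    then show "(\<Sum>j\<in>insert i I. c j * \<psi> (a j)) =
        l2_inner \<mu> (\<lambda>x. \<psi> x * (u x + ?u x)) (\<lambda>x. v x + ?v x) + pairing R \<psi>"
      using F[OF \<psi>] insert.hyps unfolding inner_expand[OF \<psi> ul ul' vl vl'] main by simp
  qed
qed

section \<open>Replacing a density by finitely many point evaluations\<close>

lemma bergman_equicontinuous: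
  assumes "z \<in> \<Omega>" "\<delta> > 0"
  shows "\<exists>\<rho>>0. ball z \<rho> \<subseteq> \<Omega> \<and> (\<forall>f\<in>bergman \<Omega>. \<forall>x\<in>ball z \<rho>. cmod (f x - f z) \<le> \<delta> * l2_norm \<mu> f)"
proof -
  obtain r C where r: "r > 0" "C \<ge> 0" "cball z (2 * r) \<subseteq> \<Omega>"
    and lip: "\<And>f x y. f \<in> bergman \<Omega> \<Longrightarrow> x \<in> cball z r \<Longrightarrow> y \<in> cball z r \<Longrightarrow>
      cmod (f x - f y) \<le> C * l2_norm \<mu> f * norm (x - y)"
    using bergman_local_bound[OF open_\<Omega> assms(1)] by metis
  define \<rho> where "\<rho> = min r (\<delta> / (C + 1))"
  have \<rho>: "\<rho> > 0" "\<rho> \<le> r" "C * \<rho> \<le> \<delta>"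
  proof -
    show "\<rho> > 0" "\<rho> \<le> r" using r assms(2) by (auto simp: \<rho>_def)
    have "C * \<rho> \<le> C * (\<delta> / (C + 1))" using r by (intro mult_left_mono) (auto simp: \<rho>_def)
    also have "\<dots> \<le> \<delta>" using r assms(2) by (simp add: field_simps)
    finally show "C * \<rho> \<le> \<delta>" .
  qed
  have "cmod (f x - f z) \<le> \<delta> * l2_norm \<mu> f" if "f \<in> bergman \<Omega>" "x \<in> ball z \<rho>" for f x
  proof -
    have "cmod (f x - f z) \<le> C * l2_norm \<mu> f * norm (x - z)"
      using that \<rho> r by (intro lip) auto
    also have "\<dots> \<le> C * l2_norm \<mu> f * \<rho>"
      using that r by (intro mult_left_mono) (auto simp: dist_norm norm_minus_commute)
    also have "\<dots> = (C * \<rho>) * l2_norm \<mu> f" by simp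
    also have "\<dots> \<le> \<delta> * l2_norm \<mu> f" using \<rho>(3) by (intro mult_right_mono) auto
    finally show ?thesis .
  qed
  moreover have "ball z \<rho> \<subseteq> \<Omega>" using r(1,3) \<rho>(2) by (auto simp: subset_eq)
  ultimately show ?thesis using \<rho>(1) by blast
qed

end

lemma indicator_disjoint_partition:
  fixes Q :: "nat \<Rightarrow> 'a set"
  assumes disj: "\<And>i j. i \<noteq> j \<Longrightarrow> Q i \<inter> Q j = {}" and x: "x \<in> \<Omega>"
  shows "indicator (\<Omega> - (\<Union>i<n. Q i)) x + (\<Sum>i<n. indicator (Q i) x) = (1 :: 'b :: real_normed_field)"
proof (cases "\<exists>i<n. x \<in> Q i")
  case True
  then obtain i where i: "i < n" "x \<in> Q i" by blast
  have "(\<Sum>j<n. indicator (Q j) x) = (\<Sum>j<n. if j = i then 1 else (0 :: 'b))"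
    using disj i by (intro sum.cong refl) (auto simp: indicator_def)
  then show ?thesis using i by (auto simp: indicator_def)
next
  case False
  then show ?thesis using x by (auto simp: indicator_def)
qed

lemma integrable_indicator_mult:
  fixes f :: "'a \<Rightarrow> 'b :: {real_normed_field, banach, second_countable_topology}"
  assumes "A \<in> sets M" "integrable M f"
  shows "integrable M (\<lambda>x. indicator A x * f x)"
proof -
  have "(\<lambda>x. indicator A x * f x) = (\<lambda>x. indicator A x *\<^sub>R f x)"
    by (auto simp: indicator_def)
  then show ?thesis using integrable_mult_indicator[OF assms] by simp
qed

context bounded_open
begin

text \<open>The pieces of the partition are so small that replacing a Bergman function by its value at a
  centre costs at most \<open>\<delta>\<close> times its norm; the total cost is a bounded functional on the Bergman
  space, hence of the form \<open>\<langle>\<cdot>, k\<rangle>\<close> with \<open>k\<close> small.\<close>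

lemma discretize:
  assumes q: "integrable \<mu> q" and e: "e > 0" and ne: "\<Omega> \<noteq> {}"
  obtains N :: nat and a c r where "\<And>i. i < N \<Longrightarrow> a i \<in> \<Omega>" "(\<Sum>i<N. cmod (c i)) \<le> l1_norm q"
    "integrable \<mu> r" "l1_norm r \<le> e"
    "\<And>\<psi>. \<psi> \<in> Hinf \<Omega> \<Longrightarrow> pairing q \<psi> = (\<Sum>i<N. c i * \<psi> (a i)) + pairing r \<psi>"
proof -
  define V where "V = sqrt (measure \<mu> (space \<mu>))"
  have V: "V \<ge> 0" by (simp add: V_def)
  \<comment> \<open>Makes \<delta> times the L^1 norm of q times V at most e / 2, where V converts
    L^2 norms into L^1 norms; the summand 1 keeps the divisor positive.\<close>
  define W where "W = l1_norm q * V + 1"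
  define \<delta> where "\<delta> = e / (2 * W)"
  have W: "W > 0" using V mult_nonneg_nonneg[OF l1_norm_nonneg[of q] V] unfolding W_def by linarith
  have \<delta>: "\<delta> > 0" "\<delta> * l1_norm q * V \<le> e / 2"
  proof -
    show "\<delta> > 0" using e W by (simp add: \<delta>_def)
    then have "\<delta> * l1_norm q * V \<le> \<delta> * W" by (simp add: W_def algebra_simps)
    also have "\<dots> = e / 2" using W by (simp add: \<delta>_def)
    finally show "\<delta> * l1_norm q * V \<le> e / 2" .
  qed
  have "\<forall>z\<in>\<Omega>. \<exists>\<rho>>0. ball z \<rho> \<subseteq> \<Omega> \<and> (\<forall>f\<in>bergman \<Omega>. \<forall>x\<in>ball z \<rho>. cmod (f x - f z) \<le> \<delta> * l2_norm \<mu> f)"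
    using bergman_equicontinuous \<delta>(1) by blast
  from bchoice[OF this] obtain \<rho> where "\<forall>z\<in>\<Omega>. \<rho> z > 0 \<and> ball z (\<rho> z) \<subseteq> \<Omega> \<and>
      (\<forall>f\<in>bergman \<Omega>. \<forall>x\<in>ball z (\<rho> z). cmod (f x - f z) \<le> \<delta> * l2_norm \<mu> f)" by (elim exE)
  then have \<rho>: "\<And>z. z \<in> \<Omega> \<Longrightarrow> \<rho> z > 0" "\<And>z. z \<in> \<Omega> \<Longrightarrow> ball z (\<rho> z) \<subseteq> \<Omega>"
      "\<And>z f x. z \<in> \<Omega> \<Longrightarrow> f \<in> bergman \<Omega> \<Longrightarrow> x \<in> ball z (\<rho> z) \<Longrightarrow> cmod (f x - f z) \<le> \<delta> * l2_norm \<mu> f"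
    by simp_all
  obtain F' where F': "F' \<subseteq> (\<lambda>z. ball z (\<rho> z)) ` \<Omega>" "countable F'" "\<Union>F' = \<Union>((\<lambda>z. ball z (\<rho> z)) ` \<Omega>)"
    using Lindelof[of "(\<lambda>z. ball z (\<rho> z)) ` \<Omega>"] by (metis (no_types, lifting) imageE open_ball)
  have cover: "\<Union>((\<lambda>z. ball z (\<rho> z)) ` \<Omega>) = \<Omega>" using \<rho>(1,2) by force
  obtain Z where Z: "countable Z" "Z \<subseteq> \<Omega>" "F' = (\<lambda>z. ball z (\<rho> z)) ` Z"
    using F'(1,2) countable_subset_image[of F' "\<lambda>z. ball z (\<rho> z)" \<Omega>] by blast
  have Zne: "Z \<noteq> {}" using F'(3) cover ne Z(3) by auto
  define a where "a = from_nat_into Z"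
  have ra: "range a = Z" unfolding a_def by (rule range_from_nat_into[OF Zne Z(1)])
  have a\<Omega>: "a i \<in> \<Omega>" for i using ra Z(2) by blast
  define U where "U i = ball (a i) (\<rho> (a i))" for i
  have UU: "(\<Union>i. U i) = \<Omega>"
  proof -
    have "(\<Union>i. U i) = \<Union>((\<lambda>z. ball z (\<rho> z)) ` range a)" by (simp add: U_def)
    then show ?thesis using ra F'(3) Z(3) cover by simp
  qed
  \<comment> \<open>A piece need not contain its centre a i, but it lies in the ball around a i,
    where the estimate holds. Repeated centres produce empty pieces.\<close>
  define Q where "Q = disjointed U"
  have QU: "Q i \<subseteq> U i" for i unfolding Q_def by (rule disjointed_subset)
  have Qm: "Q i \<in> sets \<mu>" for i
  proof -
    have "U i \<in> sets \<mu>" for i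
    proof -
      have "U i \<subseteq> \<Omega>" using UU by blast
      then show ?thesis using sets_\<Omega> by (simp add: sets_restrict_space_iff U_def)
    qed
    then have "range Q \<subseteq> sets \<mu>" unfolding Q_def by (intro sets.range_disjointed_sets) auto
    then show ?thesis by blast
  qed
  have Qdisj: "Q i \<inter> Q j = {}" if "i \<noteq> j" for i j
    using disjoint_family_disjointed[of U] that by (simp add: Q_def disjoint_family_on_def)
  have Qcov: "(\<Union>i. Q i) = \<Omega>" unfolding Q_def using UN_disjointed_eq[of U] UU by simp
  \<comment> \<open>What the first n pieces miss. Stopping at a finite stage costs the integral of
    |q| over this set, which tends to 0 and receives the other half of e.\<close>
  define T where "T n = \<Omega> - (\<Union>i<n. Q i)" for n
  have Tm: "T n \<in> sets \<mu>" for n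
    unfolding T_def using Qm sets.top[of \<mu>] by (intro sets.Diff sets.finite_UN) auto
  have part: "indicator (T n) x + (\<Sum>i<n. indicator (Q i) x) = (1 :: real)"
      "indicator (T n) x + (\<Sum>i<n. indicator (Q i) x) = (1 :: complex)" if "x \<in> \<Omega>" for n x
    unfolding T_def using indicator_disjoint_partition[of Q x \<Omega> n] Qdisj that by blast+
  have Qle: "(\<Sum>i<n. indicator (Q i) x) \<le> (1 :: real)" if "x \<in> \<Omega>" for n x
  proof -
    have "(0::real) \<le> indicator (T n) x" by simp
    then show ?thesis using part(1)[OF that, of n] by linarith
  qed
  have "(\<lambda>n. \<integral>x. indicator (T n) x * cmod (q x) \<partial>\<mu>) \<longlonglongrightarrow> (\<integral>x. 0 \<partial>\<mu>)"
  proof (rule integral_dominated_convergence[where w = "\<lambda>x. cmod (q x)"])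
    show "AE x in \<mu>. (\<lambda>n. indicator (T n) x * cmod (q x)) \<longlonglongrightarrow> 0"
    proof (intro AE_I2)
      fix x assume "x \<in> space \<mu>"
      then obtain i where "x \<in> Q i" using Qcov by auto
      then have "\<forall>\<^sub>F n in sequentially. indicator (T n) x * cmod (q x) = 0"
        by (intro eventually_sequentiallyI[of "Suc i"]) (auto simp: T_def indicator_def)
      then show "(\<lambda>n. indicator (T n) x * cmod (q x)) \<longlonglongrightarrow> 0" by (rule tendsto_eventually)
    qed
    show "(\<lambda>x. indicator (T n) x * cmod (q x)) \<in> borel_measurable \<mu>" for n
      using q Tm by (intro borel_measurable_times borel_measurable_indicator) auto
  qed (use q in \<open>auto intro!: AE_I2 simp: indicator_def\<close>)
  then have lim0: "(\<lambda>n. \<integral>x. indicator (T n) x * cmod (q x) \<partial>\<mu>) \<longlonglongrightarrow> 0" by simp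
  have "e / 2 > 0" using e by simp
  from LIMSEQ_D[OF lim0 this] obtain N
    where "\<forall>n\<ge>N. norm ((\<integral>x. indicator (T n) x * cmod (q x) \<partial>\<mu>) - 0) < e / 2" by (elim exE)
  then have N: "(\<integral>x. indicator (T N) x * cmod (q x) \<partial>\<mu>) \<le> e / 2" by (auto simp: abs_less_iff less_imp_le)
  note iind = integrable_indicator_mult
  have ni: "cmod (indicator A x) = indicator A x" for A and x :: "complex^'d" by (simp add: indicator_def)
  define c where "c i = (\<integral>x. indicator (Q i) x * q x \<partial>\<mu>)" for i
  have c_le: "cmod (c i) \<le> (\<integral>x. indicator (Q i) x * cmod (q x) \<partial>\<mu>)" for i
    unfolding c_def using integral_norm_bound[of \<mu> "\<lambda>x. indicator (Q i) x * q x"] by (simp add: norm_mult ni)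
  have sumQ: "(\<Sum>i<N. \<integral>x. indicator (Q i) x * cmod (q x) \<partial>\<mu>) \<le> l1_norm q"
  proof -
    have "(\<Sum>i<N. \<integral>x. indicator (Q i) x * cmod (q x) \<partial>\<mu>) = (\<integral>x. (\<Sum>i<N. indicator (Q i) x) * cmod (q x) \<partial>\<mu>)"
      unfolding sum_distrib_right
      by (rule Bochner_Integration.integral_sum[symmetric], rule iind[OF Qm]) (use q in simp)
    also have "\<dots> \<le> (\<integral>x. cmod (q x) \<partial>\<mu>)"
    proof (rule integral_mono)
      show "integrable \<mu> (\<lambda>x. (\<Sum>i<N. indicator (Q i) x) * cmod (q x))"
        unfolding sum_distrib_right
        by (intro Bochner_Integration.integrable_sum iind[OF Qm]) (use q in simp)
      show "(\<Sum>i<N. indicator (Q i) x) * cmod (q x) \<le> cmod (q x)" if "x \<in> space \<mu>" for x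
        using mult_right_mono[OF Qle[of x N], of "cmod (q x)"] that by simp
    qed (use q in simp)
    finally show ?thesis by (simp add: l1_norm_def)
  qed
  define L where "L \<psi> = (\<Sum>i<N. \<integral>x. indicator (Q i) x * (q x * (\<psi> x - \<psi> (a i))) \<partial>\<mu>)" for \<psi>
  have piece_bd: "cmod (indicator (Q i) x * (q x * (\<psi> x - \<psi> (a i)))) \<le>
      \<delta> * l2_norm \<mu> \<psi> * (indicator (Q i) x * cmod (q x))" if "\<psi> \<in> bergman \<Omega>" for \<psi> i x
  proof (cases "x \<in> Q i")
    case True
    then have "cmod (\<psi> x - \<psi> (a i)) \<le> \<delta> * l2_norm \<mu> \<psi>"
      using \<rho>(3)[OF a\<Omega> that] QU[of i] by (auto simp: U_def)
    from mult_left_mono[OF this norm_ge_zero[of "q x"]] show ?thesis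
      using True by (simp add: norm_mult mult_ac)
  qed simp
  have piece_int: "integrable \<mu> (\<lambda>x. indicator (Q i) x * (q x * (\<psi> x - \<psi> (a i))))" if \<psi>: "\<psi> \<in> bergman \<Omega>" for \<psi> i
  proof (rule Bochner_Integration.integrable_bound)
    show "integrable \<mu> (\<lambda>x. \<delta> * l2_norm \<mu> \<psi> * (indicator (Q i) x * cmod (q x)))"
      by (intro integrable_mult_right iind[OF Qm]) (use q in simp)
    show "(\<lambda>x. indicator (Q i) x * (q x * (\<psi> x - \<psi> (a i)))) \<in> borel_measurable \<mu>"
      using q Qm l2_spaceD(1)[OF bergman_l2[OF \<psi>]]
      by (intro borel_measurable_times borel_measurable_indicator borel_measurable_diff) auto
    show "AE x in \<mu>. norm (indicator (Q i) x * (q x * (\<psi> x - \<psi> (a i)))) \<le>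
        norm (\<delta> * l2_norm \<mu> \<psi> * (indicator (Q i) x * cmod (q x)))"
      using piece_bd[OF \<psi>] \<delta>(1) by (intro AE_I2) (simp add: abs_mult)
  qed
  have "\<exists>k\<in>l2_closure \<mu> (bergman \<Omega>). l2_norm \<mu> k \<le> \<delta> * l1_norm q \<and> (\<forall>\<psi>\<in>bergman \<Omega>. L \<psi> = l2_inner \<mu> \<psi> k)"
  proof (rule l2_riesz[OF finite_\<mu> _ bergman_subspace])
    show "bergman \<Omega> \<subseteq> l2_space \<mu>" using bergman_l2 by blast
    show "L (\<lambda>x. g x + h x) = L g + L h" if g: "g \<in> bergman \<Omega>" and h: "h \<in> bergman \<Omega>" for g h
    proof -
      have "(\<integral>x. indicator (Q i) x * (q x * (g x + h x - (g (a i) + h (a i)))) \<partial>\<mu>) =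
          (\<integral>x. indicator (Q i) x * (q x * (g x - g (a i))) \<partial>\<mu>) +
          (\<integral>x. indicator (Q i) x * (q x * (h x - h (a i))) \<partial>\<mu>)" for i
        by (subst Bochner_Integration.integral_add[OF piece_int[OF g] piece_int[OF h], symmetric])
          (intro Bochner_Integration.integral_cong, auto simp: algebra_simps)
      then show ?thesis by (simp add: L_def sum.distrib)
    qed
    show "L (\<lambda>x. k * g x) = k * L g" if g: "g \<in> bergman \<Omega>" for k g
    proof -
      have "(\<integral>x. indicator (Q i) x * (q x * (k * g x - k * g (a i))) \<partial>\<mu>) =
          k * (\<integral>x. indicator (Q i) x * (q x * (g x - g (a i))) \<partial>\<mu>)" for i
        by (subst integral_mult_right_zero[symmetric])
          (intro Bochner_Integration.integral_cong, auto simp: algebra_simps)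
      then show ?thesis by (simp add: L_def sum_distrib_left)
    qed
    show "cmod (L g) \<le> \<delta> * l1_norm q * l2_norm \<mu> g" if g: "g \<in> bergman \<Omega>" for g
    proof -
      have "cmod (L g) \<le> (\<Sum>i<N. cmod (\<integral>x. indicator (Q i) x * (q x * (g x - g (a i))) \<partial>\<mu>))"
        unfolding L_def by (rule norm_sum)
      also have "\<dots> \<le> (\<Sum>i<N. \<delta> * l2_norm \<mu> g * (\<integral>x. indicator (Q i) x * cmod (q x) \<partial>\<mu>))"
      proof (rule sum_mono)
        fix i
        have "cmod (\<integral>x. indicator (Q i) x * (q x * (g x - g (a i))) \<partial>\<mu>) \<le>
            (\<integral>x. cmod (indicator (Q i) x * (q x * (g x - g (a i)))) \<partial>\<mu>)" by (rule integral_norm_bound)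
        also have "\<dots> \<le> (\<integral>x. \<delta> * l2_norm \<mu> g * (indicator (Q i) x * cmod (q x)) \<partial>\<mu>)"
          by (intro integral_mono integrable_norm piece_int[OF g] piece_bd[OF g] integrable_mult_right iind[OF Qm])
            (use q in simp)
        finally show "cmod (\<integral>x. indicator (Q i) x * (q x * (g x - g (a i))) \<partial>\<mu>) \<le>
            \<delta> * l2_norm \<mu> g * (\<integral>x. indicator (Q i) x * cmod (q x) \<partial>\<mu>)" by simp
      qed
      also have "\<dots> = \<delta> * l2_norm \<mu> g * (\<Sum>i<N. \<integral>x. indicator (Q i) x * cmod (q x) \<partial>\<mu>)"
        by (simp add: sum_distrib_left)
      also have "\<dots> \<le> \<delta> * l2_norm \<mu> g * l1_norm q"
        using \<delta>(1) sumQ by (intro mult_left_mono) auto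
      finally show ?thesis by (simp add: mult_ac)
    qed
    show "0 \<le> \<delta> * l1_norm q" using \<delta>(1) by simp
  qed
  then obtain k where k: "k \<in> l2_closure \<mu> (bergman \<Omega>)" "l2_norm \<mu> k \<le> \<delta> * l1_norm q"
    "\<And>\<psi>. \<psi> \<in> bergman \<Omega> \<Longrightarrow> L \<psi> = l2_inner \<mu> \<psi> k" by blast
  have kl: "k \<in> l2_space \<mu>" using k(1) l2_closure_subset by blast
  have one: "(\<lambda>x. 1) \<in> l2_space \<mu>" by (rule l2_finite_bounded[OF finite_\<mu>, of _ 1]) auto
  have ik: "integrable \<mu> (\<lambda>x. cnj (k x))" using integrable_l2_mult(2)[OF one kl] by simp
  have iT: "integrable \<mu> (\<lambda>x. indicator (T N) x * q x)" by (rule iind[OF Tm q])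
  \<comment> \<open>The tail of q plus the density that Riesz representation gives to the
    replacement error; both parts have L^1 norm at most e / 2.\<close>
  define r where "r x = indicator (T N) x * q x + cnj (k x)" for x
  show thesis
  proof (rule that[of N a c r])
    show "a i \<in> \<Omega>" for i by (rule a\<Omega>)
    show "(\<Sum>i<N. cmod (c i)) \<le> l1_norm q" using sum_mono[of "{..<N}", OF c_le] sumQ by (rule order_trans)
    show "integrable \<mu> r" unfolding r_def using iT ik by simp
    have "l1_norm r \<le> l1_norm (\<lambda>x. indicator (T N) x * q x) + l1_norm (\<lambda>x. cnj (k x))"
      unfolding r_def by (rule l1_norm_add[OF iT ik])
    moreover have "l1_norm (\<lambda>x. indicator (T N) x * q x) \<le> e / 2" using N by (simp add: l1_norm_def norm_mult ni)
    moreover have "l1_norm (\<lambda>x. cnj (k x)) \<le> \<delta> * l1_norm q * V"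
      using integrable_l2(2)[OF finite_\<mu> kl] mult_right_mono[OF k(2) V] by (simp add: l1_norm_def V_def)
    ultimately show "l1_norm r \<le> e" using \<delta>(2) by linarith
    fix \<psi> assume \<psi>: "\<psi> \<in> Hinf \<Omega>"
    have \<psi>b: "\<psi> \<in> bergman \<Omega>" using \<psi> Hinf_subset_bergman by blast
    note iq = Hinf_mult_integrable[OF \<psi> q]
    have "pairing q \<psi> = (\<integral>x. indicator (T N) x * (\<psi> x * q x) + (\<Sum>i<N. indicator (Q i) x * (\<psi> x * q x)) \<partial>\<mu>)"
      unfolding pairing_def
    proof (rule Bochner_Integration.integral_cong[OF refl])
      fix x assume "x \<in> space \<mu>"
      then have "(indicator (T N) x + (\<Sum>i<N. indicator (Q i) x)) * (\<psi> x * q x) = \<psi> x * q x"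
        using part(2)[of x N] by simp
      then show "\<psi> x * q x = indicator (T N) x * (\<psi> x * q x) + (\<Sum>i<N. indicator (Q i) x * (\<psi> x * q x))"
        by (simp add: distrib_right sum_distrib_right)
    qed
    also have "\<dots> = (\<integral>x. indicator (T N) x * (\<psi> x * q x) \<partial>\<mu>) + (\<Sum>i<N. \<integral>x. indicator (Q i) x * (\<psi> x * q x) \<partial>\<mu>)"
      using iind[OF Tm iq] iind[OF Qm iq]
      by (simp only: Bochner_Integration.integral_add Bochner_Integration.integrable_sum
          Bochner_Integration.integral_sum)
    also have "(\<integral>x. indicator (T N) x * (\<psi> x * q x) \<partial>\<mu>) = pairing (\<lambda>x. indicator (T N) x * q x) \<psi>"
      by (simp add: pairing_def mult.left_commute)
    also have "(\<Sum>i<N. \<integral>x. indicator (Q i) x * (\<psi> x * q x) \<partial>\<mu>) = (\<Sum>i<N. c i * \<psi> (a i)) + L \<psi>"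
    proof -
      have "(\<integral>x. indicator (Q i) x * (\<psi> x * q x) \<partial>\<mu>) =
          (\<integral>x. \<psi> (a i) * (indicator (Q i) x * q x) + indicator (Q i) x * (q x * (\<psi> x - \<psi> (a i))) \<partial>\<mu>)" for i
        by (rule Bochner_Integration.integral_cong) (auto simp: algebra_simps)
      also have "\<dots> i = c i * \<psi> (a i) + (\<integral>x. indicator (Q i) x * (q x * (\<psi> x - \<psi> (a i))) \<partial>\<mu>)" for i
        using iind[OF Qm q] piece_int[OF \<psi>b, of i] by (simp add: c_def)
      finally show ?thesis by (simp add: L_def sum.distrib)
    qed
    also have "L \<psi> = pairing (\<lambda>x. cnj (k x)) \<psi>" by (simp add: k(3)[OF \<psi>b] l2_inner_def pairing_def)
    finally show "pairing q \<psi> = (\<Sum>i<N. c i * \<psi> (a i)) + pairing r \<psi>"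
      unfolding r_def by (simp add: pairing_add[OF \<psi> iT ik])
  qed
qed

lemma approx_factor_pairing:
  assumes q: "integrable \<mu> q" and p: "p \<in> l2_space \<mu>" and e: "e > 0" and ne: "\<Omega> \<noteq> {}"
  shows "approx_factor (pairing q) (l1_norm q) p e"
proof -
  have e2: "e / 2 > 0" using e by simp
  obtain N :: nat and a c r1 where a: "\<And>i. i < N \<Longrightarrow> a i \<in> \<Omega>" and c: "(\<Sum>i<N. cmod (c i)) \<le> l1_norm q"
    and r1: "integrable \<mu> r1" "l1_norm r1 \<le> e / 2"
    and d: "\<And>\<psi>. \<psi> \<in> Hinf \<Omega> \<Longrightarrow> pairing q \<psi> = (\<Sum>i<N. c i * \<psi> (a i)) + pairing r1 \<psi>"
    using discretize[OF q e2 ne] by blast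
  have "approx_factor (\<lambda>\<psi>. \<Sum>i<N. c i * \<psi> (a i)) (\<Sum>i<N. cmod (c i)) p (e / 2)"
    by (rule approx_factor_evaluations[OF _ _ p e2]) (use a in auto)
  then obtain u v r where u: "u \<in> bergman \<Omega>" "v \<in> bergman \<Omega>" and r: "integrable \<mu> r"
    and F: "\<And>\<psi>. \<psi> \<in> Hinf \<Omega> \<Longrightarrow> (\<Sum>i<N. c i * \<psi> (a i)) = l2_inner \<mu> (\<lambda>x. \<psi> x * u x) v + pairing r \<psi>"
    and b: "l1_norm r \<le> e / 2" "(l2_norm \<mu> u)\<^sup>2 \<le> (\<Sum>i<N. cmod (c i)) + e / 2"
      "(l2_norm \<mu> v)\<^sup>2 \<le> (\<Sum>i<N. cmod (c i)) + e / 2"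
      "(\<integral>x. cmod (p x) * cmod (u x) \<partial>\<mu>) \<le> e / 2" "(\<integral>x. cmod (p x) * cmod (v x) \<partial>\<mu>) \<le> e / 2"
    by (rule approx_factorE) (rule that)
  show ?thesis unfolding approx_factor_def
  proof (rule exI[of _ u], rule exI[of _ v], rule exI[of _ "\<lambda>x. r x + r1 x"], intro conjI ballI u)
    show "integrable \<mu> (\<lambda>x. r x + r1 x)" using r r1 by simp
    show "l1_norm (\<lambda>x. r x + r1 x) \<le> e" using l1_norm_add[OF r r1(1)] b r1 by linarith
    show "pairing q \<psi> = l2_inner \<mu> (\<lambda>x. \<psi> x * u x) v + pairing (\<lambda>x. r x + r1 x) \<psi>" if "\<psi> \<in> Hinf \<Omega>" for \<psi>
      by (simp add: d[OF that] F[OF that] pairing_add[OF that r r1(1)])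
  qed (use b c e in linarith)+
qed

section \<open>Iteration to an exact factorization\<close>

lemma bergman_geometric:
  assumes x: "\<And>n. x n \<in> bergman \<Omega>" and step: "\<And>n. l2_norm \<mu> (\<lambda>z. x (Suc n) z - x n z) \<le> s / 2 ^ n"
  obtains g where "g \<in> bergman \<Omega>" "(\<lambda>n. l2_norm \<mu> (\<lambda>z. x n z - g z)) \<longlonglongrightarrow> 0"
    "l2_norm \<mu> g \<le> l2_norm \<mu> (x 0) + 2 * s"
proof -
  note xl = bergman_l2[OF x]
  have s0: "s \<ge> 0" using order_trans[OF l2_norm_nonneg step[of 0]] by simp
  have tele: "l2_norm \<mu> (\<lambda>z. x (n + k) z - x n z) \<le> 2 * s / 2 ^ n - 2 * s / 2 ^ (n + k)" for n k
  proof (induction k)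
    case (Suc k)
    have "l2_norm \<mu> (\<lambda>z. x (n + Suc k) z - x n z) \<le> s / 2 ^ (n + k) + (2 * s / 2 ^ n - 2 * s / 2 ^ (n + k))"
      using l2_norm_triangle_diff[OF xl[of "Suc (n + k)"] xl[of "n + k"] xl[of n]] step[of "n + k"] Suc.IH by simp
    also have "\<dots> = 2 * s / 2 ^ n - 2 * s / 2 ^ (n + Suc k)" by (simp add: field_simps)
    finally show ?case .
  qed simp
  have tail: "l2_norm \<mu> (\<lambda>z. x m z - x n z) \<le> 2 * s / 2 ^ N" if "m \<ge> N" "n \<ge> N" for m n N
  proof -
    have *: "l2_norm \<mu> (\<lambda>z. x m z - x n z) \<le> 2 * s / 2 ^ N" if "n \<le> m" "n \<ge> N" for m n
    proof -
      have "l2_norm \<mu> (\<lambda>z. x m z - x n z) \<le> 2 * s / 2 ^ n"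
      proof -
        have "2 * s / 2 ^ m \<ge> 0" using s0 by simp
        then show ?thesis using tele[of n "m - n"] that(1) by simp
      qed
      also have "\<dots> \<le> 2 * s / 2 ^ N" using s0 that(2) by (intro divide_left_mono power_increasing) auto
      finally show ?thesis .
    qed
    show ?thesis
    proof (cases "n \<le> m")
      case True
      then show ?thesis by (rule *) fact
    next
      case False
      then show ?thesis unfolding l2_norm_minus_commute[of \<mu> "x m" "x n"] by (intro *) (use that in auto)
    qed
  qed
  have cau: "\<exists>N. \<forall>m\<ge>N. \<forall>n\<ge>N. l2_norm \<mu> (\<lambda>z. x m z - x n z) < e" if e: "e > 0" for e
  proof -
    have "e / (2 * s + 1) > 0" using e s0 by simp
    then obtain N where N: "(1/2) ^ N < e / (2 * s + 1)" using real_arch_pow_inv[of "e / (2 * s + 1)" "1/2"] by auto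
    have "2 * s / 2 ^ N \<le> (2 * s + 1) * (1/2) ^ N" by (simp add: field_simps power_divide)
    also have "\<dots> < e" using N s0 by (simp add: pos_less_divide_eq mult.commute)
    finally show ?thesis using tail by (meson le_less_trans)
  qed
  obtain g where g: "g \<in> bergman \<Omega>" "(\<lambda>n. l2_norm \<mu> (\<lambda>z. x n z - g z)) \<longlonglongrightarrow> 0"
    "\<And>z. (\<lambda>n. x n z) \<longlonglongrightarrow> g z"
    by (rule bergman_complete[OF open_\<Omega> x cau]) (assumption, rule that)
  have "l2_norm \<mu> g \<le> l2_norm \<mu> (x 0) + 2 * s"
  proof (rule LIMSEQ_le_const2)
    show "(\<lambda>n. l2_norm \<mu> (x n)) \<longlonglongrightarrow> l2_norm \<mu> g" by (rule l2_norm_tendsto[OF xl bergman_l2[OF g(1)] g(2)])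
    show "\<exists>N. \<forall>n\<ge>N. l2_norm \<mu> (x n) \<le> l2_norm \<mu> (x 0) + 2 * s"
    proof (intro exI allI impI)
      fix n
      show "l2_norm \<mu> (x n) \<le> l2_norm \<mu> (x 0) + 2 * s"
        using l2_norm_le_add_diff[OF xl[of n] xl[of 0]] tail[of 0 n 0] by simp
    qed
  qed
  with g(1,2) show thesis by (rule that)
qed

text \<open>At stage n the remainder has L^1 norm at most t^2 / 4^n, so factoring it needs only
  vectors with norm of order t / 2^n, which are added to those already found. The cross terms this
  creates are small because the new vectors are chosen almost orthogonal to the old ones. The
  increments are summable and their total is of order t, which keeps the product of the norms near
  the L^1 norm of q.\<close>

lemma pairing_factorization:
  assumes q: "integrable \<mu> q" and e: "e > 0" and ne: "\<Omega> \<noteq> {}"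
  obtains x y where "x \<in> bergman \<Omega>" "y \<in> bergman \<Omega>"
    "\<And>\<psi>. \<psi> \<in> Hinf \<Omega> \<Longrightarrow> pairing q \<psi> = l2_inner \<mu> (\<lambda>z. \<psi> z * x z) y"
    "l2_norm \<mu> x * l2_norm \<mu> y \<le> l1_norm q + e"
proof -
  define S where "S = sqrt (l1_norm q)"
  have S: "S \<ge> 0" "S\<^sup>2 = l1_norm q" by (auto simp: S_def)
  \<comment> \<open>Chosen for the last estimate: (S + 5 t)^2 = S^2 + 10 S t + 25 t^2 is at most S^2
    + t (10 S + 25) because t <= 1.\<close>
  define t where "t = min 1 (e / (10 * S + 25))"
  have t: "t > 0" "t \<le> 1" "t * (10 * S + 25) \<le> e"
  proof -
    have p: "10 * S + 25 > 0" using S by linarith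
    show "t > 0" "t \<le> 1" using e p by (auto simp: t_def)
    have "t \<le> e / (10 * S + 25)" by (simp add: t_def)
    then show "t * (10 * S + 25) \<le> e" using p by (simp add: pos_le_divide_eq)
  qed
  have t2: "t\<^sup>2 > 0" using t by simp
  \<comment> \<open>The state of the iteration is a pair of vectors with the density they do not yet
    reproduce. Norms are recorded at stage 0 only; afterwards the increments in \<open>R\<close>
    control them.\<close>
  define P where "P n = (\<lambda>(x, y, r). x \<in> bergman \<Omega> \<and> y \<in> bergman \<Omega> \<and> integrable \<mu> r \<and>
    (\<forall>\<psi>\<in>Hinf \<Omega>. pairing q \<psi> = l2_inner \<mu> (\<lambda>z. \<psi> z * x z) y + pairing r \<psi>) \<and> l1_norm r \<le> t\<^sup>2 / 4 ^ n \<and>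
    (n = 0 \<longrightarrow> (l2_norm \<mu> x)\<^sup>2 \<le> l1_norm q + t\<^sup>2 \<and> (l2_norm \<mu> y)\<^sup>2 \<le> l1_norm q + t\<^sup>2))" for n :: nat
  define R where "R n = (\<lambda>(x, y, r :: complex^'d \<Rightarrow> complex) (x', y', r' :: complex^'d \<Rightarrow> complex).
    l2_norm \<mu> (\<lambda>z. x' z - x z) \<le> 2 * t / 2 ^ n \<and> l2_norm \<mu> (\<lambda>z. y' z - y z) \<le> 2 * t / 2 ^ n)" for n :: nat
  have "\<exists>F. \<forall>n. P n (F n) \<and> R n (F n) (F (Suc n))"
  proof (rule dependent_nat_choice)
    \<comment> \<open>At the start there are no earlier vectors to avoid, so p is 0.\<close>
    obtain u v r where u: "u \<in> bergman \<Omega>" "v \<in> bergman \<Omega>" and r: "integrable \<mu> r"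
      and F: "\<And>\<psi>. \<psi> \<in> Hinf \<Omega> \<Longrightarrow> pairing q \<psi> = l2_inner \<mu> (\<lambda>x. \<psi> x * u x) v + pairing r \<psi>"
      and b: "l1_norm r \<le> t\<^sup>2" "(l2_norm \<mu> u)\<^sup>2 \<le> l1_norm q + t\<^sup>2" "(l2_norm \<mu> v)\<^sup>2 \<le> l1_norm q + t\<^sup>2"
      "(\<integral>x. cmod (0 :: complex) * cmod (u x) \<partial>\<mu>) \<le> t\<^sup>2" "(\<integral>x. cmod (0 :: complex) * cmod (v x) \<partial>\<mu>) \<le> t\<^sup>2"
      by (rule approx_factorE[OF approx_factor_pairing[OF q l2_zero t2 ne]]) (rule that)
    show "\<exists>s. P 0 s" using u r F b by (intro exI[of _ "(u, v, r)"]) (simp add: P_def)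
  next
    fix s n assume "P n s"
    then obtain x y r where s: "s = (x, y, r)" and x: "x \<in> bergman \<Omega>" and y: "y \<in> bergman \<Omega>"
      and r: "integrable \<mu> r" "l1_norm r \<le> t\<^sup>2 / 4 ^ n"
      and F: "\<And>\<psi>. \<psi> \<in> Hinf \<Omega> \<Longrightarrow> pairing q \<psi> = l2_inner \<mu> (\<lambda>z. \<psi> z * x z) y + pairing r \<psi>"
      by (cases s) (auto simp: P_def)
    note xl = bergman_l2[OF x] and yl = bergman_l2[OF y]
    \<comment> \<open>The new remainder has three parts, \<open>r'\<close> and two cross terms, each
      at most \<eta>.\<close>
    define \<eta> where "\<eta> = t\<^sup>2 / 4 ^ Suc n / 3"
    have \<eta>: "\<eta> > 0" using t2 by (simp add: \<eta>_def)
    define p where "p z = complex_of_real (cmod (x z)) + complex_of_real (cmod (y z))" for z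
    have pl: "p \<in> l2_space \<mu>" unfolding p_def using xl yl by (intro l2_add l2_cmod)
    have p_cmod: "cmod (p z) = cmod (x z) + cmod (y z)" for z
      unfolding p_def of_real_add[symmetric] norm_of_real by simp
    obtain u v r' where u: "u \<in> bergman \<Omega>" and v: "v \<in> bergman \<Omega>" and r': "integrable \<mu> r'"
      and G: "\<And>\<psi>. \<psi> \<in> Hinf \<Omega> \<Longrightarrow> pairing r \<psi> = l2_inner \<mu> (\<lambda>x. \<psi> x * u x) v + pairing r' \<psi>"
      and b: "l1_norm r' \<le> \<eta>" "(l2_norm \<mu> u)\<^sup>2 \<le> l1_norm r + \<eta>" "(l2_norm \<mu> v)\<^sup>2 \<le> l1_norm r + \<eta>"
      "(\<integral>x. cmod (p x) * cmod (u x) \<partial>\<mu>) \<le> \<eta>" "(\<integral>x. cmod (p x) * cmod (v x) \<partial>\<mu>) \<le> \<eta>"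
      by (rule approx_factorE[OF approx_factor_pairing[OF r(1) pl \<eta> ne]]) (rule that)
    note ul = bergman_l2[OF u] and vl = bergman_l2[OF v]
    have i1: "integrable \<mu> (\<lambda>z. x z * cnj (v z))" and i2: "integrable \<mu> (\<lambda>z. u z * cnj (y z))"
      by (rule integrable_l2_mult(2)[OF xl vl], rule integrable_l2_mult(2)[OF ul yl])
    define r2 where "r2 z = r' z - (x z * cnj (v z) + u z * cnj (y z))" for z
    have "l1_norm (\<lambda>z. x z * cnj (v z)) \<le> \<eta>"
      unfolding l1_norm_l2 by (rule order_trans[OF l2_integral_mono_left[OF xl pl vl] b(5)]) (simp add: p_cmod)
    moreover have "l1_norm (\<lambda>z. u z * cnj (y z)) \<le> \<eta>"
    proof -
      have "l1_norm (\<lambda>z. u z * cnj (y z)) = (\<integral>z. cmod (y z) * cmod (u z) \<partial>\<mu>)"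
        unfolding l1_norm_l2 by (simp add: mult.commute)
      also have "\<dots> \<le> \<eta>"
        by (rule order_trans[OF l2_integral_mono_left[OF yl pl ul] b(4)]) (simp add: p_cmod)
      finally show ?thesis .
    qed
    ultimately have "l1_norm r2 \<le> 3 * \<eta>"
      using l1_norm_diff[OF r' Bochner_Integration.integrable_add[OF i1 i2]] l1_norm_add[OF i1 i2] b(1)
      unfolding r2_def by linarith
    then have r2n: "l1_norm r2 \<le> t\<^sup>2 / 4 ^ Suc n" by (simp add: \<eta>_def)
    have r2i: "integrable \<mu> r2" unfolding r2_def using r' i1 i2 by simp
    have r2p: "pairing q \<psi> = l2_inner \<mu> (\<lambda>z. \<psi> z * (x z + u z)) (\<lambda>z. y z + v z) + pairing r2 \<psi>"
      if \<psi>: "\<psi> \<in> Hinf \<Omega>" for \<psi>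
    proof -
      have "pairing r2 \<psi> = pairing r' \<psi> - (l2_inner \<mu> (\<lambda>z. \<psi> z * x z) v + l2_inner \<mu> (\<lambda>z. \<psi> z * u z) y)"
        unfolding r2_def by (simp add: pairing_diff[OF \<psi> r' Bochner_Integration.integrable_add[OF i1 i2]]
            pairing_add[OF \<psi> i1 i2] pairing_l2)
      then show ?thesis unfolding inner_expand[OF \<psi> xl ul yl vl] using F[OF \<psi>] G[OF \<psi>] by simp
    qed
    \<comment> \<open>The old remainder and \<eta> together are at most 4 t^2 / 4^n, the square of 2
      t / 2^n.\<close>
    have step: "l2_norm \<mu> f \<le> 2 * t / 2 ^ n" if "(l2_norm \<mu> f)\<^sup>2 \<le> l1_norm r + \<eta>" for f
    proof (rule power2_le_imp_le)
      have "\<eta> \<le> 3 * (t\<^sup>2 / 4 ^ n)" using t2 by (simp add: \<eta>_def field_simps)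
      then have "(l2_norm \<mu> f)\<^sup>2 \<le> 4 * (t\<^sup>2 / 4 ^ n)" using that r(2) by linarith
      also have "\<dots> = (2 * t / 2 ^ n)\<^sup>2"
      proof -
        have "(4::real) ^ n = (2 ^ n)\<^sup>2" by (simp add: power_mult[symmetric] power2_eq_square power_mult_distrib[symmetric])
        then show ?thesis by (simp add: power_divide power_mult_distrib)
      qed
      finally show "(l2_norm \<mu> f)\<^sup>2 \<le> (2 * t / 2 ^ n)\<^sup>2" .
    qed (use t in simp)
    show "\<exists>s'. P (Suc n) s' \<and> R n s s'"
    proof (rule exI[of _ "(\<lambda>z. x z + u z, \<lambda>z. y z + v z, r2)"], rule conjI)
      show "P (Suc n) (\<lambda>z. x z + u z, \<lambda>z. y z + v z, r2)"
        unfolding P_def using complex_subspaceD(1)[OF bergman_subspace x u]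
          complex_subspaceD(1)[OF bergman_subspace y v] r2i r2n r2p by simp
      show "R n s (\<lambda>z. x z + u z, \<lambda>z. y z + v z, r2)"
        unfolding R_def s using step[OF b(2)] step[OF b(3)] by simp
    qed
  qed
  then obtain F where F: "\<And>n. P n (F n)" "\<And>n. R n (F n) (F (Suc n))" by blast
  define X where "X n = fst (F n)" for n
  define Y where "Y n = fst (snd (F n))" for n
  define r where "r n = snd (snd (F n))" for n
  have XY: "X n \<in> bergman \<Omega>" "Y n \<in> bergman \<Omega>" "integrable \<mu> (r n)" "l1_norm (r n) \<le> t\<^sup>2 / 4 ^ n"
    and pq: "\<And>\<psi>. \<psi> \<in> Hinf \<Omega> \<Longrightarrow> pairing q \<psi> = l2_inner \<mu> (\<lambda>z. \<psi> z * X n z) (Y n) + pairing (r n) \<psi>" for n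
    using F(1)[of n] by (auto simp: P_def X_def Y_def r_def split: prod.splits)
  have XY0: "(l2_norm \<mu> (X 0))\<^sup>2 \<le> l1_norm q + t\<^sup>2" "(l2_norm \<mu> (Y 0))\<^sup>2 \<le> l1_norm q + t\<^sup>2"
    using F(1)[of 0] by (auto simp: P_def X_def Y_def split: prod.splits)
  have steps: "l2_norm \<mu> (\<lambda>z. X (Suc n) z - X n z) \<le> 2 * t / 2 ^ n"
    "l2_norm \<mu> (\<lambda>z. Y (Suc n) z - Y n z) \<le> 2 * t / 2 ^ n" for n
    using F(2)[of n] by (auto simp: R_def X_def Y_def split: prod.splits)
  obtain x where x: "x \<in> bergman \<Omega>" "(\<lambda>n. l2_norm \<mu> (\<lambda>z. X n z - x z)) \<longlonglongrightarrow> 0"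
    "l2_norm \<mu> x \<le> l2_norm \<mu> (X 0) + 2 * (2 * t)"
    by (rule bergman_geometric[OF XY(1) steps(1)]) (rule that)
  obtain y where y: "y \<in> bergman \<Omega>" "(\<lambda>n. l2_norm \<mu> (\<lambda>z. Y n z - y z)) \<longlonglongrightarrow> 0"
    "l2_norm \<mu> y \<le> l2_norm \<mu> (Y 0) + 2 * (2 * t)"
    by (rule bergman_geometric[OF XY(2) steps(2)]) (rule that)
  note xl = bergman_l2[OF x(1)] and yl = bergman_l2[OF y(1)] and Xl = bergman_l2[OF XY(1)] and Yl = bergman_l2[OF XY(2)]
  show thesis
  proof (rule that[OF x(1) y(1)])
    fix \<psi> assume \<psi>: "\<psi> \<in> Hinf \<Omega>"
    obtain B where B: "B \<ge> 0" "\<And>x. cmod (\<psi> x) \<le> B" using Hinf_bound[OF \<psi>] by blast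
    have "(\<lambda>n. l2_inner \<mu> (\<lambda>z. \<psi> z * X n z) (Y n) + pairing (r n) \<psi> - l2_inner \<mu> (\<lambda>z. \<psi> z * x z) y) \<longlonglongrightarrow> 0"
    proof (rule Lim_null_comparison)
      have "(\<lambda>n. t\<^sup>2 / 4 ^ n) \<longlonglongrightarrow> 0"
        using tendsto_mult_right_zero[OF LIMSEQ_power_zero[of "1/4 :: real"], of "t\<^sup>2"] by (simp add: power_divide)
      then have "(\<lambda>n. B * l2_norm \<mu> (\<lambda>z. X n z - x z) * l2_norm \<mu> (Y n) +
          l2_norm \<mu> (\<lambda>z. \<psi> z * x z) * l2_norm \<mu> (\<lambda>z. Y n z - y z) + B * (t\<^sup>2 / 4 ^ n)) \<longlonglongrightarrow>
          B * 0 * l2_norm \<mu> y + l2_norm \<mu> (\<lambda>z. \<psi> z * x z) * 0 + B * 0"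
        by (intro tendsto_intros x(2) y(2) l2_norm_tendsto[OF Yl yl y(2)])
      then show "(\<lambda>n. B * l2_norm \<mu> (\<lambda>z. X n z - x z) * l2_norm \<mu> (Y n) +
          l2_norm \<mu> (\<lambda>z. \<psi> z * x z) * l2_norm \<mu> (\<lambda>z. Y n z - y z) + B * (t\<^sup>2 / 4 ^ n)) \<longlonglongrightarrow> 0" by simp
      have "norm (l2_inner \<mu> (\<lambda>z. \<psi> z * X n z) (Y n) + pairing (r n) \<psi> - l2_inner \<mu> (\<lambda>z. \<psi> z * x z) y) \<le>
          B * l2_norm \<mu> (\<lambda>z. X n z - x z) * l2_norm \<mu> (Y n) +
          l2_norm \<mu> (\<lambda>z. \<psi> z * x z) * l2_norm \<mu> (\<lambda>z. Y n z - y z) + B * (t\<^sup>2 / 4 ^ n)" for n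
      proof -
        have d: "(\<lambda>z. X n z - x z) \<in> l2_space \<mu>" "(\<lambda>z. Y n z - y z) \<in> l2_space \<mu>" using Xl yl xl Yl by auto
        note \<psi>d = Hinf_mult_l2[OF \<psi> d(1)] and \<psi>x = Hinf_mult_l2[OF \<psi> xl] and \<psi>X = Hinf_mult_l2[OF \<psi> Xl]
        have eq: "l2_inner \<mu> (\<lambda>z. \<psi> z * X n z) (Y n) - l2_inner \<mu> (\<lambda>z. \<psi> z * x z) y =
            l2_inner \<mu> (\<lambda>z. \<psi> z * (X n z - x z)) (Y n) + l2_inner \<mu> (\<lambda>z. \<psi> z * x z) (\<lambda>z. Y n z - y z)"
          using \<psi>x \<psi>X Yl yl by (simp add: right_diff_distrib l2_inner_diff_left l2_inner_diff_right)
        have "cmod (l2_inner \<mu> (\<lambda>z. \<psi> z * (X n z - x z)) (Y n)) \<le>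
            l2_norm \<mu> (\<lambda>z. \<psi> z * (X n z - x z)) * l2_norm \<mu> (Y n)" by (rule l2_cauchy_schwarz[OF \<psi>d Yl])
        also have "\<dots> \<le> B * l2_norm \<mu> (\<lambda>z. X n z - x z) * l2_norm \<mu> (Y n)"
          by (intro mult_right_mono l2_bounded_mult(2)[OF d(1) Hinf_measurable[OF \<psi>] B(2)]) simp
        finally have 1: "cmod (l2_inner \<mu> (\<lambda>z. \<psi> z * (X n z - x z)) (Y n)) \<le>
            B * l2_norm \<mu> (\<lambda>z. X n z - x z) * l2_norm \<mu> (Y n)" .
        have 2: "cmod (l2_inner \<mu> (\<lambda>z. \<psi> z * x z) (\<lambda>z. Y n z - y z)) \<le>
            l2_norm \<mu> (\<lambda>z. \<psi> z * x z) * l2_norm \<mu> (\<lambda>z. Y n z - y z)" by (rule l2_cauchy_schwarz[OF \<psi>x d(2)])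
        have "cmod (pairing (r n) \<psi>) \<le> B * l1_norm (r n)" by (rule pairing_bound[OF B(2) \<psi> XY(3)])
        also have "\<dots> \<le> B * (t\<^sup>2 / 4 ^ n)" using XY(4) B(1) by (rule mult_left_mono)
        finally have 3: "cmod (pairing (r n) \<psi>) \<le> B * (t\<^sup>2 / 4 ^ n)" .
        have eq2: "l2_inner \<mu> (\<lambda>z. \<psi> z * X n z) (Y n) + pairing (r n) \<psi> - l2_inner \<mu> (\<lambda>z. \<psi> z * x z) y =
            (l2_inner \<mu> (\<lambda>z. \<psi> z * (X n z - x z)) (Y n) + l2_inner \<mu> (\<lambda>z. \<psi> z * x z) (\<lambda>z. Y n z - y z)) +
            pairing (r n) \<psi>" using eq by (simp add: algebra_simps)
        have tri: "cmod (a + b + c) \<le> cmod a + cmod b + cmod c" for a b c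
          using norm_triangle_ineq[of "a + b" c] norm_triangle_ineq[of a b] by linarith
        show ?thesis unfolding eq2 by (rule order_trans[OF tri]) (intro add_mono 1 2 3)
      qed
      then show "\<forall>\<^sub>F n in sequentially. norm (l2_inner \<mu> (\<lambda>z. \<psi> z * X n z) (Y n) + pairing (r n) \<psi> -
          l2_inner \<mu> (\<lambda>z. \<psi> z * x z) y) \<le> B * l2_norm \<mu> (\<lambda>z. X n z - x z) * l2_norm \<mu> (Y n) +
          l2_norm \<mu> (\<lambda>z. \<psi> z * x z) * l2_norm \<mu> (\<lambda>z. Y n z - y z) + B * (t\<^sup>2 / 4 ^ n)" by simp
    qed
    then have "(\<lambda>n::nat. pairing q \<psi> - l2_inner \<mu> (\<lambda>z. \<psi> z * x z) y) \<longlonglongrightarrow> 0" using pq[OF \<psi>] by simp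
    then show "pairing q \<psi> = l2_inner \<mu> (\<lambda>z. \<psi> z * x z) y" by (simp add: LIMSEQ_const_iff)
  next
    \<comment> \<open>5 t is t from the initial approximation plus 4 t, the sum of all increments 2
      t / 2^n.\<close>
    have nrm: "a \<le> S + 5 * t" if "a \<le> b + 2 * (2 * t)" "b\<^sup>2 \<le> l1_norm q + t\<^sup>2" "b \<ge> 0" for a b
    proof -
      have "0 \<le> 2 * S * t" using S t by simp
      then have "b\<^sup>2 \<le> (S + t)\<^sup>2" using that(2) S by (simp add: power2_sum)
      then have "b \<le> S + t" using S t by (intro power2_le_imp_le[of b]) auto
      then show ?thesis using that(1) by linarith
    qed
    have "l2_norm \<mu> x * l2_norm \<mu> y \<le> (S + 5 * t) * (S + 5 * t)"
      using nrm[OF x(3) XY0(1)] nrm[OF y(3) XY0(2)] S t by (intro mult_mono) auto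
    also have "\<dots> = S\<^sup>2 + t * (10 * S) + 25 * t * t" by (simp add: power2_eq_square algebra_simps)
    also have "\<dots> \<le> S\<^sup>2 + t * (10 * S + 25)" using t mult_left_mono[of t 1 "25 * t"] by (simp add: algebra_simps)
    also have "\<dots> \<le> l1_norm q + e" using t(3) S by linarith
    finally show "l2_norm \<mu> x * l2_norm \<mu> y \<le> l1_norm q + e" .
  qed
qed

end

subsection \<open>Kernel vectors and the Pick matrix\<close>

lemma complex_subspace_sum:
  assumes "complex_subspace V" "\<And>i. i \<in> I \<Longrightarrow> g i \<in> V"
  shows "(\<lambda>x. \<Sum>i\<in>I. c i * g i x) \<in> V"
  using assms(2)
proof (induction I rule: infinite_finite_induct)
  case (insert i I)
  then have "(\<lambda>x. c i * g i x) \<in> V" "(\<lambda>x. \<Sum>i\<in>I. c i * g i x) \<in> V"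
    using complex_subspaceD(2)[OF assms(1), of "g i" "g i" "c i"] by auto
  then show ?case using complex_subspaceD(1)[OF assms(1)] insert.hyps by simp
qed (use assms(1) in \<open>auto simp: complex_subspace_def\<close>)

lemma l2_closure_subspace:
  assumes V: "complex_subspace V" and sub: "V \<subseteq> l2_space M"
  shows "complex_subspace (l2_closure M V)"
  unfolding complex_subspace_def
proof (intro conjI ballI allI)
  show "(\<lambda>x. 0) \<in> l2_closure M V" using l2_subset_closure[OF sub] V by (auto simp: complex_subspace_def)
next
  fix g h assume g: "g \<in> l2_closure M V" and h: "h \<in> l2_closure M V"
  obtain s where s: "\<And>n. s n \<in> V" "(\<lambda>n. l2_norm M (\<lambda>x. s n x - g x)) \<longlonglongrightarrow> 0"
    using l2_closureD[OF g sub] by blast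
  obtain t where t: "\<And>n. t n \<in> V" "(\<lambda>n. l2_norm M (\<lambda>x. t n x - h x)) \<longlonglongrightarrow> 0"
    using l2_closureD[OF h sub] by blast
  have l: "g \<in> l2_space M" "h \<in> l2_space M" "\<And>n. s n \<in> l2_space M" "\<And>n. t n \<in> l2_space M"
    using g h s(1) t(1) sub l2_closure_subset by blast+
  show "(\<lambda>x. g x + h x) \<in> l2_closure M V"
  proof (rule l2_closureI[where s = "\<lambda>n x. s n x + t n x"])
    show "(\<lambda>x. s n x + t n x) \<in> V" for n by (rule complex_subspaceD(1)[OF V s(1) t(1)])
    show "(\<lambda>n. l2_norm M (\<lambda>x. s n x + t n x - (g x + h x))) \<longlonglongrightarrow> 0"
    proof (rule Lim_null_comparison)
      show "(\<lambda>n. l2_norm M (\<lambda>x. s n x - g x) + l2_norm M (\<lambda>x. t n x - h x)) \<longlonglongrightarrow> 0"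
        using tendsto_add[OF s(2) t(2)] by simp
      have "l2_norm M (\<lambda>x. s n x + t n x - (g x + h x)) \<le>
          l2_norm M (\<lambda>x. s n x - g x) + l2_norm M (\<lambda>x. t n x - h x)" for n
        using l2_norm_triangle[OF l2_diff[OF l(3)[of n] l(1)] l2_diff[OF l(4)[of n] l(2)]]
        by (simp add: algebra_simps)
      then show "\<forall>\<^sub>F n in sequentially. norm (l2_norm M (\<lambda>x. s n x + t n x - (g x + h x))) \<le>
          l2_norm M (\<lambda>x. s n x - g x) + l2_norm M (\<lambda>x. t n x - h x)" by simp
    qed
  qed (use l sub in auto)
next
  fix c g assume g: "g \<in> l2_closure M V"
  obtain s where s: "\<And>n. s n \<in> V" "(\<lambda>n. l2_norm M (\<lambda>x. s n x - g x)) \<longlonglongrightarrow> 0"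
    using l2_closureD[OF g sub] by blast
  show "(\<lambda>x. c * g x) \<in> l2_closure M V"
  proof (rule l2_closureI[where s = "\<lambda>n x. c * s n x"])
    show "(\<lambda>x. c * g x) \<in> l2_space M" using g l2_closure_subset by blast
    show "(\<lambda>x. c * s n x) \<in> V" for n by (rule complex_subspaceD(2)[OF V s(1,1)])
    show "(\<lambda>n. l2_norm M (\<lambda>x. c * s n x - c * g x)) \<longlonglongrightarrow> 0"
      using tendsto_mult_left[OF s(2), of "cmod c"] by (simp add: right_diff_distrib[symmetric] l2_norm_scale)
  qed fact
qed

text \<open>Pairing with the Riesz vector is at once the linear extension to the closure and its
  bound.\<close>

lemma bounded_evaluationI:
  assumes fin: "finite_measure M" and sub: "A \<subseteq> l2_space M" and A: "complex_subspace A"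
    and C: "C \<ge> 0" "\<And>\<phi>. \<phi> \<in> A \<Longrightarrow> cmod (\<phi> z) \<le> C * l2_norm M \<phi>"
  shows "bounded_evaluation A M z"
proof -
  obtain k where k: "k \<in> l2_closure M A" "l2_norm M k \<le> C" "\<And>\<phi>. \<phi> \<in> A \<Longrightarrow> \<phi> z = l2_inner M \<phi> k"
    using l2_riesz[OF fin sub A, of "\<lambda>\<phi>. \<phi> z" C] C by auto
  have kl: "k \<in> l2_space M" using k(1) l2_closure_subset by blast
  show ?thesis unfolding bounded_evaluation_def
  proof (intro exI[of _ "\<lambda>g. l2_inner M g k"] conjI ballI allI)
    fix g h a b assume "g \<in> l2_closure M A" "h \<in> l2_closure M A"
    then have "g \<in> l2_space M" "h \<in> l2_space M" using l2_closure_subset by blast+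
    then show "l2_inner M (\<lambda>x. a * g x + b * h x) k = a * l2_inner M g k + b * l2_inner M h k"
      using kl by (simp add: l2_inner_add_left l2_inner_scale_left l2_scale)
  next
    show "\<exists>C. \<forall>g\<in>l2_closure M A. cmod (l2_inner M g k) \<le> C * l2_norm M g"
    proof (intro exI[of _ C] ballI)
      fix g assume "g \<in> l2_closure M A"
      then have "g \<in> l2_space M" using l2_closure_subset by blast
      from l2_cauchy_schwarz[OF this kl] mult_left_mono[OF k(2) l2_norm_nonneg[of M g]]
      show "cmod (l2_inner M g k) \<le> C * l2_norm M g" by (simp add: mult.commute)
    qed
  qed (use k(3) in auto)
qed

text \<open>Shows that the choice in \<open>kernel_vector\<close> has a witness. The constant in
  \<open>bounded_evaluation\<close> may be negative, so its absolute value is passed to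
  \<open>l2_riesz\<close>.\<close>

lemma kernel_vector:
  assumes fin: "finite_measure M" and sub: "A \<subseteq> l2_space M" and A: "complex_subspace A"
    and b: "bounded_evaluation A M z"
  shows "kernel_vector A M z \<in> l2_closure M A" "\<And>\<phi>. \<phi> \<in> A \<Longrightarrow> l2_inner M \<phi> (kernel_vector A M z) = \<phi> z"
proof -
  obtain L C where L: "\<forall>\<phi>\<in>A. L \<phi> = \<phi> z" "\<forall>g\<in>l2_closure M A. cmod (L g) \<le> C * l2_norm M g"
    using b unfolding bounded_evaluation_def by blast
  have "cmod (\<phi> z) \<le> \<bar>C\<bar> * l2_norm M \<phi>" if "\<phi> \<in> A" for \<phi>
  proof -
    have "\<phi> \<in> l2_closure M A" using that l2_subset_closure[OF sub] by blast
    then have "cmod (L \<phi>) \<le> C * l2_norm M \<phi>" using L(2) by blast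
    also have "\<dots> \<le> \<bar>C\<bar> * l2_norm M \<phi>" by (intro mult_right_mono) auto
    finally show ?thesis using L(1) that by simp
  qed
  then have "\<exists>k\<in>l2_closure M A. l2_norm M k \<le> \<bar>C\<bar> \<and> (\<forall>\<phi>\<in>A. \<phi> z = l2_inner M \<phi> k)"
    by (intro l2_riesz[OF fin sub A]) auto
  then have "\<exists>k. k \<in> l2_closure M A \<and> (\<forall>\<phi>\<in>A. \<phi> z = l2_inner M \<phi> k)" by blast
  from someI_ex[OF this] show "kernel_vector A M z \<in> l2_closure M A"
    "\<And>\<phi>. \<phi> \<in> A \<Longrightarrow> l2_inner M \<phi> (kernel_vector A M z) = \<phi> z"
    unfolding kernel_vector_def by auto
qed


text \<open>Only nodes with bounded evaluation enter, in agreement with the value 0 of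
  \<open>repr_kernel\<close> at the other nodes; a quadratic form over all nodes thus reduces to
  these.\<close>

definition kernel_comb ::
    "(complex^'d \<Rightarrow> complex) set \<Rightarrow> (complex^'d) measure \<Rightarrow> ('n::finite \<Rightarrow> complex^'d) \<Rightarrow> ('n \<Rightarrow> complex) \<Rightarrow>
     (complex^'d \<Rightarrow> complex)" where
  "kernel_comb A M z c = (\<lambda>x. \<Sum>i\<in>{i. bounded_evaluation A M (z i)}. c i * kernel_vector A M (z i) x)"

context
  fixes M :: "(complex^'d) measure" and A :: "(complex^'d \<Rightarrow> complex) set" and z :: "'n::finite \<Rightarrow> complex^'d"
  assumes fin: "finite_measure M" and sub: "A \<subseteq> l2_space M" and A: "complex_subspace A"
begin

lemma kernel_comb_closure: "kernel_comb A M z c \<in> l2_closure M A"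
  unfolding kernel_comb_def
  by (intro complex_subspace_sum l2_closure_subspace A sub kernel_vector[OF fin sub A]) simp

lemma kernel_comb_l2: "kernel_comb A M z c \<in> l2_space M"
  using kernel_comb_closure l2_closure_subset by blast

lemma kernel_vector_l2: "bounded_evaluation A M x \<Longrightarrow> kernel_vector A M x \<in> l2_space M"
  using kernel_vector(1)[OF fin sub A] l2_closure_subset by blast

lemma inner_kernel_comb:
  assumes "\<phi> \<in> A"
  shows "l2_inner M \<phi> (kernel_comb A M z c) =
    (\<Sum>i\<in>{i. bounded_evaluation A M (z i)}. cnj (c i) * \<phi> (z i))"
proof -
  have "\<phi> \<in> l2_space M" using assms sub by blast
  then have "l2_inner M \<phi> (kernel_comb A M z c) =
      (\<Sum>i\<in>{i. bounded_evaluation A M (z i)}. l2_inner M \<phi> (\<lambda>x. c i * kernel_vector A M (z i) x))"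
    unfolding kernel_comb_def by (intro l2_inner_sum_right l2_scale kernel_vector_l2) auto
  also have "\<dots> = (\<Sum>i\<in>{i. bounded_evaluation A M (z i)}. cnj (c i) * \<phi> (z i))"
    using kernel_vector(2)[OF fin sub A _ assms] by (intro sum.cong) (simp_all add: l2_inner_scale_right)
  finally show ?thesis .
qed

lemma kernel_comb_norm:
  "complex_of_real ((l2_norm M (kernel_comb A M z c))\<^sup>2) =
    (\<Sum>i\<in>UNIV. \<Sum>j\<in>UNIV. cnj (c i) * repr_kernel A M (z i) (z j) * c j)"
proof -
  let ?I = "{i. bounded_evaluation A M (z i)}" and ?k = "\<lambda>i. kernel_vector A M (z i)"
  have "complex_of_real ((l2_norm M (kernel_comb A M z c))\<^sup>2) =
      l2_inner M (kernel_comb A M z c) (kernel_comb A M z c)" by (simp only: l2_inner_self)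
  also have "\<dots> = (\<Sum>j\<in>?I. l2_inner M (\<lambda>x. c j * ?k j x) (kernel_comb A M z c))"
    by (subst (1) kernel_comb_def) (intro l2_inner_sum_left l2_scale kernel_vector_l2 kernel_comb_l2, auto)
  also have "\<dots> = (\<Sum>j\<in>?I. \<Sum>i\<in>?I. c j * (cnj (c i) * l2_inner M (?k j) (?k i)))"
  proof (intro sum.cong refl)
    fix j assume j: "j \<in> ?I"
    have "l2_inner M (?k j) (kernel_comb A M z c) = (\<Sum>i\<in>?I. l2_inner M (?k j) (\<lambda>x. c i * ?k i x))"
      unfolding kernel_comb_def using j by (intro l2_inner_sum_right l2_scale kernel_vector_l2) auto
    then show "l2_inner M (\<lambda>x. c j * ?k j x) (kernel_comb A M z c) =
        (\<Sum>i\<in>?I. c j * (cnj (c i) * l2_inner M (?k j) (?k i)))"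
      by (simp add: l2_inner_scale_left l2_inner_scale_right sum_distrib_left)
  qed
  also have "\<dots> = (\<Sum>i\<in>?I. \<Sum>j\<in>?I. c j * (cnj (c i) * l2_inner M (?k j) (?k i)))" by (rule sum.swap)
  also have "\<dots> = (\<Sum>i\<in>?I. \<Sum>j\<in>?I. cnj (c i) * repr_kernel A M (z i) (z j) * c j)"
    by (intro sum.cong refl) (auto simp: repr_kernel_def)
  also have "\<dots> = (\<Sum>i\<in>?I. \<Sum>j\<in>UNIV. cnj (c i) * repr_kernel A M (z i) (z j) * c j)"
    by (intro sum.cong refl sum.mono_neutral_left) (auto simp: repr_kernel_def)
  also have "\<dots> = (\<Sum>i\<in>UNIV. \<Sum>j\<in>UNIV. cnj (c i) * repr_kernel A M (z i) (z j) * c j)"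
    by (rule sum.mono_neutral_left) (auto simp: repr_kernel_def)
  finally show ?thesis .
qed

text \<open>The quadratic form at c is the difference of the squared norms of the combinations with
  coefficients c i and cnj (w i) c i. Positivity is therefore contractivity of the map multiplying
  the kernel vector at z i by cnj (w i).\<close>

lemma positive_semidefinite_iff:
  "positive_semidefinite (\<chi> i j. (1 - w i * cnj (w j)) * repr_kernel A M (z i) (z j)) \<longleftrightarrow>
    (\<forall>c. l2_norm M (kernel_comb A M z (\<lambda>i. cnj (w i) * c i)) \<le> l2_norm M (kernel_comb A M z c))"
proof -
  have gram: "(\<Sum>i\<in>UNIV. \<Sum>j\<in>UNIV. cnj (c i) * ((1 - w i * cnj (w j)) * repr_kernel A M (z i) (z j)) * c j) =
      complex_of_real ((l2_norm M (kernel_comb A M z c))\<^sup>2 -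
        (l2_norm M (kernel_comb A M z (\<lambda>i. cnj (w i) * c i)))\<^sup>2)" for c
    unfolding of_real_diff kernel_comb_norm
    by (simp add: sum_subtractf[symmetric] algebra_simps)
  have real: "complex_of_real (a\<^sup>2 - b\<^sup>2) \<in> \<real>\<^sub>\<ge>\<^sub>0 \<longleftrightarrow> b \<le> a" if "a \<ge> 0" "b \<ge> 0" for a b :: real
    using that by (simp add: nonneg_Reals_of_real_iff abs_le_square_iff[symmetric] del: of_real_diff of_real_power)
  show ?thesis
    unfolding positive_semidefinite_def
  proof (intro iffI allI)
    fix c :: "'n \<Rightarrow> complex"
    assume "\<forall>c::complex^'n. (\<Sum>i\<in>UNIV. \<Sum>j\<in>UNIV. cnj (c $ i) *
      (\<chi> i j. (1 - w i * cnj (w j)) * repr_kernel A M (z i) (z j)) $ i $ j * c $ j) \<in> \<real>\<^sub>\<ge>\<^sub>0"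
    from this[rule_format, of "\<chi> i. c i"]
    show "l2_norm M (kernel_comb A M z (\<lambda>i. cnj (w i) * c i)) \<le> l2_norm M (kernel_comb A M z c)"
      by (simp add: gram real del: of_real_diff of_real_power)
  next
    fix c :: "complex^'n"
    assume "\<forall>c. l2_norm M (kernel_comb A M z (\<lambda>i. cnj (w i) * c i)) \<le> l2_norm M (kernel_comb A M z c)"
    then show "(\<Sum>i\<in>UNIV. \<Sum>j\<in>UNIV. cnj (c $ i) *
      (\<chi> i j. (1 - w i * cnj (w j)) * repr_kernel A M (z i) (z j)) $ i $ j * c $ j) \<in> \<real>\<^sub>\<ge>\<^sub>0"
      by (simp add: gram real del: of_real_diff of_real_power)
  qed
qed

end

subsection \<open>Weights and interpolation by the algebra\<close>

lemma Re_bounded_below_imp_zero: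
  assumes "\<And>c. a \<le> Re (b + c * z)"
  shows "z = 0"
proof (rule ccontr)
  assume "z \<noteq> 0"
  then have "a \<le> Re (b + (of_real (a - Re b - 1) / z) * z)" using assms by blast
  then show False using \<open>z \<noteq> 0\<close> by simp
qed

context bounded_open
begin

text \<open>Includes the sums of |f m|^2 attached to trace class functionals, which in general are
  not |f|^2 for one analytic f. Closure under addition makes the weighted norms a directed
  family.\<close>

definition weights :: "(complex^'d \<Rightarrow> real) set" where
  "weights = {h. integrable \<mu> h \<and> (\<forall>x. 0 \<le> h x)}"

abbreviation dens :: "(complex^'d \<Rightarrow> real) \<Rightarrow> (complex^'d) measure" where
  "dens h \<equiv> density \<mu> (\<lambda>x. ennreal (h x))"

lemma weights_add: "h \<in> weights \<Longrightarrow> k \<in> weights \<Longrightarrow> (\<lambda>x. h x + k x) \<in> weights"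
  by (auto simp: weights_def)

lemma const_weight: "(\<lambda>x. 1) \<in> weights"
  using finite_measure.integrable_const[OF finite_\<mu>, of "1::real"] by (simp add: weights_def)

lemma bergman_weight: "f \<in> bergman \<Omega> \<Longrightarrow> (\<lambda>z. (cmod (f z))\<^sup>2) \<in> weights"
  by (auto simp: weights_def dest: bergman_l2 l2_spaceD)

lemma finite_dens:
  assumes "h \<in> weights"
  shows "finite_measure (dens h)"
proof
  have "emeasure (dens h) (space \<mu>) = (\<integral>\<^sup>+x. ennreal (h x) * indicator (space \<mu>) x \<partial>\<mu>)"
    using assms by (intro emeasure_density) (auto simp: weights_def)
  also have "\<dots> = (\<integral>\<^sup>+x. ennreal (h x) \<partial>\<mu>)" by (intro nn_integral_cong) simp
  also have "\<dots> = ennreal (\<integral>x. h x \<partial>\<mu>)"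
    using assms by (intro nn_integral_eq_integral) (auto simp: weights_def)
  finally show "emeasure (dens h) (space (dens h)) \<noteq> \<infinity>" by simp
qed

lemma dens_measurable: "g \<in> borel_measurable (dens h) \<longleftrightarrow> g \<in> borel_measurable \<mu>"
  by (simp add: measurable_def)

lemma dens_l2_bounded:
  assumes "h \<in> weights" "g \<in> borel_measurable \<mu>" "\<And>x. cmod (g x) \<le> B"
  shows "g \<in> l2_space (dens h)"
  using assms by (intro l2_finite_bounded[OF finite_dens]) (auto simp: dens_measurable)

lemma Hinf_dens_l2: "h \<in> weights \<Longrightarrow> \<phi> \<in> Hinf \<Omega> \<Longrightarrow> \<phi> \<in> l2_space (dens h)"
  using Hinf_bound dens_l2_bounded Hinf_measurable by metis

lemma dens_norm_power2:
  assumes "h \<in> weights" "g \<in> borel_measurable \<mu>"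
  shows "(l2_norm (dens h) g)\<^sup>2 = (\<integral>x. h x * (cmod (g x))\<^sup>2 \<partial>\<mu>)"
  unfolding l2_norm_power2 using assms
  by (subst integral_density) (auto simp: weights_def)

lemma dens_integrable:
  assumes "h \<in> weights" "g \<in> l2_space (dens h)"
  shows "integrable \<mu> (\<lambda>x. h x * (cmod (g x))\<^sup>2)"
  using l2_spaceD[OF assms(2)] assms(1)
  by (subst (asm) integrable_density) (auto simp: weights_def dens_measurable)

lemma dens_inner:
  assumes "h \<in> weights" "g \<in> borel_measurable \<mu>" "k \<in> borel_measurable \<mu>"
  shows "l2_inner (dens h) g k = (\<integral>x. complex_of_real (h x) * (g x * cnj (k x)) \<partial>\<mu>)"
proof -
  have "(\<lambda>x. cnj (k x)) \<in> borel_measurable \<mu>"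
    using borel_measurable_continuous_onI[of cnj] assms(3)
    by (rule measurable_compose[rotated]) (intro continuous_intros)
  then show ?thesis unfolding l2_inner_def using assms
    by (subst integral_density) (auto simp: weights_def scaleR_conv_of_real intro: borel_measurable_times)
qed

lemma weighted_measure_dens: "weighted_measure \<Omega> f = dens (\<lambda>z. (cmod (f z))\<^sup>2)"
  by (simp add: weighted_measure_def)

lemma weighted_norm:
  assumes f: "f \<in> bergman \<Omega>" and "g \<in> borel_measurable \<mu>"
  shows "l2_norm (weighted_measure \<Omega> f) g = l2_norm \<mu> (\<lambda>x. g x * f x)"
proof -
  have "(l2_norm (weighted_measure \<Omega> f) g)\<^sup>2 = (l2_norm \<mu> (\<lambda>x. g x * f x))\<^sup>2"
    unfolding weighted_measure_dens dens_norm_power2[OF bergman_weight[OF f] assms(2)]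
    by (simp add: l2_norm_power2 norm_mult power_mult_distrib mult.commute)
  then show ?thesis by simp
qed

lemma finite_weighted: "f \<in> bergman \<Omega> \<Longrightarrow> finite_measure (weighted_measure \<Omega> f)"
  unfolding weighted_measure_dens by (rule finite_dens[OF bergman_weight])

lemma Hinf_weighted_l2: "f \<in> bergman \<Omega> \<Longrightarrow> Hinf \<Omega> \<subseteq> l2_space (weighted_measure \<Omega> f)"
  unfolding weighted_measure_dens using Hinf_dens_l2[OF bergman_weight] by blast

end

section \<open>Nodes identified by the algebra, and the contraction estimate\<close>

locale pick_data = bounded_open \<Omega> for \<Omega> :: "(complex^'d) set" +
  fixes A :: "(complex^'d \<Rightarrow> complex) set" and z :: "'n::finite \<Rightarrow> complex^'d"
  assumes alg: "unital_subalgebra \<Omega> A" and z_in: "\<And>i. z i \<in> \<Omega>"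
begin

lemma A_Hinf: "\<phi> \<in> A \<Longrightarrow> \<phi> \<in> Hinf \<Omega>"
  using alg by (auto simp: unital_subalgebra_def)

lemma A_one: "indicator \<Omega> \<in> A"
  and A_add: "\<phi> \<in> A \<Longrightarrow> \<psi> \<in> A \<Longrightarrow> (\<lambda>z. \<phi> z + \<psi> z) \<in> A"
  and A_scale: "\<phi> \<in> A \<Longrightarrow> (\<lambda>z. c * \<phi> z) \<in> A"
  and A_mult: "\<phi> \<in> A \<Longrightarrow> \<psi> \<in> A \<Longrightarrow> (\<lambda>z. \<phi> z * \<psi> z) \<in> A"
  using alg by (auto simp: unital_subalgebra_def)

lemma A_subspace: "complex_subspace A"
  using A_add A_scale A_scale[OF A_one, of 0] by (auto simp: complex_subspace_def)

lemma A_sub: "f \<in> bergman \<Omega> \<Longrightarrow> A \<subseteq> l2_space (weighted_measure \<Omega> f)"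
  using A_Hinf Hinf_weighted_l2 by blast

lemma psd_iff:
  assumes "f \<in> bergman \<Omega>"
  shows "positive_semidefinite
      (\<chi> i j. (1 - w i * cnj (w j)) * repr_kernel A (weighted_measure \<Omega> f) (z i) (z j)) \<longleftrightarrow>
    (\<forall>c. l2_norm (weighted_measure \<Omega> f) (kernel_comb A (weighted_measure \<Omega> f) z (\<lambda>i. cnj (w i) * c i)) \<le>
      l2_norm (weighted_measure \<Omega> f) (kernel_comb A (weighted_measure \<Omega> f) z c))"
  by (rule positive_semidefinite_iff[OF finite_weighted[OF assms] A_sub[OF assms] A_subspace])

text \<open>No adjoint operator is constructed: <\<psi>, t> = <\<phi> \<psi>, s> holds for \<psi> in
  \<open>A\<close>, and \<open>l2_closure_norm_le\<close> turns this into ||t|| <= ||s||.\<close>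

lemma interpolation_imp_psd:
  assumes f: "f \<in> bergman \<Omega>" and \<phi>: "\<phi> \<in> A" "\<And>x. cmod (\<phi> x) \<le> 1" "\<And>i. \<phi> (z i) = w i"
  shows "positive_semidefinite
      (\<chi> i j. (1 - w i * cnj (w j)) * repr_kernel A (weighted_measure \<Omega> f) (z i) (z j))"
  unfolding psd_iff[OF f]
proof
  fix c
  let ?\<nu> = "weighted_measure \<Omega> f"
  note k = finite_weighted[OF f] A_sub[OF f] A_subspace
  let ?s = "kernel_comb A ?\<nu> z c" and ?t = "kernel_comb A ?\<nu> z (\<lambda>i. cnj (w i) * c i)"
  show "l2_norm ?\<nu> ?t \<le> l2_norm ?\<nu> ?s"
  proof (rule l2_closure_norm_le[OF kernel_comb_closure[OF k] A_sub[OF f]])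
    fix \<psi> assume \<psi>: "\<psi> \<in> A"
    have "l2_inner ?\<nu> \<psi> ?t = l2_inner ?\<nu> (\<lambda>x. \<phi> x * \<psi> x) ?s"
      unfolding inner_kernel_comb[OF k \<psi>] inner_kernel_comb[OF k A_mult[OF \<phi>(1) \<psi>]]
      by (intro sum.cong refl) (simp add: \<phi>(3))
    moreover have \<psi>l: "\<psi> \<in> l2_space ?\<nu>" using A_sub[OF f] \<psi> by blast
    have "\<phi> \<in> borel_measurable ?\<nu>" using A_sub[OF f] \<phi>(1) l2_spaceD(1) by blast
    note m = l2_bounded_mult[OF \<psi>l this \<phi>(2)]
    have "cmod (l2_inner ?\<nu> (\<lambda>x. \<phi> x * \<psi> x) ?s) \<le> l2_norm ?\<nu> (\<lambda>x. \<phi> x * \<psi> x) * l2_norm ?\<nu> ?s"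
      by (rule l2_cauchy_schwarz[OF m(1) kernel_comb_l2[OF k]])
    also have "\<dots> \<le> l2_norm ?\<nu> ?s * l2_norm ?\<nu> \<psi>"
      using mult_right_mono[OF m(2), of "l2_norm ?\<nu> ?s"] by (simp add: mult.commute)
    ultimately show "cmod (l2_inner ?\<nu> \<psi> ?t) \<le> l2_norm ?\<nu> ?s * l2_norm ?\<nu> \<psi>" by simp
  qed simp
qed

text \<open>\<open>A\<close> need not separate the nodes; one index is selected from each class on
  which all functions in \<open>A\<close> agree. Indices of one class define the same predicate, so
  they receive the same representative.\<close>

definition rep :: "'n \<Rightarrow> 'n" where
  "rep i = (SOME j. \<forall>\<phi>\<in>A. \<phi> (z j) = \<phi> (z i))"

lemma rep_eval: "\<phi> \<in> A \<Longrightarrow> \<phi> (z (rep i)) = \<phi> (z i)"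
proof -
  have "\<exists>j. \<forall>\<phi>\<in>A. \<phi> (z j) = \<phi> (z i)" by blast
  from someI_ex[OF this] show "\<phi> \<in> A \<Longrightarrow> \<phi> (z (rep i)) = \<phi> (z i)" unfolding rep_def by blast
qed

lemma rep_eq: "(\<And>\<phi>. \<phi> \<in> A \<Longrightarrow> \<phi> (z i) = \<phi> (z j)) \<Longrightarrow> rep i = rep j"
proof -
  assume eq: "\<And>\<phi>. \<phi> \<in> A \<Longrightarrow> \<phi> (z i) = \<phi> (z j)"
  have "(\<lambda>k. \<forall>\<phi>\<in>A. \<phi> (z k) = \<phi> (z i)) = (\<lambda>k. \<forall>\<phi>\<in>A. \<phi> (z k) = \<phi> (z j))"
    by (intro ext ball_cong refl) (simp add: eq)
  then show ?thesis unfolding rep_def by (rule arg_cong)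
qed

lemma separating:
  assumes "r \<in> range rep" "finite R" "R \<subseteq> range rep" "r \<notin> R"
  shows "\<exists>\<phi>\<in>A. \<phi> (z r) = 1 \<and> (\<forall>r'\<in>R. \<phi> (z r') = 0)"
  using assms(2-4)
proof (induction R)
  case empty
  then show ?case using A_one z_in by (intro bexI[of _ "indicator \<Omega>"]) auto
next
  case (insert s R)
  then obtain \<phi> where \<phi>: "\<phi> \<in> A" "\<phi> (z r) = 1" "\<forall>r'\<in>R. \<phi> (z r') = 0" by auto
  obtain i j where ij: "r = rep i" "s = rep j" using assms(1) insert.prems by blast
  have "rep i \<noteq> rep j" using ij insert.prems by auto
  then obtain \<psi> where \<psi>: "\<psi> \<in> A" "\<psi> (z i) \<noteq> \<psi> (z j)" using rep_eq[of i j] by blast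
  then have ne: "\<psi> (z r) - \<psi> (z s) \<noteq> 0" using rep_eval[OF \<psi>(1)] ij by simp
  define \<theta> where "\<theta> x = (1 / (\<psi> (z r) - \<psi> (z s))) * (\<psi> x + (- \<psi> (z s)) * indicator \<Omega> x)" for x
  have \<theta>A: "\<theta> \<in> A" unfolding \<theta>_def by (intro A_scale A_add \<psi>(1) A_one)
  have "\<theta> (z r) = 1" "\<theta> (z s) = 0" using ne z_in by (auto simp: \<theta>_def)
  then show ?case using \<phi> A_mult[OF \<phi>(1) \<theta>A]
    by (intro bexI[of _ "\<lambda>x. \<phi> x * \<theta> x"]) auto
qed

text \<open>The functions are idempotent modulo the ideal of functions in \<open>A\<close> that
  vanish at all nodes; they split the finite-dimensional quotient into its points.\<close>

lemma idempotents:
  obtains e where "\<And>r. r \<in> range rep \<Longrightarrow> e r \<in> A"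
    "\<And>r r'. r \<in> range rep \<Longrightarrow> r' \<in> range rep \<Longrightarrow> e r (z r') = (if r' = r then 1 else 0)"
proof -
  have "\<forall>r\<in>range rep. \<exists>\<phi>. \<phi> \<in> A \<and> \<phi> (z r) = 1 \<and> (\<forall>r'\<in>range rep - {r}. \<phi> (z r') = 0)"
  proof
    fix r assume "r \<in> range rep"
    then have "\<exists>\<phi>\<in>A. \<phi> (z r) = 1 \<and> (\<forall>r'\<in>range rep - {r}. \<phi> (z r') = 0)"
      by (rule separating) auto
    then show "\<exists>\<phi>. \<phi> \<in> A \<and> \<phi> (z r) = 1 \<and> (\<forall>r'\<in>range rep - {r}. \<phi> (z r') = 0)" by blast
  qed
  from bchoice[OF this] obtain e where
    "\<forall>r\<in>range rep. e r \<in> A \<and> e r (z r) = 1 \<and> (\<forall>r'\<in>range rep - {r}. e r (z r') = 0)" by (elim exE)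
  then show thesis by (intro that[of e]) auto
qed

text \<open>The functional annihilates the functions vanishing at the nodes, so it is a combination
  of evaluations with coefficients b r. It is bounded by ||y|| in the norm of \<nu>, hence
  represented by a kernel combination s with ||s|| <= ||y||. Contractivity gives ||t|| <= ||y|| for
  the combination t weighted by cnj (w i), and the wanted value is <1, t>, where the constant 1 has
  norm ||x|| with respect to \<nu>.\<close>

lemma psd_imp_bound:
  assumes x: "x \<in> bergman \<Omega>" and y: "y \<in> l2_space \<mu>"
    and psd: "positive_semidefinite
      (\<chi> i j. (1 - w i * cnj (w j)) * repr_kernel A (weighted_measure \<Omega> x) (z i) (z j))"
    and ann: "\<And>\<phi>. \<phi> \<in> A \<Longrightarrow> (\<And>i. \<phi> (z i) = 0) \<Longrightarrow> l2_inner \<mu> (\<lambda>u. \<phi> u * x u) y = 0"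
    and \<phi>0: "\<phi>0 \<in> A" "\<And>i. \<phi>0 (z i) = w i"
  shows "cmod (l2_inner \<mu> (\<lambda>u. \<phi>0 u * x u) y) \<le> l2_norm \<mu> x * l2_norm \<mu> y"
proof -
  let ?\<nu> = "weighted_measure \<Omega> x"
  note k = finite_weighted[OF x] A_sub[OF x] A_subspace
  have xl: "x \<in> l2_space \<mu>" by (rule bergman_l2[OF x])
  define ell where "ell \<phi> = l2_inner \<mu> (\<lambda>u. \<phi> u * x u) y" for \<phi>
  have norm\<nu>: "l2_norm ?\<nu> \<phi> = l2_norm \<mu> (\<lambda>u. \<phi> u * x u)" if "\<phi> \<in> A" for \<phi>
    by (rule weighted_norm[OF x Hinf_measurable[OF A_Hinf[OF that]]])
  have ell_bd: "cmod (ell \<phi>) \<le> l2_norm \<mu> y * l2_norm ?\<nu> \<phi>" if "\<phi> \<in> A" for \<phi>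
    using l2_cauchy_schwarz[OF Hinf_mult_l2[OF A_Hinf[OF that] xl] y] norm\<nu>[OF that]
    by (simp add: ell_def mult.commute)
  obtain e where e: "\<And>r. r \<in> range rep \<Longrightarrow> e r \<in> A"
    "\<And>r r'. r \<in> range rep \<Longrightarrow> r' \<in> range rep \<Longrightarrow> e r (z r') = (if r' = r then 1 else 0)"
    using idempotents by blast
  define b where "b r = ell (e r)" for r
  have ell_eq: "ell \<phi> = (\<Sum>r\<in>range rep. \<phi> (z r) * b r)" if \<phi>: "\<phi> \<in> A" for \<phi>
  proof -
    let ?s = "\<lambda>u. \<Sum>r\<in>range rep. \<phi> (z r) * e r u"
    have s: "?s \<in> A" by (rule complex_subspace_sum[OF A_subspace e(1)])
    have "\<phi> (z i) - ?s (z i) = 0" for i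
    proof -
      have "?s (z i) = ?s (z (rep i))" using rep_eval[OF s, of i] by simp
      also have "\<dots> = (\<Sum>r\<in>range rep. if r = rep i then \<phi> (z r) else 0)"
        by (intro sum.cong refl) (auto simp: e(2))
      also have "\<dots> = \<phi> (z i)" using rep_eval[OF \<phi>, of i] by simp
      finally show ?thesis by simp
    qed
    then have "ell (\<lambda>u. \<phi> u - ?s u) = 0"
      unfolding ell_def by (intro ann complex_subspaceD(3)[OF A_subspace \<phi> s])
    moreover have "ell (\<lambda>u. \<phi> u - ?s u) = ell \<phi> - ell ?s"
      using Hinf_mult_l2[OF A_Hinf[OF \<phi>] xl] Hinf_mult_l2[OF A_Hinf[OF s] xl] y
      by (simp add: ell_def left_diff_distrib l2_inner_diff_left)
    moreover have "ell ?s = (\<Sum>r\<in>range rep. \<phi> (z r) * b r)"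
    proof -
      have "ell ?s = l2_inner \<mu> (\<lambda>u. \<Sum>r\<in>range rep. \<phi> (z r) * (e r u * x u)) y"
        by (simp add: ell_def sum_distrib_right mult.assoc)
      also have "\<dots> = (\<Sum>r\<in>range rep. l2_inner \<mu> (\<lambda>u. \<phi> (z r) * (e r u * x u)) y)"
        by (intro l2_inner_sum_left y l2_scale Hinf_mult_l2 A_Hinf e(1) xl)
      finally show ?thesis by (simp add: l2_inner_scale_left b_def ell_def)
    qed
    ultimately show ?thesis by simp
  qed
  \<comment> \<open>Multiplying by \<open>e r\<close> isolates one node: the functional at
    \<open>e r\<close> \<phi> equals \<phi>(z r) b r. So a nonzero coefficient forces a bounded
    evaluation, and the omitted nodes contribute nothing.\<close>
  have bdd: "bounded_evaluation A ?\<nu> (z r)" if r: "r \<in> range rep" "b r \<noteq> 0" for r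
  proof -
    obtain B where B: "B \<ge> 0" "\<And>u. cmod (e r u) \<le> B" using Hinf_bound[OF A_Hinf[OF e(1)[OF r(1)]]] by blast
    show ?thesis
    proof (rule bounded_evaluationI[OF k])
      show "0 \<le> l2_norm \<mu> y * B / cmod (b r)" using B by simp
      fix \<phi> assume \<phi>: "\<phi> \<in> A"
      note e\<phi> = A_mult[OF e(1)[OF r(1)] \<phi>]
      have "ell (\<lambda>u. e r u * \<phi> u) = (\<Sum>r'\<in>range rep. if r' = r then \<phi> (z r) * b r else 0)"
        unfolding ell_eq[OF e\<phi>] by (intro sum.cong refl) (auto simp: e(2) r(1))
      then have "cmod (\<phi> (z r)) * cmod (b r) = cmod (ell (\<lambda>u. e r u * \<phi> u))"
        using r(1) by (simp add: norm_mult)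
      also have "\<dots> \<le> l2_norm \<mu> y * l2_norm ?\<nu> (\<lambda>u. e r u * \<phi> u)" by (rule ell_bd[OF e\<phi>])
      also have "\<dots> \<le> l2_norm \<mu> y * (B * l2_norm ?\<nu> \<phi>)"
      proof (rule mult_left_mono)
        have "\<phi> \<in> l2_space ?\<nu>" "e r \<in> borel_measurable ?\<nu>"
          using A_sub[OF x] \<phi> e(1)[OF r(1)] l2_spaceD(1) by blast+
        then show "l2_norm ?\<nu> (\<lambda>u. e r u * \<phi> u) \<le> B * l2_norm ?\<nu> \<phi>" by (rule l2_bounded_mult(2)) (rule B)
      qed simp
      finally show "cmod (\<phi> (z r)) \<le> l2_norm \<mu> y * B / cmod (b r) * l2_norm ?\<nu> \<phi>"
        using r(2) by (simp add: field_simps)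
    qed
  qed
  \<comment> \<open>Only representatives get a coefficient, so identified nodes are counted once;
    the conjugate undoes the antilinearity of the second slot.\<close>
  define c where "c i = (if i \<in> range rep then cnj (b i) else 0)" for i
  have c_sum: "(\<Sum>i\<in>{i. bounded_evaluation A ?\<nu> (z i)}. g i * cnj (c i)) = (\<Sum>r\<in>range rep. g r * b r)" for g
  proof -
    have "(\<Sum>i\<in>{i. bounded_evaluation A ?\<nu> (z i)}. g i * cnj (c i)) = (\<Sum>i\<in>UNIV. g i * cnj (c i))"
      using bdd by (intro sum.mono_neutral_left) (auto simp: c_def)
    also have "\<dots> = (\<Sum>r\<in>range rep. g r * cnj (c r))"
      by (intro sum.mono_neutral_right) (auto simp: c_def)
    finally show ?thesis by (simp add: c_def)
  qed
  let ?s = "kernel_comb A ?\<nu> z c" and ?t = "kernel_comb A ?\<nu> z (\<lambda>i. cnj (w i) * c i)"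
  have "l2_norm ?\<nu> ?s \<le> l2_norm \<mu> y"
  proof (rule l2_closure_norm_le[OF kernel_comb_closure[OF k] A_sub[OF x]])
    fix \<phi> assume \<phi>: "\<phi> \<in> A"
    have "l2_inner ?\<nu> \<phi> ?s = ell \<phi>"
      unfolding inner_kernel_comb[OF k \<phi>] ell_eq[OF \<phi>] c_sum[of "\<lambda>i. \<phi> (z i)", symmetric] by (simp add: mult.commute)
    then show "cmod (l2_inner ?\<nu> \<phi> ?s) \<le> l2_norm \<mu> y * l2_norm ?\<nu> \<phi>" using ell_bd[OF \<phi>] by simp
  qed simp
  moreover have "l2_norm ?\<nu> ?t \<le> l2_norm ?\<nu> ?s" using psd unfolding psd_iff[OF x] by blast
  ultimately have t: "l2_norm ?\<nu> ?t \<le> l2_norm \<mu> y" by linarith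
  \<comment> \<open>Every interpolant has the values w r at representatives, and pairing 1 with t
    restores w r from the factor cnj (w r).\<close>
  have "ell \<phi>0 = (\<Sum>r\<in>range rep. w r * b r)" unfolding ell_eq[OF \<phi>0(1)] by (simp add: \<phi>0(2))
  also have "\<dots> = l2_inner ?\<nu> (indicator \<Omega>) ?t"
    unfolding inner_kernel_comb[OF k A_one] c_sum[of w, symmetric] using z_in by (intro sum.cong refl) simp
  finally have eq: "ell \<phi>0 = l2_inner ?\<nu> (indicator \<Omega>) ?t" .
  have one: "indicator \<Omega> \<in> l2_space ?\<nu>" using A_one A_sub[OF x] by blast
  have "l2_norm ?\<nu> (indicator \<Omega>) = l2_norm \<mu> x"
  proof -
    have "(\<lambda>u. indicator \<Omega> u * x u) = x" using bergmanD(3)[OF x] by (intro ext) (auto simp: indicator_def)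
    then show ?thesis using norm\<nu>[OF A_one] by simp
  qed
  then have "cmod (ell \<phi>0) \<le> l2_norm \<mu> x * l2_norm ?\<nu> ?t"
    unfolding eq using l2_cauchy_schwarz[OF one kernel_comb_l2[OF k]] by simp
  also have "\<dots> \<le> l2_norm \<mu> x * l2_norm \<mu> y" using t by (intro mult_left_mono) auto
  finally show ?thesis by (simp add: ell_def)
qed

text \<open>The Pick condition for f = 1, where every node has a bounded evaluation, forces equal
  targets at nodes that \<open>A\<close> identifies. A combination of the functions from
  \<open>idempotents\<close> then interpolates, without control of its norm.\<close>

lemma psd_imp_interpolant:
  assumes psd: "\<And>f. f \<in> bergman \<Omega> \<Longrightarrow> positive_semidefinite
      (\<chi> i j. (1 - w i * cnj (w j)) * repr_kernel A (weighted_measure \<Omega> f) (z i) (z j))"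
  obtains \<phi> where "\<phi> \<in> A" "\<And>i. \<phi> (z i) = w i"
proof -
  have one: "indicator \<Omega> \<in> bergman \<Omega>" using indicator_Hinf Hinf_subset_bergman by blast
  let ?\<nu> = "weighted_measure \<Omega> (indicator \<Omega>)"
  note k = finite_weighted[OF one] A_sub[OF one] A_subspace
  have bdd: "bounded_evaluation A ?\<nu> (z i)" for i
  proof -
    obtain r C where C: "r > 0" "C \<ge> 0"
      "\<And>f x. f \<in> bergman \<Omega> \<Longrightarrow> x \<in> cball (z i) (2 * r) \<Longrightarrow> cmod (f x) \<le> C * l2_norm \<mu> f"
      using bergman_local_bound[OF open_\<Omega> z_in[of i]] by metis
    show ?thesis
    proof (rule bounded_evaluationI[OF k C(2)])
      fix \<phi> assume \<phi>: "\<phi> \<in> A"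
      have "(\<lambda>u. \<phi> u * indicator \<Omega> u) = \<phi>" using A_Hinf[OF \<phi>] by (intro ext) (auto simp: indicator_def Hinf_def)
      then have "l2_norm ?\<nu> \<phi> = l2_norm \<mu> \<phi>" using weighted_norm[OF one Hinf_measurable[OF A_Hinf[OF \<phi>]]] by simp
      then show "cmod (\<phi> (z i)) \<le> C * l2_norm ?\<nu> \<phi>"
        using C(3)[of \<phi> "z i"] Hinf_subset_bergman A_Hinf[OF \<phi>] C(1) by auto
    qed
  qed
  have w_eq: "w i = w j" if ij: "\<And>\<phi>. \<phi> \<in> A \<Longrightarrow> \<phi> (z i) = \<phi> (z j)" for i j
  proof (cases "i = j")
    case False
    \<comment> \<open>For identified nodes the difference of their kernel vectors is null.
      Contractivity makes the combination weighted by cnj (w i) and cnj (w j) null too, and pairing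
      it with 1 yields w i - w j.\<close>
    define c where "c l = (if l = i then 1 else if l = j then - 1 else (0::complex))" for l
    have c_sum: "(\<Sum>l\<in>{i. bounded_evaluation A ?\<nu> (z i)}. cnj (g l * c l) * h l) = cnj (g i) * h i - cnj (g j) * h j" for g h
    proof -
      have "(\<Sum>l\<in>{i. bounded_evaluation A ?\<nu> (z i)}. cnj (g l * c l) * h l) = (\<Sum>l\<in>{i, j}. cnj (g l * c l) * h l)"
        using bdd by (intro sum.mono_neutral_right) (auto simp: c_def)
      then show ?thesis using False by (simp add: c_def)
    qed
    let ?s = "kernel_comb A ?\<nu> z c" and ?t = "kernel_comb A ?\<nu> z (\<lambda>i. cnj (w i) * c i)"
    have "l2_norm ?\<nu> ?s \<le> 0"
    proof (rule l2_closure_norm_le[OF kernel_comb_closure[OF k] A_sub[OF one]])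
      fix \<phi> assume \<phi>: "\<phi> \<in> A"
      have "l2_inner ?\<nu> \<phi> ?s = 0"
        unfolding inner_kernel_comb[OF k \<phi>] using c_sum[of "\<lambda>_. 1" "\<lambda>l. \<phi> (z l)"] ij[OF \<phi>] by simp
      then show "cmod (l2_inner ?\<nu> \<phi> ?s) \<le> 0 * l2_norm ?\<nu> \<phi>" by simp
    qed simp
    moreover have "l2_norm ?\<nu> ?t \<le> l2_norm ?\<nu> ?s" using psd[OF one] unfolding psd_iff[OF one] by blast
    ultimately have "l2_norm ?\<nu> ?t \<le> 0" by linarith
    then have 0: "l2_norm ?\<nu> ?t = 0" using l2_norm_nonneg[of ?\<nu> ?t] by linarith
    have "l2_inner ?\<nu> (indicator \<Omega>) ?t = w i - w j"
      unfolding inner_kernel_comb[OF k A_one] using c_sum[of "\<lambda>l. cnj (w l)" "\<lambda>l. indicator \<Omega> (z l)"] z_in by simp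
    moreover have "indicator \<Omega> \<in> l2_space ?\<nu>" using A_one A_sub[OF one] by blast
    note l2_cauchy_schwarz[OF this kernel_comb_l2[OF k, of z "\<lambda>i. cnj (w i) * c i"]]
    ultimately have "cmod (w i - w j) \<le> 0" using 0 by simp
    then show ?thesis by simp
  qed simp
  obtain e where e: "\<And>r. r \<in> range rep \<Longrightarrow> e r \<in> A"
    "\<And>r r'. r \<in> range rep \<Longrightarrow> r' \<in> range rep \<Longrightarrow> e r (z r') = (if r' = r then 1 else 0)"
    using idempotents by blast
  let ?s = "\<lambda>u. \<Sum>r\<in>range rep. w r * e r u"
  have s: "?s \<in> A" by (rule complex_subspace_sum[OF A_subspace e(1)])
  have "?s (z i) = w i" for i
  proof -
    have "?s (z i) = ?s (z (rep i))" using rep_eval[OF s, of i] by simp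
    also have "\<dots> = (\<Sum>r\<in>range rep. if r = rep i then w r else 0)"
      by (intro sum.cong refl) (auto simp: e(2))
    also have "\<dots> = w (rep i)" by simp
    also have "\<dots> = w i" by (rule w_eq) (rule rep_eval)
    finally show ?thesis .
  qed
  with s show thesis by (rule that)
qed

end

subsection \<open>The weak-star topology\<close>

context bounded_open
begin

lemma mult_op_apply: "f \<in> bergman \<Omega> \<Longrightarrow> mult_op \<Omega> \<phi> f = (\<lambda>z. \<phi> z * f z)"
  by (simp add: mult_op_def)

lemma mult_op_bergman_ops:
  assumes \<phi>: "\<phi> \<in> Hinf \<Omega>"
  shows "mult_op \<Omega> \<phi> \<in> bergman_ops \<Omega>"
proof -
  obtain B where B: "B \<ge> 0" "\<And>x. cmod (\<phi> x) \<le> B" using Hinf_bound[OF \<phi>] by blast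
  have "\<forall>f\<in>bergman \<Omega>. l2_norm \<mu> (mult_op \<Omega> \<phi> f) \<le> B * l2_norm \<mu> f"
    using l2_bounded_mult(2)[OF bergman_l2 Hinf_measurable[OF \<phi>] B(2)] by (simp add: mult_op_apply)
  moreover have "mult_op \<Omega> \<phi> \<in> bergman \<Omega> \<rightarrow>\<^sub>E bergman \<Omega>"
    unfolding mult_op_def using Hinf_mult_bergman[OF \<phi>] by (simp add: PiE_def Pi_def)
  moreover have "mult_op \<Omega> \<phi> (\<lambda>z. f z + g z) = (\<lambda>z. mult_op \<Omega> \<phi> f z + mult_op \<Omega> \<phi> g z)"
    if "f \<in> bergman \<Omega>" "g \<in> bergman \<Omega>" for f g
    using that complex_subspaceD(1)[OF bergman_subspace that] by (simp add: mult_op_apply distrib_left)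
  moreover have "mult_op \<Omega> \<phi> (\<lambda>z. c * f z) = (\<lambda>z. c * mult_op \<Omega> \<phi> f z)" if "f \<in> bergman \<Omega>" for c f
    using that complex_subspaceD(2)[OF bergman_subspace that that] by (simp add: mult_op_apply mult.left_commute)
  ultimately show ?thesis unfolding bergman_ops_def by blast
qed

lemma square_summableD:
  assumes "square_summable \<Omega> f"
  shows "f m \<in> bergman \<Omega>" "summable (\<lambda>m. (l2_norm \<mu> (f m))\<^sup>2)"
  using assms by (auto simp: square_summable_def)

text \<open>Collects the countably many norms ||D f m|| into one weighted norm of D. The local
  evaluation bound makes the series converge at every point, not merely almost everywhere, so h is
  nonnegative at every point as \<open>weights\<close> demands.\<close>

lemma square_summable_weight:
  assumes f: "square_summable \<Omega> f"
  defines "h \<equiv> \<lambda>x. \<Sum>m. (cmod (f m x))\<^sup>2"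
  shows "h \<in> weights"
    and "D \<in> Hinf \<Omega> \<Longrightarrow> (\<lambda>m. (l2_norm \<mu> (\<lambda>x. D x * f m x))\<^sup>2) sums (\<integral>x. h x * (cmod (D x))\<^sup>2 \<partial>\<mu>)"
proof -
  note fb = square_summableD(1)[OF f] and fs = square_summableD(2)[OF f]
  have sm: "summable (\<lambda>m. (cmod (f m x))\<^sup>2)" for x
  proof (cases "x \<in> \<Omega>")
    case True
    obtain r C where C: "r > 0" "C \<ge> 0"
      "\<And>g y. g \<in> bergman \<Omega> \<Longrightarrow> y \<in> cball x (2 * r) \<Longrightarrow> cmod (g y) \<le> C * l2_norm \<mu> g"
      using bergman_local_bound[OF open_\<Omega> True] by metis
    have "norm ((cmod (f m x))\<^sup>2) \<le> C\<^sup>2 * (l2_norm \<mu> (f m))\<^sup>2" for m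
      using power_mono[OF C(3)[OF fb[of m], of x], of 2] C(1) by (simp add: power_mult_distrib)
    then show ?thesis by (intro summable_comparison_test'[OF summable_mult[OF fs, of "C\<^sup>2"]])
  next
    case False
    then show ?thesis using bergmanD(3)[OF fb] by simp
  qed
  have int: "integrable \<mu> (\<lambda>x. (cmod (f m x))\<^sup>2)" for m by (rule l2_spaceD(2)[OF bergman_l2[OF fb]])
  have "integrable \<mu> h" unfolding h_def
    by (rule integrable_suminf[OF int]) (use sm fs in \<open>auto simp: l2_norm_power2[symmetric]\<close>)
  then show h: "h \<in> weights" using sm by (auto simp: weights_def h_def intro: suminf_nonneg)
  assume D: "D \<in> Hinf \<Omega>"
  obtain B where B: "B \<ge> 0" "\<And>x. cmod (D x) \<le> B" using Hinf_bound[OF D] by blast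
  have Df: "(\<lambda>x. D x * f m x) \<in> l2_space \<mu>" for m by (rule Hinf_mult_l2[OF D bergman_l2[OF fb]])
  have "(\<lambda>m. \<integral>x. (cmod (D x * f m x))\<^sup>2 \<partial>\<mu>) sums (\<integral>x. (\<Sum>m. (cmod (D x * f m x))\<^sup>2) \<partial>\<mu>)"
  proof (rule sums_integral)
    show "integrable \<mu> (\<lambda>x. (cmod (D x * f m x))\<^sup>2)" for m by (rule l2_spaceD(2)[OF Df])
    show "AE x in \<mu>. summable (\<lambda>m. norm ((cmod (D x * f m x))\<^sup>2))"
      using sm by (intro AE_I2) (simp add: norm_mult power_mult_distrib summable_mult)
    have "norm (\<integral>x. norm ((cmod (D x * f m x))\<^sup>2) \<partial>\<mu>) \<le> B\<^sup>2 * (l2_norm \<mu> (f m))\<^sup>2" for m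
      using power_mono[OF l2_bounded_mult(2)[OF bergman_l2[OF fb] Hinf_measurable[OF D] B(2)], of m 2]
      by (simp add: l2_norm_power2[symmetric] power_mult_distrib)
    then show "summable (\<lambda>m. \<integral>x. norm ((cmod (D x * f m x))\<^sup>2) \<partial>\<mu>)"
      by (intro summable_comparison_test'[OF summable_mult[OF fs, of "B\<^sup>2"]])
  qed
  moreover have "(\<Sum>m. (cmod (D x * f m x))\<^sup>2) = h x * (cmod (D x))\<^sup>2" for x
    using suminf_mult[OF sm, of "(cmod (D x))\<^sup>2" x] by (simp add: h_def norm_mult power_mult_distrib mult.commute)
  ultimately show "(\<lambda>m. (l2_norm \<mu> (\<lambda>x. D x * f m x))\<^sup>2) sums (\<integral>x. h x * (cmod (D x))\<^sup>2 \<partial>\<mu>)"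
    by (simp add: l2_norm_power2)
qed

text \<open>Cauchy-Schwarz separates the sequences: the g side contributes a constant, the f side
  the norm of \<phi> - \<psi> for the weight given by the sum of the |f m|^2.\<close>

lemma trace_functional_continuous:
  assumes \<phi>: "\<phi> \<in> Hinf \<Omega>" and f: "square_summable \<Omega> f" and g: "square_summable \<Omega> g"
    and V: "open V" "trace_functional \<Omega> f g (mult_op \<Omega> \<phi>) \<in> V"
  shows "\<exists>h\<in>weights. \<exists>e>0. \<forall>\<psi>\<in>Hinf \<Omega>. (\<integral>x. h x * (cmod (\<phi> x - \<psi> x))\<^sup>2 \<partial>\<mu>) \<le> e \<longrightarrow>
    trace_functional \<Omega> f g (mult_op \<Omega> \<psi>) \<in> V"
proof -
  note fb = square_summableD(1)[OF f] and gb = square_summableD(1)[OF g] and gs = square_summableD(2)[OF g]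
  note gl = bergman_l2[OF gb]
  obtain \<delta> where \<delta>: "\<delta> > 0" "ball (trace_functional \<Omega> f g (mult_op \<Omega> \<phi>)) \<delta> \<subseteq> V"
    using V open_contains_ball by blast
  define h where "h x = (\<Sum>m. (cmod (f m x))\<^sup>2)" for x
  note hw = square_summable_weight(1)[OF f, folded h_def] and hs = square_summable_weight(2)[OF f, folded h_def]
  define G where "G = (\<Sum>m. (l2_norm \<mu> (g m))\<^sup>2)"
  have G: "G \<ge> 0" unfolding G_def by (rule suminf_nonneg[OF gs]) simp
  \<comment> \<open>Balances the arithmetic-geometric mean inequality: the g side stays strictly
    below \<delta> / 2, and a weighted integral of at most \<delta> / \<tau> contributes at most
    \<delta> / 2.\<close>
  define \<tau> where "\<tau> = (G + 1) / \<delta>"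
  have \<tau>: "\<tau> > 0" "G / \<tau> < \<delta>" using G \<delta> by (auto simp: \<tau>_def field_simps)
  define t where "t \<psi> m = l2_inner \<mu> (\<lambda>x. \<psi> x * f m x) (g m)" for \<psi> m
  have trace: "trace_functional \<Omega> f g (mult_op \<Omega> \<psi>) = (\<Sum>m. t \<psi> m)" for \<psi>
    by (simp add: trace_functional_def t_def mult_op_apply fb)
  have amgm: "cmod (t D m) \<le> \<tau> / 2 * (l2_norm \<mu> (\<lambda>x. D x * f m x))\<^sup>2 + 1 / (2 * \<tau>) * (l2_norm \<mu> (g m))\<^sup>2"
    if "D \<in> Hinf \<Omega>" for D m
  proof -
    let ?a = "l2_norm \<mu> (\<lambda>x. D x * f m x)" and ?b = "l2_norm \<mu> (g m)"
    have "0 \<le> (\<tau> * ?a - ?b)\<^sup>2 / (2 * \<tau>)" using \<tau> by simp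
    also have "\<dots> = \<tau> / 2 * ?a\<^sup>2 + 1 / (2 * \<tau>) * ?b\<^sup>2 - ?a * ?b"
      using \<tau> by (simp add: power2_eq_square field_simps)
    finally show ?thesis
      unfolding t_def using l2_cauchy_schwarz[OF Hinf_mult_l2[OF that bergman_l2[OF fb]] gl] by (meson diff_ge_0_iff_ge order_trans)
  qed
  have rhs: "(\<lambda>m. \<tau> / 2 * (l2_norm \<mu> (\<lambda>x. D x * f m x))\<^sup>2 + 1 / (2 * \<tau>) * (l2_norm \<mu> (g m))\<^sup>2) sums
      (\<tau> / 2 * (\<integral>x. h x * (cmod (D x))\<^sup>2 \<partial>\<mu>) + 1 / (2 * \<tau>) * G)" if "D \<in> Hinf \<Omega>" for D
    unfolding G_def by (intro sums_add sums_mult hs[OF that] summable_sums gs)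
  have sumt: "summable (\<lambda>m. cmod (t D m))" if D: "D \<in> Hinf \<Omega>" for D
    by (rule summable_comparison_test'[OF sums_summable[OF rhs[OF D]]]) (use amgm[OF D] in simp)
  have "trace_functional \<Omega> f g (mult_op \<Omega> \<psi>) \<in> V"
    if \<psi>: "\<psi> \<in> Hinf \<Omega>" and small: "(\<integral>x. h x * (cmod (\<phi> x - \<psi> x))\<^sup>2 \<partial>\<mu>) \<le> \<delta> / \<tau>" for \<psi>
  proof -
    have D: "(\<lambda>x. \<phi> x - \<psi> x) \<in> Hinf \<Omega>" by (rule Hinf_diff[OF \<phi> \<psi>])
    have "t \<phi> m - t \<psi> m = t (\<lambda>x. \<phi> x - \<psi> x) m" for m
      unfolding t_def left_diff_distrib
      by (rule l2_inner_diff_left[symmetric]) (intro Hinf_mult_l2 \<phi> \<psi> bergman_l2 fb gl)+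
    then have "(\<Sum>m. t \<phi> m) - (\<Sum>m. t \<psi> m) = (\<Sum>m. t (\<lambda>x. \<phi> x - \<psi> x) m)"
      using suminf_diff[OF summable_norm_cancel[OF sumt[OF \<phi>]] summable_norm_cancel[OF sumt[OF \<psi>]]] by simp
    then have "dist (\<Sum>m. t \<phi> m) (\<Sum>m. t \<psi> m) \<le> (\<Sum>m. cmod (t (\<lambda>x. \<phi> x - \<psi> x) m))"
      using summable_norm[OF sumt[OF D]] by (simp add: dist_norm)
    also have "\<dots> \<le> \<tau> / 2 * (\<integral>x. h x * (cmod (\<phi> x - \<psi> x))\<^sup>2 \<partial>\<mu>) + 1 / (2 * \<tau>) * G"
      using suminf_le[OF amgm[OF D] sumt[OF D] sums_summable[OF rhs[OF D]]] sums_unique[OF rhs[OF D]] by simp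
    also have "\<dots> \<le> \<tau> / 2 * (\<delta> / \<tau>) + 1 / (2 * \<tau>) * G"
      using small \<tau> by (intro add_right_mono mult_left_mono) auto
    also have "\<dots> < \<delta>" using \<tau> by (simp add: field_simps)
    finally have "dist (\<Sum>m. t \<phi> m) (\<Sum>m. t \<psi> m) < \<delta>" .
    then show ?thesis using \<delta>(2) by (auto simp: trace)
  qed
  moreover have "\<delta> / \<tau> > 0" using \<delta> \<tau> by simp
  ultimately show ?thesis using hw by blast
qed

text \<open>Every weak-star neighbourhood of \<phi> contains a ball for some weighted norm, so
  approximation in all weighted norms reaches the closure.\<close>

lemma weak_star_closed:
  assumes cl: "closedin (weak_star_Hinf \<Omega>) A" and \<phi>: "\<phi> \<in> Hinf \<Omega>" and A: "A \<subseteq> Hinf \<Omega>"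
    and approx: "\<And>h e. h \<in> weights \<Longrightarrow> e > 0 \<Longrightarrow> \<exists>\<psi>\<in>A. (\<integral>x. h x * (cmod (\<phi> x - \<psi> x))\<^sup>2 \<partial>\<mu>) \<le> e"
  shows "\<phi> \<in> A"
proof (rule ccontr)
  assume nA: "\<phi> \<notin> A"
  let ?S = "{{T \<in> bergman_ops \<Omega>. trace_functional \<Omega> f g T \<in> U} | f g U.
    square_summable \<Omega> f \<and> square_summable \<Omega> g \<and> open U}"
  have zero: "square_summable \<Omega> (\<lambda>m x. 0)"
    using bergman_subspace[of \<Omega>] by (simp add: square_summable_def complex_subspace_def)
  \<comment> \<open>Zero sequences and U = UNIV give the whole operator space as a generator; hence
    multiplication operators are points of the topological space.\<close>
  have "bergman_ops \<Omega> \<in> ?S" using zero open_UNIV by blast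
  then have "mult_op \<Omega> \<phi> \<in> topspace (weak_star_ops \<Omega>)"
    unfolding weak_star_ops_def topology_generated_by_topspace using mult_op_bergman_ops[OF \<phi>] by blast
  then have top: "\<phi> \<in> topspace (weak_star_Hinf \<Omega>)"
    unfolding weak_star_Hinf_def topspace_pullback_topology using \<phi> by blast
  have "openin (weak_star_Hinf \<Omega>) (topspace (weak_star_Hinf \<Omega>) - A)" using cl by (simp add: closedin_def)
  then obtain U where U: "openin (weak_star_ops \<Omega>) U"
    "topspace (weak_star_Hinf \<Omega>) - A = mult_op \<Omega> -` U \<inter> Hinf \<Omega>"
    unfolding weak_star_Hinf_def openin_pullback_topology by blast
  have gen: "generate_topology_on ?S U"
    using U(1) unfolding weak_star_ops_def by (rule openin_topology_generated_by)
  \<comment> \<open>Induction on the generation of the topology: intersections are met by adding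
    weights, unions by the member containing the operator.\<close>
  have nbhd: "mult_op \<Omega> \<phi> \<in> W \<Longrightarrow> \<exists>h\<in>weights. \<exists>e>0. \<forall>\<psi>\<in>Hinf \<Omega>.
      (\<integral>x. h x * (cmod (\<phi> x - \<psi> x))\<^sup>2 \<partial>\<mu>) \<le> e \<longrightarrow> mult_op \<Omega> \<psi> \<in> W" if "generate_topology_on ?S W" for W
    using that
  proof (induction W rule: generate_topology_on.induct)
    case Empty
    then show ?case by simp
  next
    case (Int a b)
    obtain h e where h: "h \<in> weights" "e > 0" "\<And>\<psi>. \<psi> \<in> Hinf \<Omega> \<Longrightarrow>
        (\<integral>x. h x * (cmod (\<phi> x - \<psi> x))\<^sup>2 \<partial>\<mu>) \<le> e \<Longrightarrow> mult_op \<Omega> \<psi> \<in> a" using Int by blast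
    obtain k d where k: "k \<in> weights" "d > 0" "\<And>\<psi>. \<psi> \<in> Hinf \<Omega> \<Longrightarrow>
        (\<integral>x. k x * (cmod (\<phi> x - \<psi> x))\<^sup>2 \<partial>\<mu>) \<le> d \<Longrightarrow> mult_op \<Omega> \<psi> \<in> b" using Int by blast
    have "mult_op \<Omega> \<psi> \<in> a \<inter> b"
      if \<psi>: "\<psi> \<in> Hinf \<Omega>" and small: "(\<integral>x. (h x + k x) * (cmod (\<phi> x - \<psi> x))\<^sup>2 \<partial>\<mu>) \<le> min e d" for \<psi>
    proof -
      note D = Hinf_diff[OF \<phi> \<psi>]
      have i: "integrable \<mu> (\<lambda>x. h x * (cmod (\<phi> x - \<psi> x))\<^sup>2)" "integrable \<mu> (\<lambda>x. k x * (cmod (\<phi> x - \<psi> x))\<^sup>2)"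
        using dens_integrable[OF h(1) Hinf_dens_l2[OF h(1) D]] dens_integrable[OF k(1) Hinf_dens_l2[OF k(1) D]] by auto
      have nn: "0 \<le> (\<integral>x. h x * (cmod (\<phi> x - \<psi> x))\<^sup>2 \<partial>\<mu>)" "0 \<le> (\<integral>x. k x * (cmod (\<phi> x - \<psi> x))\<^sup>2 \<partial>\<mu>)"
        using h(1) k(1) by (auto intro!: integral_nonneg_AE simp: weights_def)
      have "(\<integral>x. (h x + k x) * (cmod (\<phi> x - \<psi> x))\<^sup>2 \<partial>\<mu>) =
          (\<integral>x. h x * (cmod (\<phi> x - \<psi> x))\<^sup>2 \<partial>\<mu>) + (\<integral>x. k x * (cmod (\<phi> x - \<psi> x))\<^sup>2 \<partial>\<mu>)"
        using i by (simp add: distrib_right)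
      then show ?thesis using h(3)[OF \<psi>] k(3)[OF \<psi>] nn small by auto
    qed
    then show ?case using weights_add[OF h(1) k(1)] h(2) k(2)
      by (intro bexI[of _ "\<lambda>x. h x + k x"] exI[of _ "min e d"]) auto
  next
    case (UN K)
    then obtain k where k: "k \<in> K" "mult_op \<Omega> \<phi> \<in> k" by blast
    from UN.IH[OF k] k(1) show ?case by blast
  next
    case (Basis s)
    then obtain f g V where s: "s = {T \<in> bergman_ops \<Omega>. trace_functional \<Omega> f g T \<in> V}"
      "square_summable \<Omega> f" "square_summable \<Omega> g" "open V" by blast
    have "trace_functional \<Omega> f g (mult_op \<Omega> \<phi>) \<in> V" using Basis s(1) by blast
    from trace_functional_continuous[OF \<phi> s(2-4) this] show ?case
      unfolding s(1) using mult_op_bergman_ops by blast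
  qed
  have "mult_op \<Omega> \<phi> \<in> U" using top nA U(2) by blast
  from nbhd[OF gen this] obtain h e where h: "h \<in> weights" "e > 0" "\<And>\<psi>. \<psi> \<in> Hinf \<Omega> \<Longrightarrow>
      (\<integral>x. h x * (cmod (\<phi> x - \<psi> x))\<^sup>2 \<partial>\<mu>) \<le> e \<Longrightarrow> mult_op \<Omega> \<psi> \<in> U" by blast
  obtain \<psi> where \<psi>: "\<psi> \<in> A" "(\<integral>x. h x * (cmod (\<phi> x - \<psi> x))\<^sup>2 \<partial>\<mu>) \<le> e" using approx[OF h(1,2)] by blast
  then have "\<psi> \<in> mult_op \<Omega> -` U \<inter> Hinf \<Omega>" using h(3) A by blast
  then show False using U(2) \<psi>(1) by blast
qed

end

subsection \<open>Separation and compactness\<close>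

context bounded_open
begin

text \<open>The set where the continuous f exceeds c is open, and nonempty open sets have positive
  measure.\<close>

lemma AE_le_imp_le:
  assumes "continuous_on \<Omega> f" and "AE x in \<mu>. f x \<le> (c::real)" and x: "x \<in> \<Omega>"
  shows "f x \<le> c"
proof (rule ccontr)
  assume n: "\<not> f x \<le> c"
  define U where "U = \<Omega> \<inter> f -` {c<..}"
  have U: "open U" unfolding U_def by (rule continuous_open_preimage[OF assms(1) open_\<Omega>]) auto
  moreover have "x \<in> U" using n x by (simp add: U_def)
  ultimately obtain e where e: "e > 0" "ball x e \<subseteq> U" using open_contains_ball by blast
  have sub: "ball x e \<subseteq> \<Omega>" using e(2) by (auto simp: U_def)
  have bs: "ball x e \<in> sets \<mu>"
    using sub sets_\<Omega> by (simp add: sets_restrict_space_iff)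
  have "AE y in \<mu>. y \<notin> ball x e" using assms(2) by eventually_elim (use e(2) in \<open>auto simp: U_def\<close>)
  then have "emeasure \<mu> (ball x e) = 0" using sub by (subst (asm) AE_iff_measurable[OF bs]) auto
  moreover have "emeasure \<mu> (ball x e) = emeasure lebesgue (ball x e)"
    using e(2) sets_\<Omega> by (intro emeasure_restrict_space) (auto simp: U_def)
  ultimately have "measure lborel (ball x e) = 0" by (simp add: measure_def)
  then show False using content_ball_pos[OF e(1), of x] by simp
qed

lemma dens_norm_mono:
  assumes h: "h \<in> weights" and k: "k \<in> weights" "\<And>x. h x \<le> k x"
    and g: "g \<in> borel_measurable \<mu>" "\<And>x. cmod (g x) \<le> B"
  shows "l2_norm (dens h) g \<le> l2_norm (dens k) g"
proof (rule power2_le_imp_le)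
  show "(l2_norm (dens h) g)\<^sup>2 \<le> (l2_norm (dens k) g)\<^sup>2"
    unfolding dens_norm_power2[OF h g(1)] dens_norm_power2[OF k(1) g(1)]
    using dens_integrable[OF h dens_l2_bounded[OF h g]] dens_integrable[OF k(1) dens_l2_bounded[OF k(1) g]] k(2)
    by (intro integral_mono mult_right_mono) auto
qed simp

text \<open>A weight may be unbounded, so convergence in L^2(\<mu>) alone says nothing about the
  weighted norm. The uniform bound 1 helps: an almost everywhere convergent subsequence is dominated
  by 4 h, as the differences have modulus at most 2.\<close>

lemma dens_limit:
  assumes h: "h \<in> weights" and d: "\<And>n. d n \<in> borel_measurable \<mu>" "\<And>n x. cmod (d n x) \<le> 1"
    and g: "g \<in> l2_space \<mu>" "(\<lambda>n. l2_norm \<mu> (\<lambda>x. d n x - g x)) \<longlonglongrightarrow> 0"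
  shows "AE x in \<mu>. cmod (g x) \<le> 1"
    and "\<exists>r :: nat \<Rightarrow> nat. strict_mono r \<and> (\<lambda>n. \<integral>x. h x * (cmod (g x - d (r n) x))\<^sup>2 \<partial>\<mu>) \<longlonglongrightarrow> 0"
proof -
  have dl: "d n \<in> l2_space \<mu>" for n by (rule l2_finite_bounded[OF finite_\<mu> d])
  obtain r :: "nat \<Rightarrow> nat" where r: "strict_mono r" "AE x in \<mu>. (\<lambda>n. d (r n) x) \<longlonglongrightarrow> g x"
    using l2_AE_subseq[OF dl g] by blast
  show g1: "AE x in \<mu>. cmod (g x) \<le> 1"
    using r(2)
  proof eventually_elim
    case (elim x)
    show ?case by (rule LIMSEQ_le_const2[OF tendsto_norm[OF elim]]) (use d(2) in auto)
  qed
  have [measurable]: "g \<in> borel_measurable \<mu>" "d n \<in> borel_measurable \<mu>" "h \<in> borel_measurable \<mu>" for n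
    using g(1) d(1) h by (auto dest: l2_spaceD simp: weights_def)
  have "(\<lambda>n. \<integral>x. h x * (cmod (g x - d (r n) x))\<^sup>2 \<partial>\<mu>) \<longlonglongrightarrow> (\<integral>x. 0 \<partial>\<mu>)"
  proof (rule integral_dominated_convergence[where w = "\<lambda>x. 4 * h x"])
    show "integrable \<mu> (\<lambda>x. 4 * h x)" using h by (simp add: weights_def)
    show "AE x in \<mu>. (\<lambda>n. h x * (cmod (g x - d (r n) x))\<^sup>2) \<longlonglongrightarrow> 0"
      using r(2)
    proof eventually_elim
      case (elim x)
      have "(\<lambda>n. h x * (cmod (g x - d (r n) x))\<^sup>2) \<longlonglongrightarrow> h x * (cmod (g x - g x))\<^sup>2"
        by (intro tendsto_intros elim)
      then show ?case by simp
    qed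
    show "AE x in \<mu>. norm (h x * (cmod (g x - d (r n) x))\<^sup>2) \<le> 4 * h x" for n
      using g1
    proof eventually_elim
      case (elim x)
      have "cmod (g x - d (r n) x) \<le> 2" using norm_triangle_ineq4[of "g x" "d (r n) x"] elim d(2)[of "r n" x] by linarith
      then have "(cmod (g x - d (r n) x))\<^sup>2 \<le> 4" using power_mono[of "cmod (g x - d (r n) x)" 2 2] by simp
      moreover have "h x \<ge> 0" using h by (simp add: weights_def)
      ultimately show ?case using mult_left_mono[of "(cmod (g x - d (r n) x))\<^sup>2" 4 "h x"] by (simp add: abs_mult mult.commute)
    qed
  qed measurable
  then show "\<exists>r :: nat \<Rightarrow> nat. strict_mono r \<and> (\<lambda>n. \<integral>x. h x * (cmod (g x - d (r n) x))\<^sup>2 \<partial>\<mu>) \<longlonglongrightarrow> 0"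
    using r(1) by auto
qed

text \<open>Merely measurable functions: the extremal element for a separating functional is a sign
  function.\<close>

definition unit_ball :: "(complex^'d \<Rightarrow> complex) set" where
  "unit_ball = {d \<in> borel_measurable \<mu>. \<forall>x. cmod (d x) \<le> 1}"

lemma unit_ball_convex:
  assumes "d \<in> unit_ball" "d' \<in> unit_ball" "0 \<le> t" "t \<le> 1"
  shows "(\<lambda>x. d x + complex_of_real t * (d' x - d x)) \<in> unit_ball"
proof -
  have [measurable]: "d \<in> borel_measurable \<mu>" "d' \<in> borel_measurable \<mu>" using assms by (auto simp: unit_ball_def)
  have "cmod (d x + complex_of_real t * (d' x - d x)) \<le> 1" for x
  proof -
    have "d x + complex_of_real t * (d' x - d x) = complex_of_real (1 - t) * d x + complex_of_real t * d' x"
      by (simp add: algebra_simps)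
    also have "cmod \<dots> \<le> (1 - t) * cmod (d x) + t * cmod (d' x)"
      using norm_triangle_ineq[of "complex_of_real (1 - t) * d x" "complex_of_real t * d' x"] assms(3,4)
      by (simp add: norm_mult del: of_real_diff)
    also have "\<dots> \<le> (1 - t) * 1 + t * 1"
      using assms by (intro add_mono mult_left_mono) (auto simp: unit_ball_def)
    finally show ?thesis by simp
  qed
  then show ?thesis by (simp add: unit_ball_def)
qed

end

context pick_data
begin

definition interpolants :: "('n \<Rightarrow> complex) \<Rightarrow> (complex^'d \<Rightarrow> complex) set" where
  "interpolants w = {\<psi> \<in> A. \<forall>i. \<psi> (z i) = w i}"

lemma interpolants_convex:
  "\<psi> \<in> interpolants w \<Longrightarrow> \<psi>' \<in> interpolants w \<Longrightarrow> (\<lambda>x. \<psi> x + c * (\<psi>' x - \<psi> x)) \<in> interpolants w"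
  using complex_subspaceD(3)[OF A_subspace, of \<psi>' \<psi>] by (auto simp: interpolants_def intro!: A_add A_scale)

text \<open>If the distance were positive, separating the two convex sets in the weighted space would
  give a functional annihilating the functions in \<open>A\<close> that vanish at the nodes, with too large a
  value on the interpolants. Written as a vector functional it contradicts the Pick condition.\<close>

lemma unit_ball_near_interpolants:
  assumes psd: "\<And>f. f \<in> bergman \<Omega> \<Longrightarrow> positive_semidefinite
      (\<chi> i j. (1 - w i * cnj (w j)) * repr_kernel A (weighted_measure \<Omega> f) (z i) (z j))"
    and h: "h \<in> weights" and e: "e > 0"
  shows "\<exists>d\<in>unit_ball. \<exists>\<psi>\<in>interpolants w. l2_norm (dens h) (\<lambda>x. d x - \<psi> x) < e"
proof (rule ccontr)
  assume neg: "\<not> ?thesis"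
  let ?M = "dens h"
  note fin = finite_dens[OF h]
  define S where "S = {(\<lambda>x. d x - \<psi> x) | d \<psi>. d \<in> unit_ball \<and> \<psi> \<in> interpolants w}"
  have S_I: "(\<lambda>x. a x - b x) \<in> S" if "a \<in> unit_ball" "b \<in> interpolants w" for a b
    using that unfolding S_def by blast
  obtain \<phi>0 where \<phi>0: "\<phi>0 \<in> interpolants w"
    using psd_imp_interpolant[OF psd] by (auto simp: interpolants_def)
  have ball_l2: "d \<in> l2_space ?M" if "d \<in> unit_ball" for d
    using that dens_l2_bounded[OF h, of d 1] by (simp add: unit_ball_def)
  have int_l2: "\<psi> \<in> l2_space ?M" if "\<psi> \<in> interpolants w" for \<psi>
    using that Hinf_dens_l2[OF h A_Hinf] by (simp add: interpolants_def)
  have S_sub: "S \<subseteq> l2_space ?M" using ball_l2 int_l2 by (auto simp: S_def)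
  have zero: "(\<lambda>x. 0) \<in> unit_ball" by (simp add: unit_ball_def)
  have "\<exists>v\<in>l2_closure ?M S. \<forall>g\<in>S. (l2_norm ?M v)\<^sup>2 \<le> Re (l2_inner ?M g v)"
  proof (rule l2_min_norm[OF fin S_sub])
    show "S \<noteq> {}" using zero \<phi>0 by (auto simp: S_def)
    fix g k t assume "g \<in> S" "k \<in> S" and t: "0 \<le> t" "t \<le> (1::real)"
    then obtain d d' \<psi> \<psi>' where eq: "g = (\<lambda>x. d x - \<psi> x)" "k = (\<lambda>x. d' x - \<psi>' x)"
      and m: "d \<in> unit_ball" "d' \<in> unit_ball" "\<psi> \<in> interpolants w" "\<psi>' \<in> interpolants w"
      by (auto simp: S_def)
    have "(\<lambda>x. g x + complex_of_real t * (k x - g x)) =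
        (\<lambda>x. (d x + complex_of_real t * (d' x - d x)) - (\<psi> x + complex_of_real t * (\<psi>' x - \<psi> x)))"
      unfolding eq by (simp add: algebra_simps)
    then show "(\<lambda>x. g x + complex_of_real t * (k x - g x)) \<in> S"
      using S_I[OF unit_ball_convex[OF m(1,2) t] interpolants_convex[OF m(3,4), of "complex_of_real t"]] by simp
  qed
  then obtain v where v: "v \<in> l2_closure ?M S" "\<And>g. g \<in> S \<Longrightarrow> (l2_norm ?M v)\<^sup>2 \<le> Re (l2_inner ?M g v)" by blast
  have vl: "v \<in> l2_space ?M" using v(1) l2_closure_subset by blast
  have vm: "v \<in> borel_measurable \<mu>" using l2_spaceD(1)[OF vl] by (simp add: dens_measurable)
  obtain s where s: "\<And>n. s n \<in> S" "(\<lambda>n. l2_norm ?M (\<lambda>x. s n x - v x)) \<longlonglongrightarrow> 0"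
    using l2_closureD[OF v(1) S_sub] by blast
  have "e \<le> l2_norm ?M v"
  proof (rule LIMSEQ_le_const)
    show "(\<lambda>n. l2_norm ?M (s n)) \<longlonglongrightarrow> l2_norm ?M v"
      by (rule l2_norm_tendsto[OF _ vl s(2)]) (use s(1) S_sub in blast)
    have "e \<le> l2_norm ?M (s n)" for n
    proof -
      obtain d \<psi> where "s n = (\<lambda>x. d x - \<psi> x)" "d \<in> unit_ball" "\<psi> \<in> interpolants w"
        using s(1)[of n] by (auto simp: S_def)
      then show ?thesis using neg by (auto simp: not_less)
    qed
    then show "\<exists>N. \<forall>n\<ge>N. e \<le> l2_norm ?M (s n)" by blast
  qed
  then have vpos: "(l2_norm ?M v)\<^sup>2 > 0" using e by simp
  \<comment> \<open>Subtracting c j from an interpolant gives another one for every complex c, so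
    the real part of c <j, v> is bounded below and <j, v> must be 0.\<close>
  have orth: "l2_inner ?M j v = 0" if j: "j \<in> A" "\<And>i. j (z i) = 0" for j
  proof (rule Re_bounded_below_imp_zero)
    fix c
    have jl: "j \<in> l2_space ?M" by (rule Hinf_dens_l2[OF h A_Hinf[OF j(1)]])
    have "(\<lambda>x. \<phi>0 x + (- c) * j x) \<in> interpolants w"
      using \<phi>0 j A_add[OF _ A_scale[OF j(1)], of \<phi>0 "- c"] by (auto simp: interpolants_def)
    then have "(\<lambda>x. 0 - (\<phi>0 x + (- c) * j x)) \<in> S" by (rule S_I[OF zero])
    from v(2)[OF this]
    have "(l2_norm ?M v)\<^sup>2 \<le> Re (l2_inner ?M (\<lambda>x. c * j x - \<phi>0 x) v)" by simp
    also have "l2_inner ?M (\<lambda>x. c * j x - \<phi>0 x) v = c * l2_inner ?M j v - l2_inner ?M \<phi>0 v"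
      using jl int_l2[OF \<phi>0] vl by (simp add: l2_inner_diff_left l2_inner_scale_left l2_scale)
    finally show "(l2_norm ?M v)\<^sup>2 \<le> Re (- l2_inner ?M \<phi>0 v + c * l2_inner ?M j v)" by simp
  qed
  \<comment> \<open>The density with respect to \<mu> of pairing with v in the weighted space. It is
    integrable even if v is not square integrable for \<mu>.\<close>
  define q where "q x = complex_of_real (h x) * cnj (v x)" for x
  have cm: "(\<lambda>x. cnj (v x)) \<in> borel_measurable \<mu>"
    using borel_measurable_continuous_onI[of cnj] vm
    by (rule measurable_compose[rotated]) (intro continuous_intros)
  have hm: "h \<in> borel_measurable \<mu>" "\<And>x. h x \<ge> 0" using h by (auto simp: weights_def)
  have hv: "integrable \<mu> (\<lambda>x. h x * cmod (v x))"
  proof -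
    have "integrable ?M (\<lambda>x. cmod (v x))" using integrable_norm[OF integrable_l2(1)[OF fin vl]] .
    then show ?thesis using hm vm by (subst (asm) integrable_density) auto
  qed
  have "q \<in> borel_measurable \<mu>"
    unfolding q_def using hm cm by (intro borel_measurable_times borel_measurable_of_real) auto
  then have qi: "integrable \<mu> q"
    by (rule Bochner_Integration.integrable_bound[OF hv]) (use hm in \<open>auto simp: q_def norm_mult intro!: AE_I2\<close>)
  have ql: "l1_norm q = (\<integral>x. h x * cmod (v x) \<partial>\<mu>)"
    using hm by (simp add: l1_norm_def q_def norm_mult)
  have pair: "pairing q \<psi> = l2_inner ?M \<psi> v" if "\<psi> \<in> Hinf \<Omega>" for \<psi>
    unfolding dens_inner[OF h Hinf_measurable[OF that] vm] by (simp add: pairing_def q_def mult.left_commute)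
  have big: "(l2_norm ?M v)\<^sup>2 + l1_norm q \<le> cmod (pairing q \<phi>0)"
  proof -
    \<comment> \<open>Minimises the real part of <d, v> over the unit ball; the minimum is minus the
      L^1 norm of q.\<close>
    define d where "d x = - sgn (v x)" for x
    have dm: "d \<in> borel_measurable \<mu>" unfolding d_def using vm by measurable
    have d1: "cmod (d x) \<le> 1" for x by (simp add: d_def norm_sgn)
    have db: "d \<in> unit_ball" using dm d1 by (simp add: unit_ball_def)
    have "l2_inner ?M d v = (\<integral>x. complex_of_real (- (h x * cmod (v x))) \<partial>\<mu>)"
      unfolding dens_inner[OF h dm vm]
    proof (rule Bochner_Integration.integral_cong[OF refl])
      fix x
      have "sgn (v x) * cnj (v x) = complex_of_real (cmod (v x))"
        by (cases "v x = 0") (simp_all add: sgn_div_norm scaleR_conv_of_real complex_norm_square[symmetric] power2_eq_square field_simps)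
      then show "complex_of_real (h x) * (d x * cnj (v x)) = complex_of_real (- (h x * cmod (v x)))"
        by (simp add: d_def)
    qed
    also have "\<dots> = complex_of_real (- l1_norm q)" unfolding ql by (subst integral_complex_of_real) simp
    finally have dv: "l2_inner ?M d v = complex_of_real (- l1_norm q)" .
    have "(\<lambda>x. d x - \<phi>0 x) \<in> S" by (rule S_I[OF db \<phi>0])
    from v(2)[OF this] have "(l2_norm ?M v)\<^sup>2 \<le> - l1_norm q - Re (l2_inner ?M \<phi>0 v)"
      using ball_l2[OF db] int_l2[OF \<phi>0] vl by (simp add: l2_inner_diff_left dv)
    moreover have "- Re (l2_inner ?M \<phi>0 v) \<le> cmod (l2_inner ?M \<phi>0 v)"
      using abs_Re_le_cmod[of "l2_inner ?M \<phi>0 v"] by linarith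
    moreover have "pairing q \<phi>0 = l2_inner ?M \<phi>0 v"
      by (rule pair) (use \<phi>0 A_Hinf in \<open>auto simp: interpolants_def\<close>)
    ultimately show ?thesis by simp
  qed
  have "\<Omega> \<noteq> {}" using z_in by auto
  \<comment> \<open>The factorization may lose half of the separation gap and still contradict
    it.\<close>
  obtain x y where xy: "x \<in> bergman \<Omega>" "y \<in> bergman \<Omega>"
    and fac: "\<And>\<psi>. \<psi> \<in> Hinf \<Omega> \<Longrightarrow> pairing q \<psi> = l2_inner \<mu> (\<lambda>u. \<psi> u * x u) y"
    and nrm: "l2_norm \<mu> x * l2_norm \<mu> y \<le> l1_norm q + (l2_norm ?M v)\<^sup>2 / 2"
    by (rule pairing_factorization[OF qi half_gt_zero[OF vpos] \<open>\<Omega> \<noteq> {}\<close>]) (rule that)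
  have "cmod (l2_inner \<mu> (\<lambda>u. \<phi>0 u * x u) y) \<le> l2_norm \<mu> x * l2_norm \<mu> y"
  proof (rule psd_imp_bound[OF xy(1) bergman_l2[OF xy(2)] psd[OF xy(1)]])
    show "l2_inner \<mu> (\<lambda>u. \<phi> u * x u) y = 0" if "\<phi> \<in> A" "\<And>i. \<phi> (z i) = 0" for \<phi>
      using fac[OF A_Hinf[OF that(1)]] pair[OF A_Hinf[OF that(1)]] orth[OF that] by simp
  qed (use \<phi>0 in \<open>auto simp: interpolants_def\<close>)
  moreover have "pairing q \<phi>0 = l2_inner \<mu> (\<lambda>u. \<phi>0 u * x u) y"
    by (rule fac) (use \<phi>0 A_Hinf in \<open>auto simp: interpolants_def\<close>)
  ultimately show False using big nrm vpos by simp
qed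

text \<open>The sets \<open>K h e\<close> shrink when weights are added and tolerances lowered, so
  they are directed. All lie in the unit ball, a bounded set in the single Hilbert space L^2(\<mu>),
  where \<open>l2_directed_convex\<close> finds one g near all of them; this removes the dependence
  of the approximant on the weight.\<close>

lemma psd_imp_interpolation:
  assumes psd: "\<And>f. f \<in> bergman \<Omega> \<Longrightarrow> positive_semidefinite
      (\<chi> i j. (1 - w i * cnj (w j)) * repr_kernel A (weighted_measure \<Omega> f) (z i) (z j))"
    and cl: "closedin (weak_star_Hinf \<Omega>) A"
  obtains \<phi> where "\<phi> \<in> A" "\<And>x. x \<in> \<Omega> \<Longrightarrow> cmod (\<phi> x) \<le> 1" "\<And>i. \<phi> (z i) = w i"
proof -
  define K where "K h e = {d \<in> unit_ball. \<exists>\<psi>\<in>interpolants w. l2_norm (dens h) (\<lambda>x. d x - \<psi> x) \<le> e}" for h e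
  define \<K> where "\<K> = {K h e | h e. h \<in> weights \<and> e > 0}"
  have K_I: "d \<in> K h e" if "d \<in> unit_ball" "\<psi> \<in> interpolants w" "l2_norm (dens h) (\<lambda>x. d x - \<psi> x) \<le> e" for d \<psi> h e
    using that unfolding K_def by blast
  have \<K>_I: "K h e \<in> \<K>" if "h \<in> weights" "e > 0" for h e
    using that unfolding \<K>_def by blast
  have diff_bd: "\<exists>B. \<forall>x. cmod (d x - \<psi> x) \<le> B" and diff_m: "(\<lambda>x. d x - \<psi> x) \<in> borel_measurable \<mu>"
    if "d \<in> unit_ball" "\<psi> \<in> interpolants w" for d \<psi>
  proof -
    have \<psi>: "\<psi> \<in> Hinf \<Omega>" using that A_Hinf by (simp add: interpolants_def)
    obtain B where B: "\<And>x. cmod (\<psi> x) \<le> B" using Hinf_bound[OF \<psi>] by blast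
    have "cmod (d x - \<psi> x) \<le> 1 + B" for x
    proof -
      have "cmod (d x) \<le> 1" using that(1) by (simp add: unit_ball_def)
      then show ?thesis using norm_triangle_ineq4[of "d x" "\<psi> x"] B[of x] by linarith
    qed
    then show "\<exists>B. \<forall>x. cmod (d x - \<psi> x) \<le> B" by blast
    show "(\<lambda>x. d x - \<psi> x) \<in> borel_measurable \<mu>"
      using that(1) Hinf_measurable[OF \<psi>] by (intro borel_measurable_diff) (auto simp: unit_ball_def)
  qed
  have diff_l2: "(\<lambda>x. d x - \<psi> x) \<in> l2_space (dens h)"
    if "d \<in> unit_ball" "\<psi> \<in> interpolants w" "h \<in> weights" for d \<psi> h
    using diff_bd[OF that(1,2)] dens_l2_bounded[OF that(3) diff_m[OF that(1,2)]] by blast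
  have ball_l2: "d \<in> l2_space \<mu>" if "d \<in> unit_ball" for d
    using that l2_finite_bounded[OF finite_\<mu>, of d 1] by (simp add: unit_ball_def)
  have mono: "K k e \<subseteq> K h e'" if hk: "h \<in> weights" "k \<in> weights" "\<And>x. h x \<le> k x" "e \<le> e'" for h k e e'
  proof
    fix d assume "d \<in> K k e"
    then obtain \<psi> where \<psi>: "d \<in> unit_ball" "\<psi> \<in> interpolants w" "l2_norm (dens k) (\<lambda>x. d x - \<psi> x) \<le> e"
      by (auto simp: K_def)
    obtain B where "\<And>x. cmod (d x - \<psi> x) \<le> B" using diff_bd[OF \<psi>(1,2)] by blast
    from dens_norm_mono[OF hk(1-3) diff_m[OF \<psi>(1,2)] this] show "d \<in> K h e'"
      using \<psi> hk(4) unfolding K_def by force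
  qed
  have "\<exists>g\<in>l2_space \<mu>. \<forall>L\<in>\<K>. \<forall>e>0. \<exists>d\<in>L. l2_norm \<mu> (\<lambda>x. g x - d x) < e"
  proof (rule l2_directed_convex[OF finite_\<mu>, where C = "1 * l2_norm \<mu> (\<lambda>x. 1)"])
    show "\<K> \<noteq> {}" using \<K>_I[OF const_weight zero_less_one] by blast
    show "L \<subseteq> l2_space \<mu>" if "L \<in> \<K>" for L using that ball_l2 by (auto simp: \<K>_def K_def)
    show "(\<lambda>x. (g x + k x) / 2) \<in> L" if L: "L \<in> \<K>" "g \<in> L" "k \<in> L" for L g k
    proof -
      obtain h e where h: "L = K h e" "h \<in> weights" using L(1) by (auto simp: \<K>_def)
      obtain \<psi> \<psi>' where \<psi>: "g \<in> unit_ball" "\<psi> \<in> interpolants w" "l2_norm (dens h) (\<lambda>x. g x - \<psi> x) \<le> e"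
        and \<psi>': "k \<in> unit_ball" "\<psi>' \<in> interpolants w" "l2_norm (dens h) (\<lambda>x. k x - \<psi>' x) \<le> e"
        using L(2,3) by (auto simp: h(1) K_def)
      have half: "(\<lambda>x. a x + complex_of_real (1/2) * (b x - a x)) = (\<lambda>x. (a x + b x) / 2)" for a b :: "complex^'d \<Rightarrow> complex"
        by (auto simp: field_simps)
      have 1: "(\<lambda>x. (g x + k x) / 2) \<in> unit_ball"
        using unit_ball_convex[OF \<psi>(1) \<psi>'(1), of "1/2"] unfolding half by simp
      have 2: "(\<lambda>x. (\<psi> x + \<psi>' x) / 2) \<in> interpolants w"
        using interpolants_convex[OF \<psi>(2) \<psi>'(2), of "complex_of_real (1/2)"] unfolding half .
      have "l2_norm (dens h) (\<lambda>x. (g x + k x) / 2 - (\<psi> x + \<psi>' x) / 2) =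
          l2_norm (dens h) (\<lambda>x. (1/2) * ((g x - \<psi> x) + (k x - \<psi>' x)))"
        by (rule arg_cong[where f = "l2_norm (dens h)"]) (auto simp: field_simps)
      also have "\<dots> = 1/2 * l2_norm (dens h) (\<lambda>x. (g x - \<psi> x) + (k x - \<psi>' x))" by (subst l2_norm_scale) simp
      also have "\<dots> \<le> e"
        using l2_norm_triangle[OF diff_l2[OF \<psi>(1,2) h(2)] diff_l2[OF \<psi>'(1,2) h(2)]] \<psi>(3) \<psi>'(3) by linarith
      finally show ?thesis unfolding h(1) by (rule K_I[OF 1 2])
    qed
    show "\<exists>N\<in>\<K>. N \<subseteq> L \<inter> L'" if LL: "L \<in> \<K>" "L' \<in> \<K>" for L L'
    proof -
      obtain h e h' e' where h: "L = K h e" "h \<in> weights" "e > 0" "L' = K h' e'" "h' \<in> weights" "e' > 0"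
        using LL by (auto simp: \<K>_def)
      note hh = weights_add[OF h(2,5)]
      have nn: "h x \<ge> 0" "h' x \<ge> 0" for x using h(2,5) by (auto simp: weights_def)
      have "K (\<lambda>x. h x + h' x) (min e e') \<subseteq> K h e" by (rule mono[OF h(2) hh]) (use nn in auto)
      moreover have "K (\<lambda>x. h x + h' x) (min e e') \<subseteq> K h' e'" by (rule mono[OF h(5) hh]) (use nn in auto)
      moreover have "K (\<lambda>x. h x + h' x) (min e e') \<in> \<K>" by (rule \<K>_I[OF hh]) (use h(3,6) in simp)
      ultimately show ?thesis using h(1,4) by blast
    qed
    show "\<exists>g\<in>L. l2_norm \<mu> g \<le> 1 * l2_norm \<mu> (\<lambda>x. 1)" if L: "L \<in> \<K>" for L
    proof -
      obtain h e where h: "L = K h e" "h \<in> weights" "e > 0" using L by (auto simp: \<K>_def)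
      obtain d \<psi> where d: "d \<in> unit_ball" "\<psi> \<in> interpolants w" "l2_norm (dens h) (\<lambda>x. d x - \<psi> x) < e"
        using unit_ball_near_interpolants[OF psd h(2,3)] by blast
      have "(\<lambda>x. 1) \<in> l2_space \<mu>" by (rule l2_finite_bounded[OF finite_\<mu>, of _ 1]) auto
      then have "l2_norm \<mu> (\<lambda>x. d x * 1) \<le> 1 * l2_norm \<mu> (\<lambda>x. 1)"
        by (rule l2_bounded_mult(2)) (use d(1) in \<open>auto simp: unit_ball_def\<close>)
      moreover have "d \<in> L" unfolding h(1) by (rule K_I[OF d(1,2) less_imp_le[OF d(3)]])
      ultimately show ?thesis by (intro bexI[of _ d]) simp_all
    qed
  qed
  then obtain g where gl: "g \<in> l2_space \<mu>"
    and gK: "\<forall>L\<in>\<K>. \<forall>e>0. \<exists>d\<in>L. l2_norm \<mu> (\<lambda>x. g x - d x) < e" by (elim bexE)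
  have "\<exists>d\<in>K h e. l2_norm \<mu> (\<lambda>x. g x - d x) < e'" if "h \<in> weights" "e > 0" "e' > 0" for h e e'
    using gK[rule_format, OF \<K>_I[OF that(1,2)] that(3)] .
  note g = gl this
  have gm: "g \<in> borel_measurable \<mu>" by (rule l2_spaceD(1)[OF g(1)])
  \<comment> \<open>Elements of \<open>K h (sqrt (e / 4))\<close> tending to g in L^2(\<mu>) have a
    subsequence tending to it in the weighted norm. One of them is within e / 4 of both g and an
    interpolant in squared norm, and (a + b)^2 <= 2 a^2 + 2 b^2 gives e.\<close>
  have near: "(AE x in \<mu>. cmod (g x) \<le> 1) \<and> (\<exists>\<psi>\<in>interpolants w. (\<integral>x. h x * (cmod (g x - \<psi> x))\<^sup>2 \<partial>\<mu>) \<le> e)"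
    if h: "h \<in> weights" and e: "e > 0" for h e
  proof -
    have e4: "sqrt (e / 4) > 0" using e by simp
    have "\<forall>n. \<exists>d. d \<in> K h (sqrt (e / 4)) \<and> l2_norm \<mu> (\<lambda>x. g x - d x) < 1 / Suc n"
    proof
      fix n
      show "\<exists>d. d \<in> K h (sqrt (e / 4)) \<and> l2_norm \<mu> (\<lambda>x. g x - d x) < 1 / Suc n"
        using g(2)[OF h e4, of "1 / Suc n"] by auto
    qed
    from choice[OF this] obtain d where "\<forall>n. d n \<in> K h (sqrt (e / 4)) \<and> l2_norm \<mu> (\<lambda>x. g x - d n x) < 1 / Suc n"
      by (elim exE)
    then have d: "\<And>n. d n \<in> K h (sqrt (e / 4))" "\<And>n. l2_norm \<mu> (\<lambda>x. g x - d n x) < 1 / Suc n" by auto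
    have db: "d n \<in> unit_ball" for n using d(1)[of n] by (simp add: K_def)
    have lim: "(\<lambda>n. l2_norm \<mu> (\<lambda>x. d n x - g x)) \<longlonglongrightarrow> 0"
    proof (rule Lim_null_comparison[OF _ LIMSEQ_Suc[OF lim_const_over_n[of 1]]])
      have "norm (l2_norm \<mu> (\<lambda>x. d n x - g x)) \<le> 1 / Suc n" for n
        using d(2)[of n] l2_norm_minus_commute[of \<mu> g "d n"] by simp
      then show "\<forall>\<^sub>F n in sequentially. norm (l2_norm \<mu> (\<lambda>x. d n x - g x)) \<le> 1 / real (Suc n)" by simp
    qed
    have dm: "d n \<in> borel_measurable \<mu>" "cmod (d n x) \<le> 1" for n x using db[of n] by (auto simp: unit_ball_def)
    note dl = dens_limit[OF h dm g(1) lim]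
    obtain r :: "nat \<Rightarrow> nat" where r: "(\<lambda>n. \<integral>x. h x * (cmod (g x - d (r n) x))\<^sup>2 \<partial>\<mu>) \<longlonglongrightarrow> 0" using dl(2) by blast
    have "e / 4 > 0" using e by simp
    from LIMSEQ_D[OF r this] obtain N
      where N: "\<forall>n\<ge>N. norm ((\<integral>x. h x * (cmod (g x - d (r n) x))\<^sup>2 \<partial>\<mu>) - 0) < e / 4" by (elim exE)
    let ?d = "d (r N)"
    obtain \<psi> where \<psi>: "\<psi> \<in> interpolants w" "l2_norm (dens h) (\<lambda>x. ?d x - \<psi> x) \<le> sqrt (e / 4)"
      using d(1)[of "r N"] by (auto simp: K_def)
    have \<psi>m: "\<psi> \<in> borel_measurable \<mu>" using \<psi>(1) A_Hinf Hinf_measurable by (simp add: interpolants_def)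
    have hnn: "h x \<ge> 0" for x using h by (simp add: weights_def)
    have hm: "h \<in> borel_measurable \<mu>" using h by (auto simp: weights_def)
    have gd_m: "(\<lambda>x. g x - ?d x) \<in> borel_measurable \<mu>" using gm dm(1) by auto
    have i1: "integrable \<mu> (\<lambda>x. h x * (cmod (g x - ?d x))\<^sup>2)"
    proof (rule Bochner_Integration.integrable_bound)
      show "integrable \<mu> (\<lambda>x. 4 * h x)" using h by (simp add: weights_def)
      show "(\<lambda>x. h x * (cmod (g x - ?d x))\<^sup>2) \<in> borel_measurable \<mu>" using hm gd_m by auto
      show "AE x in \<mu>. norm (h x * (cmod (g x - ?d x))\<^sup>2) \<le> norm (4 * h x)"
        using dl(1)
      proof eventually_elim
        case (elim x)
        have "cmod (g x - ?d x) \<le> 2" using norm_triangle_ineq4[of "g x" "?d x"] elim dm(2)[of "r N" x] by linarith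
        then have "(cmod (g x - ?d x))\<^sup>2 \<le> 4" using power_mono[of "cmod (g x - ?d x)" 2 2] by simp
        from mult_left_mono[OF this hnn[of x]] show ?case using hnn[of x] by (simp add: abs_mult mult.commute)
      qed
    qed
    have i2: "integrable \<mu> (\<lambda>x. h x * (cmod (?d x - \<psi> x))\<^sup>2)"
      by (rule dens_integrable[OF h diff_l2[OF db \<psi>(1) h]])
    have pt: "h x * (cmod (g x - \<psi> x))\<^sup>2 \<le> 2 * (h x * (cmod (g x - ?d x))\<^sup>2) + 2 * (h x * (cmod (?d x - \<psi> x))\<^sup>2)" for x
    proof -
      have "(cmod (g x - \<psi> x))\<^sup>2 \<le> (cmod (g x - ?d x) + cmod (?d x - \<psi> x))\<^sup>2"
        using norm_triangle_ineq[of "g x - ?d x" "?d x - \<psi> x"] by (intro power_mono) auto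
      also have "\<dots> \<le> 2 * (cmod (g x - ?d x))\<^sup>2 + 2 * (cmod (?d x - \<psi> x))\<^sup>2"
        using sum_squares_bound[of "cmod (g x - ?d x)" "cmod (?d x - \<psi> x)"] by (simp add: power2_sum)
      finally show ?thesis using mult_left_mono[OF _ hnn[of x]] by (simp add: distrib_left mult.left_commute) (metis distrib_left mult.left_commute)
    qed
    have "(\<integral>x. h x * (cmod (g x - \<psi> x))\<^sup>2 \<partial>\<mu>) \<le>
        (\<integral>x. 2 * (h x * (cmod (g x - ?d x))\<^sup>2) + 2 * (h x * (cmod (?d x - \<psi> x))\<^sup>2) \<partial>\<mu>)"
    proof (rule integral_mono[OF _ _ pt])
      show i3: "integrable \<mu> (\<lambda>x. 2 * (h x * (cmod (g x - ?d x))\<^sup>2) + 2 * (h x * (cmod (?d x - \<psi> x))\<^sup>2))"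
        using i1 i2 by auto
      show "integrable \<mu> (\<lambda>x. h x * (cmod (g x - \<psi> x))\<^sup>2)"
        by (rule Bochner_Integration.integrable_bound[OF i3]) (use hm gm \<psi>m pt hnn in \<open>auto intro!: AE_I2 simp: abs_mult\<close>)
    qed
    also have "\<dots> = 2 * (\<integral>x. h x * (cmod (g x - ?d x))\<^sup>2 \<partial>\<mu>) + 2 * (l2_norm (dens h) (\<lambda>x. ?d x - \<psi> x))\<^sup>2"
      unfolding dens_norm_power2[OF h diff_m[OF db \<psi>(1)]] using i1 i2 by simp
    also have "\<dots> \<le> 2 * (e / 4) + 2 * (e / 4)"
    proof -
      have "(l2_norm (dens h) (\<lambda>x. ?d x - \<psi> x))\<^sup>2 \<le> e / 4"
        using power_mono[OF \<psi>(2), of 2] e by simp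
      then show ?thesis using N[rule_format, OF order_refl] unfolding real_norm_def diff_zero by linarith
    qed
    finally show ?thesis using dl(1) \<psi>(1) by auto
  qed
  \<comment> \<open>Membership in \<open>A\<close> is not evidently stable under limits in
    L^2(\<mu>), but analyticity and the node values are. So g has a representative here, and
    \<open>A\<close> is reached only afterwards through weak-star closedness.\<close>
  define B where "B = {\<phi> \<in> bergman \<Omega>. \<forall>i. \<phi> (z i) = w i}"
  have int_B: "interpolants w \<subseteq> B" using A_Hinf Hinf_subset_bergman by (auto simp: interpolants_def B_def)
  have B_l2: "B \<subseteq> l2_space \<mu>" using bergman_l2 by (auto simp: B_def)
  have "g \<in> l2_closure \<mu> B"
  proof -
    have "\<exists>\<phi>\<in>B \<inter> l2_space \<mu>. l2_norm \<mu> (\<lambda>x. g x - \<phi> x) < e" if e: "e > 0" for e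
    proof -
      have "(e / 2)\<^sup>2 > 0" using e by simp
      then obtain \<psi> where \<psi>: "\<psi> \<in> interpolants w" "(\<integral>x. 1 * (cmod (g x - \<psi> x))\<^sup>2 \<partial>\<mu>) \<le> (e / 2)\<^sup>2"
        using near[OF const_weight] by blast
      then have "(l2_norm \<mu> (\<lambda>x. g x - \<psi> x))\<^sup>2 \<le> (e / 2)\<^sup>2" by (simp add: l2_norm_power2)
      then have "l2_norm \<mu> (\<lambda>x. g x - \<psi> x) \<le> e / 2" using e by (intro power2_le_imp_le[of "l2_norm \<mu> _"]) auto
      then show ?thesis using \<psi>(1) int_B B_l2 e by (intro bexI[of _ \<psi>]) auto
    qed
    then show ?thesis using g(1) by (simp add: l2_closure_def)
  qed
  then have "\<exists>\<phi>\<in>B. l2_norm \<mu> (\<lambda>x. g x - \<phi> x) = 0"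
  proof (rule bergman_closure_representative)
    show "B \<subseteq> bergman \<Omega>" by (auto simp: B_def)
    fix s f assume s: "\<And>n. s n \<in> B" and f: "f \<in> bergman \<Omega>" "\<And>x. (\<lambda>n. s n x) \<longlonglongrightarrow> f x"
    have "f (z i) = w i" for i using f(2)[of "z i"] s by (simp add: B_def LIMSEQ_const_iff)
    then show "f \<in> B" using f(1) by (simp add: B_def)
  qed
  then obtain \<phi> where \<phi>: "\<phi> \<in> bergman \<Omega>" "\<And>i. \<phi> (z i) = w i" "l2_norm \<mu> (\<lambda>x. g x - \<phi> x) = 0"
    by (auto simp: B_def)
  have ae: "AE x in \<mu>. g x = \<phi> x"
  proof -
    have "(\<integral>x. (cmod (g x - \<phi> x))\<^sup>2 \<partial>\<mu>) = 0" using \<phi>(3) l2_norm_power2[of \<mu> "\<lambda>x. g x - \<phi> x"] by simp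
    then have "AE x in \<mu>. (cmod (g x - \<phi> x))\<^sup>2 = 0"
      using l2_spaceD(2)[OF l2_diff[OF g(1) bergman_l2[OF \<phi>(1)]]] by (subst (asm) integral_nonneg_eq_0_iff_AE) auto
    then show ?thesis by eventually_elim simp
  qed
  have \<phi>1: "cmod (\<phi> x) \<le> 1" if "x \<in> \<Omega>" for x
  proof (rule AE_le_imp_le[OF _ _ that])
    show "continuous_on \<Omega> (\<lambda>x. cmod (\<phi> x))"
      by (intro continuous_on_norm analytic_in_continuous bergmanD(2)[OF \<phi>(1)])
    show "AE x in \<mu>. cmod (\<phi> x) \<le> 1"
      using ae near[OF const_weight zero_less_one, THEN conjunct1] by eventually_elim simp
  qed
  have \<phi>H: "\<phi> \<in> Hinf \<Omega>"
    using bergmanD[OF \<phi>(1)] \<phi>1 by (auto simp: Hinf_def intro!: boundedI[of _ 1])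
  have "\<phi> \<in> A"
  proof (rule weak_star_closed[OF cl \<phi>H])
    show "A \<subseteq> Hinf \<Omega>" using A_Hinf by blast
    fix h e assume h: "h \<in> weights" and e: "(e::real) > 0"
    obtain \<psi> where \<psi>: "\<psi> \<in> interpolants w" "(\<integral>x. h x * (cmod (g x - \<psi> x))\<^sup>2 \<partial>\<mu>) \<le> e"
      using near[OF h e] by blast
    have \<psi>A: "\<psi> \<in> A" using \<psi>(1) by (simp add: interpolants_def)
    have m: "\<phi> \<in> borel_measurable \<mu>" "\<psi> \<in> borel_measurable \<mu>" "h \<in> borel_measurable \<mu>"
      using Hinf_measurable[OF \<phi>H] Hinf_measurable[OF A_Hinf[OF \<psi>A]] h by (auto simp: weights_def)
    have "(\<integral>x. h x * (cmod (\<phi> x - \<psi> x))\<^sup>2 \<partial>\<mu>) = (\<integral>x. h x * (cmod (g x - \<psi> x))\<^sup>2 \<partial>\<mu>)"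
      by (rule integral_cong_AE) (use m gm ae in \<open>auto intro!: borel_measurable_times borel_measurable_power borel_measurable_norm\<close>)
    then show "\<exists>\<psi>\<in>A. (\<integral>x. h x * (cmod (\<phi> x - \<psi> x))\<^sup>2 \<partial>\<mu>) \<le> e"
      using \<psi>(2) by (intro bexI[OF _ \<psi>A]) simp
  qed
  then show thesis using \<phi>1 \<phi>(2) by (rule that)
qed

end

theorem theorem1p2:
  fixes \<Omega> :: "(complex^'d) set"
    and z :: "'n::finite \<Rightarrow> complex^'d"
    and w :: "'n \<Rightarrow> complex"
    and A :: "(complex^'d \<Rightarrow> complex) set"
  assumes "bounded_domain \<Omega>"
    and "\<And>i. z i \<in> \<Omega>"
    and "unital_subalgebra \<Omega> A"
    and "closedin (weak_star_Hinf \<Omega>) A"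
  shows "(\<exists>\<phi>\<in>A. (SUP x\<in>\<Omega>. cmod (\<phi> x)) \<le> 1 \<and> (\<forall>i. \<phi> (z i) = w i)) \<longleftrightarrow>
         (\<forall>f\<in>bergman \<Omega>. positive_semidefinite
            (\<chi> i j. (1 - w i * cnj (w j)) * repr_kernel A (weighted_measure \<Omega> f) (z i) (z j)))"
proof -
  interpret pick_data \<Omega> A z
    using assms by unfold_locales (auto simp: bounded_domain_def)
  have ne: "\<Omega> \<noteq> {}" using assms(1) by (simp add: bounded_domain_def)
  show ?thesis
  proof (intro iffI ballI)
    fix f assume f: "f \<in> bergman \<Omega>"
    assume "\<exists>\<phi>\<in>A. (SUP x\<in>\<Omega>. cmod (\<phi> x)) \<le> 1 \<and> (\<forall>i. \<phi> (z i) = w i)"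
    then obtain \<phi> where \<phi>: "\<phi> \<in> A" "(SUP x\<in>\<Omega>. cmod (\<phi> x)) \<le> 1" "\<And>i. \<phi> (z i) = w i" by blast
    obtain B where B: "\<And>x. cmod (\<phi> x) \<le> B" using Hinf_bound[OF A_Hinf[OF \<phi>(1)]] by blast
    have "cmod (\<phi> x) \<le> 1" for x
    proof (cases "x \<in> \<Omega>")
      case True
      \<comment> \<open>The real supremum bounds the values only once the set is known to be bounded
        above.\<close>
      have "bdd_above ((\<lambda>x. cmod (\<phi> x)) ` \<Omega>)" using B by (intro bdd_aboveI2)
      from cSUP_upper[OF True this] show ?thesis using \<phi>(2) by linarith
    next
      case False
      then show ?thesis using A_Hinf[OF \<phi>(1)] by (simp add: Hinf_def)
    qed
    then show "positive_semidefinite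
        (\<chi> i j. (1 - w i * cnj (w j)) * repr_kernel A (weighted_measure \<Omega> f) (z i) (z j))"
      by (intro interpolation_imp_psd[OF f \<phi>(1)] \<phi>(3))
  next
    assume "\<forall>f\<in>bergman \<Omega>. positive_semidefinite
        (\<chi> i j. (1 - w i * cnj (w j)) * repr_kernel A (weighted_measure \<Omega> f) (z i) (z j))"
    then obtain \<phi> where "\<phi> \<in> A" "\<And>x. x \<in> \<Omega> \<Longrightarrow> cmod (\<phi> x) \<le> 1" "\<And>i. \<phi> (z i) = w i"
      using psd_imp_interpolation[OF _ assms(4)] by blast
    then show "\<exists>\<phi>\<in>A. (SUP x\<in>\<Omega>. cmod (\<phi> x)) \<le> 1 \<and> (\<forall>i. \<phi> (z i) = w i)"
      using ne by (intro bexI[of _ \<phi>] conjI cSUP_least) auto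
  qed
qed

end
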